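(* Let $\mathfrak o$ be a compact discrete valuation ring with residue field cardinality $q$ and let $n\ge1$. For all $\lambda\in\mathcal P_{2n}$ and $\mu\in\mathcal P_n$, we have $$N_{\mathfrak o}(\lambda,\mu)=N'_{\mathfrak o}(\lambda,\mu)\,\alpha_n(\mu;q^2).$$
   Context: Let $\mathfrak o$ be a complete discrete valuation ring with finite residue field of cardinality $q$, uniformizer $\pi$, field of fractions $k$. $\mathcal P_r$ is the set of partitions $\lambda=(\lambda_1\ge\dots\ge\lambda_r\ge0)$ with at most $r$ nonzero parts (padded with zeros). For $\lambda\in\mathcal P_r$, $\mathfrak o_\lambda=\bigoplus_{i=1}^r\mathfrak o/\pi^{\lambda_i}$. Lattice count: Let $L=\mathfrak o^{2n}$ with the non-degenerate symplectic form $\langle\,,\rangle$ with Gram matrix $\begin{pmatrix}0&I_n\\-I_n&0\end{pmatrix}$. $N_{\mathfrak o}(\lambda,\mu)$ is the number of finite-index $\mathfrak o$-sublattices $\Lambda\subseteq L$ such that $L/\Lambda\simeq\mathfrak o_\lambda$ and such that $\Lambda$ has an $\mathfrak o$-basis with respect to which $\langle\,,\rangle|_\Lambda$ has Gram matrix $J_\mu=\begin{pmatrix}0&\pi^\mu\\-\pi^\mu&0\end{pmatrix}$, where $\pi^\mu=\mathrm{diag}(\pi^{\mu_1},\dots,\pi^{\mu_n})$. Intrinsic count: Put $M_0=0$ and, for $k\ge1$, $M_k=(\mathfrak o/\pi^k)e\oplus(\mathfrak o/\pi^k)f$ with the perfect alternating $\mathfrak o$-bilinear pairing $M_k\times M_k\to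 k/\mathfrak o$ (here $k/\mathfrak o$ denotes fraction field modulo $\mathfrak o$) given by $(e,f)=\pi^{-k}\bmod\mathfrak o$, $(e,e)=(f,f)=0$. For $\mu=(\mu_1,\dots,\mu_n)$, $M_\mu=M_{\mu_1}\oplus\dots\oplus M_{\mu_n}$ (orthogonal sum). A submodule $N\subseteq M_\mu$ is Lagrangian if $N=N^\perp$. $N'_{\mathfrak o}(\lambda,\mu)$ is the number of Lagrangian submodules $N\subseteq M_\mu$ with $N\simeq\mathfrak o_\lambda$. Birkhoff number: with $[r]_Y=\frac{1-Y^r}{1-Y}$, $[r]_Y!=\prod_{k=1}^r[k]_Y$, and $m_j(\mu)$ the number of $i\in\{1,\dots,n\}$ with $\mu_i=j$, $$\alpha_n(\mu;q)=q^{\sum_{i=1}^n(n+1-2i)\mu_i}\,\frac{[n]_{q^{-1}}!}{\prod_{j\ge0}[m_j(\mu)]_{q^{-1}}!},$$ the number of finite-index sublattices of $\mathfrak o^n$ with quotient isomorphic to $\mathfrak o_\mu$. $\alpha_n(\mu;q^2)$ is obtained by replacing $q$ by $q^2$ in this formula. *)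

theory Defs
  imports
    "HOL-Algebra.Ring_Divisibility"
    "HOL-Analysis.Abstract_Topology"
    "HOL-Computational_Algebra.Polynomial_Factorial"
    "Jordan_Normal_Form.VS_Connect"
begin

section \<open>Discrete valuation rings\<close>

locale dvr = principal_domain R for R :: "('a, 'b) ring_scheme" (structure) +
  assumes not_field: "\<not> field R"
    and local: "\<exists>!P. maximalideal P R"

definition uniformizer :: "('a, 'b) ring_scheme \<Rightarrow> 'a \<Rightarrow> bool" where
  "uniformizer R p \<longleftrightarrow> p \<in> carrier R \<and> maximalideal (PIdl\<^bsub>R\<^esub> p) R"

text \<open>Completeness for the adic topology, in terms of Cauchy sequences.  Separatedness (uniqueness
  of limits) is automatic in a discrete valuation ring.\<close>

definition adic_complete :: "('a, 'b) ring_scheme \<Rightarrow> 'a \<Rightarrow> bool" where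
  "adic_complete R p \<longleftrightarrow>
     (\<forall>x :: nat \<Rightarrow> 'a. (\<forall>i. x i \<in> carrier R) \<longrightarrow>
          (\<forall>k. \<exists>N. \<forall>i\<ge>N. \<forall>j\<ge>N. x i \<ominus>\<^bsub>R\<^esub> x j \<in> PIdl\<^bsub>R\<^esub> (p [^]\<^bsub>R\<^esub> (k::nat))) \<longrightarrow>
          (\<exists>l\<in>carrier R. \<forall>k. \<exists>N. \<forall>i\<ge>N. x i \<ominus>\<^bsub>R\<^esub> l \<in> PIdl\<^bsub>R\<^esub> (p [^]\<^bsub>R\<^esub> (k::nat))))"

text \<open>A compact discrete valuation ring with chosen uniformizer \<open>p\<close> and residue cardinality \<open>q\<close>:
  complete with finite residue field.  Lemma \<open>compact_dvr_iff\<close> at the end of this theory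
  shows that this is the same as compactness in the adic topology.\<close>

locale compact_dvr = dvr R for R :: "('a, 'b) ring_scheme" (structure) +
  fixes p :: 'a and q :: nat
  assumes uniformizer: "uniformizer R p"
    and complete: "adic_complete R p"
    and finite_residue: "finite (carrier (R Quot PIdl p))"
    and residue_card: "card (carrier (R Quot PIdl p)) = q"

definition adic_topology :: "('a, 'b) ring_scheme \<Rightarrow> 'a \<Rightarrow> 'a topology" where
  "adic_topology R p = topology (\<lambda>U. U \<subseteq> carrier R \<and>
     (\<forall>x\<in>U. \<exists>k::nat. PIdl\<^bsub>R\<^esub> (p [^]\<^bsub>R\<^esub> k) +>\<^bsub>R\<^esub> x \<subseteq> U))"


section \<open>Modules\<close>

text \<open>As in the record \<open>module_vec\<close>, the fields \<open>mult\<close> and \<open>one\<close> of a module record are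
  irrelevant.\<close>

definition regular_module :: "('a, 'b) ring_scheme \<Rightarrow> ('a, 'a) module" where
  "regular_module R = \<lparr>carrier = carrier R, mult = mult R, one = one R, zero = zero R,
     add = add R, smult = mult R\<rparr>"

definition quot_module :: "('a, 'm, 'c) module_scheme \<Rightarrow> 'm set \<Rightarrow> ('a, 'm set) module" where
  "quot_module M N = \<lparr>carrier = a_rcosets\<^bsub>M\<^esub> N, mult = undefined, one = undefined, zero = N,
     add = set_add M, smult = (\<lambda>a X. \<Union>x\<in>X. N +>\<^bsub>M\<^esub> (a \<odot>\<^bsub>M\<^esub> x))\<rparr>"

definition dsum_module :: "'i set \<Rightarrow> ('i \<Rightarrow> ('a, 'm, 'c) module_scheme) \<Rightarrow> ('a, 'i \<Rightarrow> 'm) module"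
  where
  "dsum_module I M = \<lparr>carrier = (\<Pi>\<^sub>E i\<in>I. carrier (M i)), mult = undefined, one = undefined,
     zero = (\<lambda>i\<in>I. \<zero>\<^bsub>M i\<^esub>), add = (\<lambda>x y. \<lambda>i\<in>I. x i \<oplus>\<^bsub>M i\<^esub> y i),
     smult = (\<lambda>a x. \<lambda>i\<in>I. a \<odot>\<^bsub>M i\<^esub> x i)\<rparr>"

definition module_isomorphic ::
  "('a, 'r) ring_scheme \<Rightarrow> ('a, 'm, 'c) module_scheme \<Rightarrow> ('a, 'n, 'd) module_scheme \<Rightarrow> bool" where
  "module_isomorphic R M N \<longleftrightarrow> (\<exists>f\<in>module_hom R M N. bij_betw f (carrier M) (carrier N))"

text \<open>Lists are used for ordered bases; the linear algebra takes place inside the submodule.\<close>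

definition ordered_basis :: "('a, 'r) ring_scheme \<Rightarrow> ('a, 'm, 'c) module_scheme \<Rightarrow> 'm list \<Rightarrow> bool"
  where
  "ordered_basis R M bs \<longleftrightarrow> distinct bs \<and> set bs \<subseteq> carrier M \<and>
     \<not> module.lin_dep R M (set bs) \<and> module.span R M (set bs) = carrier M"


section \<open>Partitions and the modules attached to them\<close>

text \<open>A partition with at most \<open>r\<close> nonzero parts is padded with zeros to a list of length \<open>r\<close>;
  the part \<open>\<lambda>\<^sub>i\<close> is entry \<open>i - 1\<close>.\<close>

definition partitions :: "nat \<Rightarrow> nat list set" where
  "partitions r = {l. length l = r \<and> sorted_wrt (\<ge>) l}"

definition cyclic_module :: "'a::idom \<Rightarrow> nat \<Rightarrow> ('a, 'a set) module" where
  "cyclic_module p k = quot_module (regular_module class_ring) (PIdl\<^bsub>class_ring\<^esub> (p ^ k))"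

definition torsion_module :: "'a::idom \<Rightarrow> nat list \<Rightarrow> ('a, nat \<Rightarrow> 'a set) module" where
  "torsion_module p l = dsum_module {..<length l} (\<lambda>i. cyclic_module p (l ! i))"


section \<open>Counting lattices\<close>

definition symp_mat :: "nat \<Rightarrow> 'a::comm_ring_1 mat \<Rightarrow> 'a mat" where
  "symp_mat n D = four_block_mat (0\<^sub>m n n) D (- D) (0\<^sub>m n n)"

definition symp_form :: "nat \<Rightarrow> 'a::comm_ring_1 vec \<Rightarrow> 'a vec \<Rightarrow> 'a" where
  "symp_form n x y = x \<bullet> (symp_mat n (1\<^sub>m n) *\<^sub>v y)"

definition gram_mat :: "nat \<Rightarrow> 'a::comm_ring_1 vec list \<Rightarrow> 'a mat" where
  "gram_mat n bs = mat (length bs) (length bs) (\<lambda>(i, j). symp_form n (bs ! i) (bs ! j))"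

definition lattices :: "'a::idom \<Rightarrow> nat \<Rightarrow> nat list \<Rightarrow> nat list \<Rightarrow> 'a vec set set" where
  "lattices p n lam mu =
     (let L = module_vec TYPE('a) (2 * n) in
      {\<Lambda>. submodule class_ring \<Lambda> L
         \<and> finite (carrier (quot_module L \<Lambda>))
         \<and> module_isomorphic class_ring (quot_module L \<Lambda>) (torsion_module p lam)
         \<and> (\<exists>bs. ordered_basis class_ring (L\<lparr>carrier := \<Lambda>\<rparr>) bs
                 \<and> gram_mat n bs = symp_mat n (mat_diag n (\<lambda>i. p ^ (mu ! i))))})"

definition lattice_count :: "'a::idom \<Rightarrow> nat \<Rightarrow> nat list \<Rightarrow> nat list \<Rightarrow> nat" where
  "lattice_count p n lam mu = card (lattices p n lam mu)"


section \<open>Counting Lagrangian submodules\<close>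

definition fract_module :: "('a::idom, 'a fract) module" where
  "fract_module = \<lparr>carrier = UNIV, mult = (*), one = 1, zero = 0, add = (+),
     smult = (\<lambda>a x. to_fract a * x)\<rparr>"

definition fract_mod_ring :: "('a::idom, 'a fract set) module" where
  "fract_mod_ring = quot_module fract_module (range to_fract)"

text \<open>The pair \<open>(A, B)\<close> stands for \<open>A e + B f\<close>.  For \<open>k = 0\<close> the module is zero, as required.\<close>

definition hyp_module :: "'a::idom \<Rightarrow> nat \<Rightarrow> ('a, 'a set \<times> 'a set) module" where
  "hyp_module p k = direct_sum (cyclic_module p k) (cyclic_module p k)"

text \<open>By bilinearity and \<open>(e,e) = (f,f) = 0\<close>, \<open>(e,f) = - (f,e) = p\<^sup>-\<^sup>k\<close>, the value on
  \<open>a e + b f\<close> and \<open>c e + d f\<close> is the class of \<open>(a d - b c) / p\<^sup>k\<close>.  As in \<open>rcoset_mult\<close>, the union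
  over all representatives is a single coset, because the class does not depend on them.\<close>

definition hyp_pairing :: "'a::idom \<Rightarrow> nat \<Rightarrow> 'a set \<times> 'a set \<Rightarrow> 'a set \<times> 'a set \<Rightarrow> 'a fract set"
  where
  "hyp_pairing p k x y = (\<Union>a\<in>fst x. \<Union>b\<in>snd x. \<Union>c\<in>fst y. \<Union>d\<in>snd y.
     range to_fract +>\<^bsub>fract_module\<^esub> (to_fract (a * d - b * c) / to_fract (p ^ k)))"

definition symp_module :: "'a::idom \<Rightarrow> nat list \<Rightarrow> ('a, nat \<Rightarrow> 'a set \<times> 'a set) module" where
  "symp_module p mu = dsum_module {..<length mu} (\<lambda>i. hyp_module p (mu ! i))"

definition symp_pairing ::
  "'a::idom \<Rightarrow> nat list \<Rightarrow> (nat \<Rightarrow> 'a set \<times> 'a set) \<Rightarrow> (nat \<Rightarrow> 'a set \<times> 'a set) \<Rightarrow> 'a fract set"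
  where
  "symp_pairing p mu x y =
     (\<Oplus>\<^bsub>fract_mod_ring\<^esub> i\<in>{..<length mu}. hyp_pairing p (mu ! i) (x i) (y i))"

definition perp ::
  "'a::idom \<Rightarrow> nat list \<Rightarrow> (nat \<Rightarrow> 'a set \<times> 'a set) set \<Rightarrow> (nat \<Rightarrow> 'a set \<times> 'a set) set" where
  "perp p mu N =
     {x \<in> carrier (symp_module p mu). \<forall>y\<in>N. symp_pairing p mu x y = \<zero>\<^bsub>fract_mod_ring\<^esub>}"

definition lagrangian :: "'a::idom \<Rightarrow> nat list \<Rightarrow> (nat \<Rightarrow> 'a set \<times> 'a set) set \<Rightarrow> bool" where
  "lagrangian p mu N \<longleftrightarrow> submodule class_ring N (symp_module p mu) \<and> N = perp p mu N"

definition lagrangian_count :: "'a::idom \<Rightarrow> nat list \<Rightarrow> nat list \<Rightarrow> nat" where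
  "lagrangian_count p lam mu =
     card {N. lagrangian p mu N \<and>
              module_isomorphic class_ring (symp_module p mu\<lparr>carrier := N\<rparr>) (torsion_module p lam)}"


section \<open>Birkhoff numbers\<close>

definition q_int :: "nat \<Rightarrow> real \<Rightarrow> real" where
  "q_int r Y = (1 - Y ^ r) / (1 - Y)"

definition q_fact :: "nat \<Rightarrow> real \<Rightarrow> real" where
  "q_fact r Y = (\<Prod>k=1..r. q_int k Y)"

text \<open>Values \<open>j\<close> not occurring in \<open>mu\<close> contribute the factor \<open>[0]! = 1\<close> to the product.\<close>

definition birkhoff :: "nat \<Rightarrow> nat list \<Rightarrow> real \<Rightarrow> real" where
  "birkhoff n mu q =
     q powi (\<Sum>i=1..n. (int n + 1 - 2 * int i) * int (mu ! (i - 1))) *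
     (q_fact n (inverse q) / (\<Prod>j\<in>set mu. q_fact (count_list mu j) (inverse q)))"

section \<open>Consistency of the definitions\<close>

lemma cyclic_coset:
  "PIdl\<^bsub>class_ring\<^esub> (p ^ k) +>\<^bsub>regular_module class_ring\<^esub> a = {a + h * p ^ k | h :: 'a::idom. True}"
  unfolding a_r_coset_def r_coset_def cgenideal_def regular_module_def by (auto simp: add.commute)

lemma fract_coset:
  "range to_fract +>\<^bsub>fract_module\<^esub> z = {z + to_fract h | h :: 'a::idom. True}"
  unfolding a_r_coset_def r_coset_def fract_module_def by (auto simp: add.commute)

lemma hyp_pairing_coset:
  fixes p a b c d :: "'a::idom" and k :: nat
  assumes p: "p \<noteq> 0"
  defines "coset x \<equiv> PIdl\<^bsub>class_ring\<^esub> (p ^ k) +>\<^bsub>regular_module class_ring\<^esub> x"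
  shows "hyp_pairing p k (coset a, coset b) (coset c, coset d) =
    range to_fract +>\<^bsub>fract_module\<^esub> (to_fract (a * d - b * c) / to_fract (p ^ k))"
proof -
  let ?v = "\<lambda>a b c d. to_fract (a * d - b * c) / to_fract (p ^ k)"
  have same: "range to_fract +>\<^bsub>fract_module\<^esub> ?v a' b' c' d' = range to_fract +>\<^bsub>fract_module\<^esub> ?v a b c d"
    if "a' \<in> coset a" "b' \<in> coset b" "c' \<in> coset c" "d' \<in> coset d" for a' b' c' d'
  proof -
    obtain r s t u where *: "a' = a + r * p ^ k" "b' = b + s * p ^ k" "c' = c + t * p ^ k"
      "d' = d + u * p ^ k"
      using \<open>a' \<in> _\<close> \<open>b' \<in> _\<close> \<open>c' \<in> _\<close> \<open>d' \<in> _\<close> unfolding coset_def cyclic_coset by auto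
    define w where "w = a * u + r * d + r * u * p ^ k - b * t - s * c - s * t * p ^ k"
    have "a' * d' - b' * c' = (a * d - b * c) + w * p ^ k"
      unfolding * w_def by (simp add: algebra_simps)
    then have "to_fract (a' * d' - b' * c') = to_fract (a * d - b * c) + to_fract w * to_fract (p ^ k)"
      by (simp only: to_fract_add to_fract_mult)
    moreover have "to_fract (p ^ k) \<noteq> 0" using p by simp
    ultimately have v: "?v a' b' c' d' = ?v a b c d + to_fract w"
      by (simp add: field_simps)
    show ?thesis unfolding fract_coset v
    proof (intro equalityI subsetI)
      fix y assume "y \<in> {?v a b c d + to_fract w + to_fract h | h. True}"
      then obtain h where "y = ?v a b c d + to_fract w + to_fract h" by blast
      then have "y = ?v a b c d + to_fract (w + h)" by (simp only: to_fract_add add.assoc)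
      then show "y \<in> {?v a b c d + to_fract h | h. True}" by blast
    next
      fix y assume "y \<in> {?v a b c d + to_fract h | h. True}"
      then obtain h where "y = ?v a b c d + to_fract h" by blast
      then have "y = ?v a b c d + to_fract w + to_fract (h - w)" by simp
      then show "y \<in> {?v a b c d + to_fract w + to_fract h | h. True}" by blast
    qed
  qed
  have mem: "x \<in> coset x" for x
    unfolding coset_def cyclic_coset by (auto intro: exI[of _ 0])
  show ?thesis
    unfolding hyp_pairing_def fst_conv snd_conv
    using mem[of a] mem[of b] mem[of c] mem[of d] same by blast
qed

context cring
begin

lemma adic_coset:
  assumes p: "p \<in> carrier R" and x: "x \<in> carrier R"
  shows "PIdl (p [^] (k::nat)) +> x = {y \<in> carrier R. y \<ominus> x \<in> PIdl (p [^] k)}"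
proof -
  interpret I: ideal "PIdl (p [^] k)" R
    using p by (simp add: cgenideal_ideal)
  show ?thesis
  proof (intro equalityI subsetI)
    fix y assume "y \<in> PIdl (p [^] k) +> x"
    then obtain h where h: "h \<in> PIdl (p [^] k)" "y = h \<oplus> x"
      unfolding a_r_coset_def' by blast
    then have hc: "h \<in> carrier R" using I.Icarr by blast
    then have "y \<ominus> x = h" using h(2) x by (simp add: a_minus_def a_assoc r_neg)
    then show "y \<in> {y \<in> carrier R. y \<ominus> x \<in> PIdl (p [^] k)}" using h hc x by simp
  next
    fix y assume y: "y \<in> {y \<in> carrier R. y \<ominus> x \<in> PIdl (p [^] k)}"
    then have "y = (y \<ominus> x) \<oplus> x" using x by (simp add: a_minus_def a_assoc l_neg)
    then show "y \<in> PIdl (p [^] k) +> x" using y unfolding a_r_coset_def' by blast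
  qed
qed

lemma adic_trans:
  assumes p: "p \<in> carrier R" and c: "x \<in> carrier R" "y \<in> carrier R" "z \<in> carrier R"
    and "x \<ominus> y \<in> PIdl (p [^] (k::nat))" "y \<ominus> z \<in> PIdl (p [^] k)"
  shows "x \<ominus> z \<in> PIdl (p [^] k)"
proof -
  interpret I: ideal "PIdl (p [^] k)" R
    using p by (simp add: cgenideal_ideal)
  have "(x \<ominus> y) \<oplus> (y \<ominus> z) = x \<ominus> z"
    using c by algebra
  then show ?thesis using I.a_closed assms(5,6) by metis
qed

lemma adic_sym:
  assumes p: "p \<in> carrier R" and c: "x \<in> carrier R" "y \<in> carrier R"
    and "x \<ominus> y \<in> PIdl (p [^] (k::nat))"
  shows "y \<ominus> x \<in> PIdl (p [^] k)"
proof -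
  interpret I: ideal "PIdl (p [^] k)" R
    using p by (simp add: cgenideal_ideal)
  have "\<ominus> (x \<ominus> y) = y \<ominus> x" using c by algebra
  then show ?thesis using I.a_inv_closed assms(4) by metis
qed

lemma adic_refl:
  assumes p: "p \<in> carrier R" and c: "x \<in> carrier R"
  shows "x \<ominus> x \<in> PIdl (p [^] (k::nat))"
proof -
  interpret I: ideal "PIdl (p [^] k)" R
    using p by (simp add: cgenideal_ideal)
  show ?thesis using c I.zero_closed by (simp add: a_minus_def r_neg)
qed

lemma adic_mono:
  assumes p: "p \<in> carrier R" and "k \<le> m"
  shows "PIdl (p [^] (m::nat)) \<subseteq> PIdl (p [^] k)"
proof
  fix y assume "y \<in> PIdl (p [^] m)"
  then obtain z where z: "z \<in> carrier R" "y = z \<otimes> p [^] m" unfolding cgenideal_def by blast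
  have "p [^] m = p [^] (m - k) \<otimes> p [^] k" using assms by (simp add: nat_pow_mult)
  then have "y = (z \<otimes> p [^] (m - k)) \<otimes> p [^] k" using z p by (simp add: m_assoc)
  then show "y \<in> PIdl (p [^] k)" unfolding cgenideal_def using z p by blast
qed

lemma openin_adic:
  assumes p: "p \<in> carrier R"
  shows "openin (adic_topology R p) U \<longleftrightarrow>
    U \<subseteq> carrier R \<and> (\<forall>x\<in>U. \<exists>k::nat. {y \<in> carrier R. y \<ominus> x \<in> PIdl (p [^] k)} \<subseteq> U)"
proof -
  let ?D = "\<lambda>k x. {y \<in> carrier R. y \<ominus> x \<in> PIdl (p [^] (k::nat))}"
  let ?O = "\<lambda>U. U \<subseteq> carrier R \<and> (\<forall>x\<in>U. \<exists>k::nat. PIdl (p [^] k) +> x \<subseteq> U)"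
  have eq: "?O U \<longleftrightarrow> U \<subseteq> carrier R \<and> (\<forall>x\<in>U. \<exists>k. ?D k x \<subseteq> U)" for U
  proof -
    have "PIdl (p [^] k) +> x = ?D k x" if "U \<subseteq> carrier R" "x \<in> U" for k :: nat and x
      using adic_coset[OF p] that by blast
    then show ?thesis by (intro conj_cong ball_cong refl) simp
  qed
  have "istopology ?O"
    unfolding istopology_def eq
  proof (intro conjI allI impI)
    fix S T
    assume S: "S \<subseteq> carrier R \<and> (\<forall>x\<in>S. \<exists>k. ?D k x \<subseteq> S)"
      and T: "T \<subseteq> carrier R \<and> (\<forall>x\<in>T. \<exists>k. ?D k x \<subseteq> T)"
    show "S \<inter> T \<subseteq> carrier R" using S by blast
    show "\<forall>x\<in>S \<inter> T. \<exists>k. ?D k x \<subseteq> S \<inter> T"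
    proof
      fix x assume "x \<in> S \<inter> T"
      then obtain k m where "?D k x \<subseteq> S" "?D m x \<subseteq> T" using S T by blast
      then have "?D (max k m) x \<subseteq> S \<inter> T"
        using adic_mono[OF p, of k "max k m"] adic_mono[OF p, of m "max k m"] by auto
      then show "\<exists>k. ?D k x \<subseteq> S \<inter> T" by blast
    qed
  next
    fix \<K> assume "\<forall>K\<in>\<K>. K \<subseteq> carrier R \<and> (\<forall>x\<in>K. \<exists>k. ?D k x \<subseteq> K)"
    then have K: "\<And>K. K \<in> \<K> \<Longrightarrow> K \<subseteq> carrier R"
      "\<And>K x. K \<in> \<K> \<Longrightarrow> x \<in> K \<Longrightarrow> \<exists>k. ?D k x \<subseteq> K" by auto
    show "\<Union>\<K> \<subseteq> carrier R" using K(1) by (rule Union_least)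
    show "\<forall>x\<in>\<Union>\<K>. \<exists>k. ?D k x \<subseteq> \<Union>\<K>"
    proof
      fix x assume "x \<in> \<Union>\<K>"
      then obtain K where "K \<in> \<K>" "x \<in> K" by (rule UnionE)
      then obtain k where "?D k x \<subseteq> K" using K(2) by meson
      then show "\<exists>k. ?D k x \<subseteq> \<Union>\<K>" using \<open>K \<in> \<K>\<close> by (meson Union_upper order_trans)
    qed
  qed
  then show ?thesis
    unfolding adic_topology_def by (subst topology_inverse') (simp_all only: eq)
qed

lemma topspace_adic:
  assumes "p \<in> carrier R"
  shows "topspace (adic_topology R p) = carrier R"
proof
  show "topspace (adic_topology R p) \<subseteq> carrier R"
    using openin_adic[OF assms, of "topspace (adic_topology R p)"] by simp
  have "openin (adic_topology R p) (carrier R)"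
    unfolding openin_adic[OF assms] by auto
  then show "carrier R \<subseteq> topspace (adic_topology R p)" by (rule openin_subset)
qed

lemma openin_adic_coset:
  assumes p: "p \<in> carrier R" and x: "x \<in> carrier R"
  shows "openin (adic_topology R p) {y \<in> carrier R. y \<ominus> x \<in> PIdl (p [^] (k::nat))}"
  unfolding openin_adic[OF p] using adic_trans[OF p _ _ x] by blast

lemma compact_adic_iff:
  assumes p: "p \<in> carrier R"
  shows "compact_space (adic_topology R p) \<longleftrightarrow>
         adic_complete R p \<and> finite (carrier (R Quot PIdl p))"
proof -
  let ?D = "\<lambda>k x. {y \<in> carrier R. y \<ominus> x \<in> PIdl (p [^] (k::nat))}"
  have D_refl: "x \<in> ?D k x" if "x \<in> carrier R" for k x
    using adic_refl[OF p that] that by simp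
  have carQ: "carrier (R Quot PIdl p) = ?D 1 ` carrier R"
  proof -
    have "carrier (R Quot PIdl p) = (\<lambda>x. PIdl p +> x) ` carrier R"
      unfolding FactRing_def A_RCOSETS_def' by auto
    also have "\<dots> = ?D 1 ` carrier R"
      using adic_coset[OF p, of _ 1] p by (intro image_cong) auto
    finally show ?thesis .
  qed
  show ?thesis
  proof (intro iffI conjI)
    assume comp: "compact_space (adic_topology R p)"
    have cov: "\<exists>F. finite F \<and> F \<subseteq> carrier R \<and> carrier R \<subseteq> (\<Union>x\<in>F. ?D (k x) x)" for k :: "_ \<Rightarrow> nat"
    proof -
      have "\<forall>U\<in>(\<lambda>x. ?D (k x) x) ` carrier R. openin (adic_topology R p) U"
        using openin_adic_coset[OF p] by blast
      moreover have "carrier R \<subseteq> \<Union> ((\<lambda>x. ?D (k x) x) ` carrier R)"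
        using D_refl by blast
      ultimately obtain \<F> where "finite \<F>" "\<F> \<subseteq> (\<lambda>x. ?D (k x) x) ` carrier R" "carrier R \<subseteq> \<Union>\<F>"
        using comp unfolding compact_space_def compactin_def topspace_adic[OF p] by meson
      then show ?thesis by (metis (no_types, lifting) finite_subset_image)
    qed
    show "finite (carrier (R Quot PIdl p))"
    proof -
      obtain F where F: "finite F" "F \<subseteq> carrier R" "carrier R \<subseteq> (\<Union>x\<in>F. ?D 1 x)"
        using cov[of "\<lambda>_. 1"] by auto
      have "?D 1 ` carrier R \<subseteq> ?D 1 ` F"
      proof
        fix X assume "X \<in> ?D 1 ` carrier R"
        then obtain x where x: "x \<in> carrier R" "X = ?D 1 x" by blast
        then obtain t where t: "t \<in> F" "x \<ominus> t \<in> PIdl (p [^] (1::nat))" using F(3) by blast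
        have tc: "t \<in> carrier R" using t F by blast
        have "?D 1 x = ?D 1 t"
          using adic_trans[OF p _ x(1) tc _ t(2)]
            adic_trans[OF p _ tc x(1) _ adic_sym[OF p x(1) tc t(2)]] by blast
        then show "X \<in> ?D 1 ` F" using x t by blast
      qed
      then show ?thesis unfolding carQ using F(1) finite_surj by blast
    qed
    show "adic_complete R p"
      unfolding adic_complete_def
    proof (intro allI impI)
      fix x :: "nat \<Rightarrow> 'a"
      assume xc: "\<forall>i. x i \<in> carrier R"
        and cau: "\<forall>k. \<exists>N. \<forall>i\<ge>N. \<forall>j\<ge>N. x i \<ominus> x j \<in> PIdl (p [^] (k::nat))"
      show "\<exists>l\<in>carrier R. \<forall>k. \<exists>N. \<forall>i\<ge>N. x i \<ominus> l \<in> PIdl (p [^] (k::nat))"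
      proof (rule ccontr)
        assume "\<not> ?thesis"
        then have "\<forall>l\<in>carrier R. \<exists>k::nat. \<forall>N. \<exists>i\<ge>N. x i \<ominus> l \<notin> PIdl (p [^] k)" by blast
        then obtain k :: "_ \<Rightarrow> nat"
          where k: "\<And>l N. l \<in> carrier R \<Longrightarrow> \<exists>i\<ge>N. x i \<ominus> l \<notin> PIdl (p [^] k l)" by metis
        obtain F where F: "finite F" "F \<subseteq> carrier R" "carrier R \<subseteq> (\<Union>x\<in>F. ?D (k x) x)"
          using cov[of k] by blast
        obtain K where K: "\<And>l. l \<in> F \<Longrightarrow> k l \<le> K"
          using F(1) by (metis finite_imageI finite_nat_set_iff_bounded_le imageI)
        obtain N where N: "\<And>i j. i \<ge> N \<Longrightarrow> j \<ge> N \<Longrightarrow> x i \<ominus> x j \<in> PIdl (p [^] K)"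
          using cau by meson
        obtain l where l: "l \<in> F" "x N \<ominus> l \<in> PIdl (p [^] k l)" using F(3) xc by blast
        have lc: "l \<in> carrier R" using l F by blast
        have "x i \<ominus> l \<in> PIdl (p [^] k l)" if "i \<ge> N" for i
          using adic_trans[OF p _ _ lc _ l(2), of "x i"] xc N[OF that order_refl]
            adic_mono[OF p K[OF l(1)]] by blast
        then show False using k[OF lc, of N] by blast
      qed
    qed
  next
    assume "adic_complete R p \<and> finite (carrier (R Quot PIdl p))"
    then have compl: "adic_complete R p" and "finite (?D 1 ` carrier R)"
      unfolding carQ by auto
    then obtain T where T: "T \<subseteq> carrier R" "finite T" "?D 1 ` carrier R = ?D 1 ` T"
      using finite_subset_image[OF _ subset_refl] by meson
    have rep: "\<exists>t\<in>T. z \<ominus> t \<in> PIdl p" if "z \<in> carrier R" for z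
    proof -
      have "?D 1 z \<in> ?D 1 ` T" unfolding T(3)[symmetric] using that by (rule imageI)
      then obtain t where "t \<in> T" "?D 1 z = ?D 1 t" by blast
      then show ?thesis using D_refl[OF that, of 1] p by auto
    qed
    show "compact_space (adic_topology R p)"
      unfolding compact_space_def compactin_def topspace_adic[OF p]
    proof (intro conjI allI impI order_refl)
      fix \<U> assume "Ball \<U> (openin (adic_topology R p)) \<and> carrier R \<subseteq> \<Union>\<U>"
      then have op: "\<And>U. U \<in> \<U> \<Longrightarrow> openin (adic_topology R p) U" and cv: "carrier R \<subseteq> \<Union>\<U>" by auto
      let ?good = "\<lambda>S. \<exists>\<F>. finite \<F> \<and> \<F> \<subseteq> \<U> \<and> S \<subseteq> \<Union>\<F>"
      show "?good (carrier R)"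
      proof (rule ccontr)
        assume nb: "\<not> ?good (carrier R)"
        have step: "\<exists>y. (y \<in> carrier R \<and> \<not> ?good (?D (Suc k) y)) \<and> y \<ominus> x \<in> PIdl (p [^] k)"
          if x: "x \<in> carrier R \<and> \<not> ?good (?D k x)" for x k
        proof (rule ccontr)
          assume "\<not> ?thesis"
          then have g: "\<And>y. y \<in> carrier R \<Longrightarrow> y \<ominus> x \<in> PIdl (p [^] k) \<Longrightarrow> ?good (?D (Suc k) y)"
            by blast
          have gt: "?good (?D (Suc k) (x \<oplus> t \<otimes> p [^] k))" if "t \<in> T" for t
          proof (rule g)
            have tc: "t \<in> carrier R" using that T by blast
            show "x \<oplus> t \<otimes> p [^] k \<in> carrier R" using x tc p by simp
            have "x \<in> carrier R" using x by simp
            then have "(x \<oplus> t \<otimes> p [^] k) \<ominus> x = t \<otimes> p [^] k"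
              using tc nat_pow_closed[OF p, of k] by algebra
            then show "(x \<oplus> t \<otimes> p [^] k) \<ominus> x \<in> PIdl (p [^] k)"
              unfolding cgenideal_def using tc by blast
          qed
          then have "\<forall>t\<in>T. ?good (?D (Suc k) (x \<oplus> t \<otimes> p [^] k))" by (rule ballI)
          from bchoice[OF this] obtain \<G> where G: "\<forall>t\<in>T. finite (\<G> t) \<and> \<G> t \<subseteq> \<U> \<and>
              ?D (Suc k) (x \<oplus> t \<otimes> p [^] k) \<subseteq> \<Union>(\<G> t)" by (rule exE)
          have "?D k x \<subseteq> (\<Union>t\<in>T. ?D (Suc k) (x \<oplus> t \<otimes> p [^] k))"
          proof
            fix y assume y: "y \<in> ?D k x"
            then obtain z where z: "z \<in> carrier R" "y \<ominus> x = z \<otimes> p [^] k"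
              unfolding cgenideal_def by blast
            obtain t where t: "t \<in> T" "z \<ominus> t \<in> PIdl p" using rep[OF z(1)] by blast
            have tc: "t \<in> carrier R" using t T by blast
            obtain w where w: "w \<in> carrier R" "z \<ominus> t = w \<otimes> p"
              using t(2) unfolding cgenideal_def by blast
            have pk: "p [^] k \<in> carrier R" using p by simp
            have xc: "x \<in> carrier R" and yc: "y \<in> carrier R" using x y by simp_all
            have "y \<ominus> (x \<oplus> t \<otimes> p [^] k) = (y \<ominus> x) \<ominus> t \<otimes> p [^] k"
              using yc xc tc pk by algebra
            also have "\<dots> = (z \<ominus> t) \<otimes> p [^] k" unfolding z(2) using z(1) tc pk by algebra
            also have "\<dots> = w \<otimes> p [^] Suc k" unfolding w(2) nat_pow_Suc using w(1) p pk by algebra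
            finally have "y \<ominus> (x \<oplus> t \<otimes> p [^] k) \<in> PIdl (p [^] Suc k)"
              unfolding cgenideal_def using w(1) by blast
            then show "y \<in> (\<Union>t\<in>T. ?D (Suc k) (x \<oplus> t \<otimes> p [^] k))" using t(1) y by blast
          qed
          also have "\<dots> \<subseteq> \<Union> (\<Union>t\<in>T. \<G> t)"
          proof (rule UN_least)
            fix t assume t: "t \<in> T"
            have "?D (Suc k) (x \<oplus> t \<otimes> p [^] k) \<subseteq> \<Union> (\<G> t)"
              using bspec[OF G t] by (elim conjE)
            also have "\<dots> \<subseteq> \<Union> (\<Union>t\<in>T. \<G> t)" using t by (intro Union_mono UN_upper)
            finally show "?D (Suc k) (x \<oplus> t \<otimes> p [^] k) \<subseteq> \<Union> (\<Union>t\<in>T. \<G> t)" .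
          qed
          finally have "?D k x \<subseteq> \<Union> (\<Union>t\<in>T. \<G> t)" .
          moreover have "finite (\<Union>t\<in>T. \<G> t)" "(\<Union>t\<in>T. \<G> t) \<subseteq> \<U>"
            using G T(2) by (simp, intro UN_least) simp
          ultimately have "?good (?D k x)" by (intro exI[of _ "\<Union>t\<in>T. \<G> t"] conjI)
          then show False using x by simp
        qed
        have "PIdl (p [^] (0::nat)) = carrier R" unfolding cgenideal_def by force
        then have "?D 0 \<zero> = carrier R" by auto
        then have base: "\<zero> \<in> carrier R \<and> \<not> ?good (?D 0 \<zero>)" using nb by simp
        have "\<exists>f. \<forall>k. (f k \<in> carrier R \<and> \<not> ?good (?D k (f k))) \<and>
            f (Suc k) \<ominus> f k \<in> PIdl (p [^] k)"
        proof (rule dependent_nat_choice)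
          show "\<exists>x. x \<in> carrier R \<and> \<not> ?good (?D 0 x)" using base by (rule exI)
          fix x k assume "x \<in> carrier R \<and> \<not> ?good (?D k x)"
          then show "\<exists>y. (y \<in> carrier R \<and> \<not> ?good (?D (Suc k) y)) \<and> y \<ominus> x \<in> PIdl (p [^] k)"
            by (rule step)
        qed
        then obtain f where "\<forall>k. (f k \<in> carrier R \<and> \<not> ?good (?D k (f k))) \<and>
            f (Suc k) \<ominus> f k \<in> PIdl (p [^] k)" by (rule exE)
        then have f: "\<And>k. f k \<in> carrier R" "\<And>k. \<not> ?good (?D k (f k))"
          "\<And>k. f (Suc k) \<ominus> f k \<in> PIdl (p [^] k)" by simp_all
        have fd: "f j \<ominus> f k \<in> PIdl (p [^] k)" if "j \<ge> k" for j k
          using that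
        proof (induction j rule: dec_induct)
          case base
          show ?case using adic_refl[OF p f(1)] .
        next
          case (step j)
          then show ?case
            using adic_trans[OF p, of "f (Suc j)" "f j" "f k" k] f(1) f(3)[of j]
              adic_mono[OF p, of k j] by auto
        qed
        have "f i \<ominus> f j \<in> PIdl (p [^] k)" if "i \<ge> k" "j \<ge> k" for i j k
          using adic_trans[OF p f(1) f(1) f(1) fd adic_sym[OF p f(1) f(1) fd]] that by blast
        then have "\<forall>k. \<exists>N. \<forall>i\<ge>N. \<forall>j\<ge>N. f i \<ominus> f j \<in> PIdl (p [^] (k::nat))" by blast
        then have "\<exists>l\<in>carrier R. \<forall>k. \<exists>N. \<forall>i\<ge>N. f i \<ominus> l \<in> PIdl (p [^] (k::nat))"
          using compl f(1) unfolding adic_complete_def by simp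
        then obtain l where l: "l \<in> carrier R"
          "\<forall>k. \<exists>N. \<forall>i\<ge>N. f i \<ominus> l \<in> PIdl (p [^] (k::nat))" by (rule bexE)
        then obtain U where U: "U \<in> \<U>" "l \<in> U" using cv by blast
        then obtain m where m: "?D m l \<subseteq> U" using op[OF U(1)] unfolding openin_adic[OF p] by blast
        obtain N where N: "\<And>i. i \<ge> N \<Longrightarrow> f i \<ominus> l \<in> PIdl (p [^] m)"
          using l(2) by blast
        let ?i = "max N m"
        have "?D ?i (f ?i) \<subseteq> ?D m l"
        proof (clarify, rule adic_trans[OF p _ _ l(1), of _ "f ?i"])
          fix y assume "y \<in> carrier R" "y \<ominus> f ?i \<in> PIdl (p [^] ?i)"
          then show "y \<in> carrier R" "f ?i \<in> carrier R" "y \<ominus> f ?i \<in> PIdl (p [^] m)"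
            "f ?i \<ominus> l \<in> PIdl (p [^] m)"
            using f(1) adic_mono[OF p, of m ?i] N[of ?i] by auto
        qed
        then have "?D ?i (f ?i) \<subseteq> U" using m by (rule subset_trans)
        then have "?good (?D ?i (f ?i))" using U(1) by (intro exI[of _ "{U}"]) simp
        then show False using f(2)[of ?i] by contradiction
      qed
    qed
  qed
qed

end

lemma compact_dvr_iff:
  "compact_dvr R p q \<longleftrightarrow> dvr R \<and> uniformizer R p \<and> compact_space (adic_topology R p) \<and>
     card (carrier (R Quot (PIdl\<^bsub>R\<^esub> p))) = q"
proof (cases "dvr R \<and> p \<in> carrier R")
  case True
  then interpret dvr R by simp
  show ?thesis
    using compact_adic_iff[of p] True dvr_axioms
    unfolding compact_dvr_def compact_dvr_axioms_def by blast
next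
  case False
  then show ?thesis
    unfolding compact_dvr_def compact_dvr_axioms_def uniformizer_def by blast
qed

end

theory Submission
  imports Defs "HOL-Library.Function_Algebras"
begin

text \<open>Let \<open>k\<close> be the fraction field, \<open>L0\<close> the standard lattice in the symplectic space \<open>k\<^sup>2\<^sup>n\<close> with
  symplectic basis \<open>E i\<close>, \<open>F i\<close>, and \<open>\<Lambda>\<^sub>\<mu>\<close> the lattice with basis \<open>\<pi>\<^bsup>\<mu> i\<^esup> E i\<close>, \<open>F i\<close>.  The symplectic
  group \<open>G\<close> is transitive on symplectic bases, so the sublattices of \<open>L0\<close> that have a basis with
  Gram matrix of type \<open>\<mu>\<close> are the lattices \<open>g \<Lambda>\<^sub>\<mu> \<subseteq> L0\<close> with \<open>g\<close> in \<open>G\<close>.  On the other side, the dual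
  of \<open>\<Lambda>\<^sub>\<mu>\<close> modulo \<open>\<Lambda>\<^sub>\<mu>\<close>, with the pairing induced by the form, is the module \<open>M\<^sub>\<mu>\<close>.  Hence its
  Lagrangian submodules correspond to the self-dual lattices \<open>X \<supseteq> \<Lambda>\<^sub>\<mu>\<close>, the submodule being
  \<open>X / \<Lambda>\<^sub>\<mu>\<close>, and by Gram-Schmidt (\<open>self_dual_orbit\<close>) the self-dual lattices are the lattices \<open>g L0\<close>.

  Let \<open>X\<close> and \<open>\<Lambda>\<close> be related when \<open>\<Lambda> \<subseteq> X\<close> and \<open>X / \<Lambda>\<close> is the torsion module of type \<open>\<lambda>\<close>.  This
  relation is \<open>G\<close>-invariant, and the two numbers to be compared count the \<open>\<Lambda>\<close> in the orbit of \<open>\<Lambda>\<^sub>\<mu>\<close>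
  related to \<open>L0\<close> and the \<open>X\<close> in the orbit of \<open>L0\<close> related to \<open>\<Lambda>\<^sub>\<mu>\<close>.  Counting pairs orbit by orbit
  (\<open>card_related\<close>), an orbit of pairs contributes to the two numbers in the ratio
  \<open>[G\<^sub>X : G\<^sub>X \<inter> G\<^sub>\<Lambda>] / [G\<^sub>\<Lambda> : G\<^sub>X \<inter> G\<^sub>\<Lambda>]\<close> for a pair \<open>(X, \<Lambda>)\<close> in it.  This ratio, called the
  index below, is the quotient of the Haar measures of the two stabilizers.  It is multiplicative
  along chains of lattices, and it is trivial within the orbit of \<open>L0\<close> (\<open>index_L0_orbit\<close>), because
  every transvection is conjugate to one that stabilizes \<open>L0\<close>.  So it is the same for all orbits of
  pairs, namely the index of \<open>L0\<close> and \<open>\<Lambda>\<^sub>\<mu>\<close>.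

  It remains to evaluate that index.  When one part of \<open>\<mu>\<close> is lowered by one, each of the two lattices
  has as many translates under the stabilizer of the other as there are lines in a space over the
  residue field outside a coordinate subspace (\<open>index_step\<close>).  All dimensions are even, as each part
  stands for a hyperbolic plane, which is why \<open>q\<^sup>2\<close> takes the place of \<open>q\<close>.  Taking off the boxes of
  \<open>\<mu>\<close> one at a time from the last nonzero part gives a product of such ratios, and it is the Birkhoff
  number (\<open>index_birkhoff\<close>).\<close>

section \<open>The index cocycle of a group acting with finite suborbits\<close>

text \<open>The elements of \<open>Y\<close> play the role of points.  Finiteness of the orbits of a stabilizer replaces
  the topology in which stabilizers of lattices are compact and open.\<close>

locale set_action =
  fixes G :: "('v \<Rightarrow> 'v) set" and Y :: "'v set set"
  assumes id_in: "id \<in> G"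
    and comp_in: "g \<in> G \<Longrightarrow> h \<in> G \<Longrightarrow> g \<circ> h \<in> G"
    and inv_in: "g \<in> G \<Longrightarrow> \<exists>h\<in>G. h \<circ> g = id \<and> g \<circ> h = id"
    and image_in: "g \<in> G \<Longrightarrow> x \<in> Y \<Longrightarrow> g ` x \<in> Y"
    and finite_suborbit: "x \<in> Y \<Longrightarrow> y \<in> Y \<Longrightarrow> finite {g ` y |g. g \<in> G \<and> g ` x = x}"
begin

definition suborbit :: "'v set \<Rightarrow> 'v set \<Rightarrow> 'v set set" where
  "suborbit x y = {g ` y |g. g \<in> G \<and> g ` x = x}"

text \<open>This is \<open>[G\<^sub>x : G\<^sub>x \<inter> G\<^sub>y] / [G\<^sub>y : G\<^sub>x \<inter> G\<^sub>y]\<close>, the ratio of the volumes of the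
  stabilizers for a Haar measure.\<close>

definition index :: "'v set \<Rightarrow> 'v set \<Rightarrow> real" where
  "index x y = real (card (suborbit x y)) / real (card (suborbit y x))"

lemma inverse_obtain:
  assumes "g \<in> G"
  obtains h where "h \<in> G" "h \<circ> g = id" "g \<circ> h = id" "\<And>s. h ` g ` s = s" "\<And>s. g ` h ` s = s"
proof -
  obtain h where h: "h \<in> G" "h \<circ> g = id" "g \<circ> h = id" using inv_in[OF assms] by blast
  have "h ` g ` s = s" "g ` h ` s = s" for s
    using h(2,3) by (simp_all add: image_comp)
  then show thesis by (rule that[OF h])
qed

lemma suborbitI: "g \<in> G \<Longrightarrow> g ` x = x \<Longrightarrow> g ` y \<in> suborbit x y"
  unfolding suborbit_def by (intro CollectI exI[of _ g]) simp

lemma suborbitE: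
  assumes "s \<in> suborbit x y"
  obtains g where "g \<in> G" "g ` x = x" "s = g ` y"
  using assms unfolding suborbit_def by (elim CollectE exE conjE)

lemma suborbit_nonempty: "y \<in> suborbit x y"
  using suborbitI[OF id_in, of x y] by simp

lemma finite_suborbit': "x \<in> Y \<Longrightarrow> y \<in> Y \<Longrightarrow> finite (suborbit x y)"
  unfolding suborbit_def by (rule finite_suborbit)

lemma card_suborbit_pos: "x \<in> Y \<Longrightarrow> y \<in> Y \<Longrightarrow> card (suborbit x y) > 0"
  using suborbit_nonempty finite_suborbit' by (metis card_gt_0_iff empty_iff)

lemma suborbit_image:
  assumes g: "g \<in> G"
  shows "suborbit (g ` x) (g ` y) = (`) g ` suborbit x y"
proof -
  obtain h where h: "h \<in> G" "\<And>s. h ` g ` s = s" "\<And>s. g ` h ` s = s"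
    using inverse_obtain[OF g] by metis
  show ?thesis
  proof (intro equalityI subsetI)
    fix s assume "s \<in> suborbit (g ` x) (g ` y)"
    then obtain k where k: "k \<in> G" "k ` g ` x = g ` x" "s = k ` g ` y"
      by (rule suborbitE)
    have "(h \<circ> k \<circ> g) ` x = x" using k(2) h(2) by (simp only: image_comp[symmetric])
    then have "(h \<circ> k \<circ> g) ` y \<in> suborbit x y"
      by (rule suborbitI[OF comp_in[OF comp_in[OF h(1) k(1)] g]])
    moreover have "s = g ` (h \<circ> k \<circ> g) ` y" using k(3) h(3) by (simp only: image_comp[symmetric])
    ultimately show "s \<in> (`) g ` suborbit x y" by blast
  next
    fix s assume "s \<in> (`) g ` suborbit x y"
    then obtain k where k: "k \<in> G" "k ` x = x" "s = g ` k ` y" by (auto elim: suborbitE)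
    have "(g \<circ> k \<circ> h) ` g ` x = g ` x" using k(2) h(2) by (simp only: image_comp[symmetric])
    moreover have "s = (g \<circ> k \<circ> h) ` g ` y" using k(3) h(2) by (simp only: image_comp[symmetric])
    ultimately show "s \<in> suborbit (g ` x) (g ` y)"
      using suborbitI[OF comp_in[OF comp_in[OF g k(1)] h(1)]] by simp
  qed
qed

lemma inj_image:
  assumes "g \<in> G" shows "inj_on ((`) g) A"
proof -
  obtain h where "\<And>s. h ` g ` s = s" using inverse_obtain[OF assms] by metis
  then show ?thesis by (metis inj_onI)
qed

lemma card_suborbit_image: "g \<in> G \<Longrightarrow> card (suborbit (g ` x) (g ` y)) = card (suborbit x y)"
  unfolding suborbit_image by (rule card_image[OF inj_image])

lemma index_image: "g \<in> G \<Longrightarrow> index (g ` x) (g ` y) = index x y"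
  unfolding index_def by (simp add: card_suborbit_image)

lemma index_self: "x \<in> Y \<Longrightarrow> index x x = 1"
  using card_suborbit_pos[of x x] unfolding index_def by simp

text \<open>The tower law \<open>[G\<^sub>x : G\<^sub>x\<^sub>y\<^sub>z] = [G\<^sub>x : G\<^sub>x\<^sub>y] [G\<^sub>x\<^sub>y : G\<^sub>x\<^sub>y\<^sub>z]\<close>.\<close>

lemma card_suborbit_pairs:
  assumes Y: "x \<in> Y" "y \<in> Y" "z \<in> Y"
  shows "card {(g ` y, g ` z) |g. g \<in> G \<and> g ` x = x} =
    card (suborbit x y) * card {g ` z |g. g \<in> G \<and> g ` x = x \<and> g ` y = y}"
    (is "card ?D = _ * card ?F")
proof -
  let ?fib = "\<lambda>y'. {z'. (y', z') \<in> ?D}"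
  have D: "?D = Sigma (suborbit x y) ?fib" unfolding suborbit_def by blast
  have fib: "card (?fib y') = card ?F" if "y' \<in> suborbit x y" for y'
  proof -
    obtain g where g: "g \<in> G" "g ` x = x" "y' = g ` y"
      using \<open>y' \<in> _\<close> by (rule suborbitE)
    obtain h where h: "h \<in> G" "\<And>s. h ` g ` s = s" "\<And>s. g ` h ` s = s"
      using inverse_obtain[OF g(1)] by metis
    have "?fib y' = (`) g ` ?F"
    proof (intro equalityI subsetI)
      fix z' assume "z' \<in> ?fib y'"
      then obtain k where k: "k \<in> G" "k ` x = x" "k ` y = g ` y" "z' = k ` z"
        unfolding g(3) by auto
      have "h \<circ> k \<in> G \<and> (h \<circ> k) ` x = x \<and> (h \<circ> k) ` y = y"
        using comp_in[OF h(1) k(1)] k(2,3) h(2) g(2) by (metis image_comp)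
      moreover have "z' = g ` (h \<circ> k) ` z" using k(4) h(3) by (metis image_comp)
      ultimately show "z' \<in> (`) g ` ?F" by blast
    next
      fix z' assume "z' \<in> (`) g ` ?F"
      then obtain k where k: "k \<in> G" "k ` x = x" "k ` y = y" "z' = g ` k ` z" by blast
      then have "g \<circ> k \<in> G" "(g \<circ> k) ` x = x" "(g \<circ> k) ` y = y'" "(g \<circ> k) ` z = z'"
        using comp_in g by (simp_all only: image_comp[symmetric])
      then show "z' \<in> ?fib y'" by blast
    qed
    then show ?thesis by (simp add: card_image[OF inj_image[OF g(1)]])
  qed
  have "finite (?fib y')" for y'
    by (rule finite_subset[OF _ finite_suborbit[OF Y(1) Y(3)]]) blast
  then have "card ?D = (\<Sum>y'\<in>suborbit x y. card (?fib y'))"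
    by (subst D) (rule card_SigmaI[OF finite_suborbit'[OF Y(1,2)]], blast)
  also have "\<dots> = card (suborbit x y) * card ?F" using fib by simp
  finally show ?thesis .
qed

text \<open>For each pair among \<open>x, y, z\<close> the index is a ratio of two of the three numbers
  \<open>[G\<^sub>x : G\<^sub>x\<^sub>y\<^sub>z]\<close>, \<open>[G\<^sub>y : G\<^sub>x\<^sub>y\<^sub>z]\<close>, \<open>[G\<^sub>z : G\<^sub>x\<^sub>y\<^sub>z]\<close>.\<close>

lemma index_trans:
  assumes Y: "x \<in> Y" "y \<in> Y" "z \<in> Y"
  shows "index x z = index x y * index y z"
proof -
  define t where "t a b c = card {(g ` b, g ` c) |g. g \<in> G \<and> g ` a = a}" for a b c :: "'v set"
  define F where "F a b c = card {g ` c |g. g \<in> G \<and> g ` a = a \<and> g ` b = b}" for a b c :: "'v set"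
  have t_swap: "t a b c = t a c b" for a b c
  proof -
    have "{(g ` b, g ` c) |g. g \<in> G \<and> g ` a = a} = prod.swap ` {(g ` c, g ` b) |g. g \<in> G \<and> g ` a = a}"
      by force
    then show ?thesis unfolding t_def by (simp add: card_image)
  qed
  have F_swap: "F a b c = F b a c" for a b c unfolding F_def by meson
  have t: "t a b c = card (suborbit a b) * F a b c" if "a \<in> Y" "b \<in> Y" "c \<in> Y" for a b c
    unfolding t_def F_def by (rule card_suborbit_pairs[OF that])
  have F_pos: "F a b c > 0" if "a \<in> Y" "b \<in> Y" "c \<in> Y" for a b c
  proof -
    have "c \<in> {g ` c |g. g \<in> G \<and> g ` a = a \<and> g ` b = b}"
      using id_in by (intro CollectI exI[of _ id]) simp
    moreover have "finite {g ` c |g. g \<in> G \<and> g ` a = a \<and> g ` b = b}"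
      by (rule finite_subset[OF _ finite_suborbit[OF that(1,3)]]) blast
    ultimately show ?thesis unfolding F_def by (auto simp: card_gt_0_iff)
  qed
  have ratio: "index a b = real (t a b c) / real (t b a c)" "t a b c > 0"
    if "a \<in> Y" "b \<in> Y" "c \<in> Y" for a b c
    using t[OF that] t[OF that(2,1,3)] F_swap[of a b c] F_pos[OF that] card_suborbit_pos[of a b] that
    unfolding index_def by auto
  show ?thesis
    using ratio[OF Y] ratio[OF Y(2,3,1)] ratio[OF Y(1,3,2)] ratio(2)[OF Y(2,1,3)]
      t_swap[of x y z] t_swap[of y x z] t_swap[of z x y] by simp
qed

text \<open>Since the index is \<open>G\<close>-invariant, the chain \<open>x\<close>, \<open>g x\<close>, \<open>g h x\<close> gives a product.\<close>

lemma index_hom: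
  assumes "x \<in> Y" "g \<in> G" "h \<in> G"
  shows "index x ((g \<circ> h) ` x) = index x (g ` x) * index x (h ` x)"
proof -
  have "index x ((g \<circ> h) ` x) = index x (g ` x) * index (g ` x) (g ` h ` x)"
    using index_trans[OF assms(1) image_in[OF assms(2,1)] image_in[OF assms(2) image_in[OF assms(3,1)]]]
    by (simp only: image_comp)
  then show ?thesis using index_image[OF assms(2)] by simp
qed

text \<open>The homomorphism \<open>g \<mapsto> index x (g x)\<close> has an abelian target, so it does not see conjugation.\<close>

lemma index_conjugate:
  assumes x: "x \<in> Y" and h: "h \<in> G" and h': "h' \<in> G" and g: "g \<in> G"
    and inv: "h' \<circ> h = id" and fixed: "(h \<circ> g \<circ> h') ` x = x"
  shows "index x (g ` x) = 1"
proof -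
  have "index x (h' ` x) * index x (h ` x) = 1"
    using index_hom[OF x h' h] inv index_self[OF x] by simp
  moreover have "index x (h ` x) * index x (g ` x) * index x (h' ` x) = 1"
    using index_hom[OF x comp_in[OF h g] h'] index_hom[OF x h g] fixed index_self[OF x] by simp
  ultimately show ?thesis by (metis mult.commute mult.left_commute mult_1 mult.assoc)
qed

text \<open>If \<open>A\<close> and \<open>B\<close> are the two sets that are counted, pair \<open>y' \<in> A\<close> with \<open>x' \<in> B\<close> when
  \<open>(x', y)\<close> and \<open>(x, y')\<close> are in one orbit of pairs.  Then \<open>y'\<close> has as many partners as
  \<open>suborbit y' x\<close> has elements, \<open>x'\<close> has as many as \<open>suborbit x y'\<close>, and the ratio of these
  two numbers is \<open>index x y'\<close>.\<close>

lemma card_related: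
  fixes R :: "'v set \<Rightarrow> 'v set \<Rightarrow> bool"
  assumes Y: "x \<in> Y" "y \<in> Y"
    and inv: "\<And>g a b. g \<in> G \<Longrightarrow> R a b \<Longrightarrow> R (g ` a) (g ` b)"
    and ind: "\<And>g. g \<in> G \<Longrightarrow> index x (g ` y) = \<kappa>"
    and finA: "finite {g ` y |g. g \<in> G \<and> R x (g ` y)}"
    and finB: "finite {g ` x |g. g \<in> G \<and> R (g ` x) y}"
  shows "real (card {g ` y |g. g \<in> G \<and> R x (g ` y)}) =
    \<kappa> * real (card {g ` x |g. g \<in> G \<and> R (g ` x) y})"
proof -
  let ?A = "{g ` y |g. g \<in> G \<and> R x (g ` y)}" and ?B = "{g ` x |g. g \<in> G \<and> R (g ` x) y}"
  define P where "P y' x' \<longleftrightarrow> (\<exists>g\<in>G. g ` x = x' \<and> g ` y' = y)" for y' x'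
  have left: "card {x'\<in>?B. P y' x'} = card (suborbit y' x)" if y': "y' \<in> ?A" for y'
  proof -
    obtain g where g: "g \<in> G" "R x (g ` y)" "y' = g ` y" using y' by blast
    obtain h where h: "h \<in> G" "\<And>s. h ` g ` s = s" "\<And>s. g ` h ` s = s"
      using inverse_obtain[OF g(1)] by metis
    have "{x'\<in>?B. P y' x'} = (`) h ` suborbit y' x"
    proof (intro equalityI subsetI)
      fix x' assume "x' \<in> {x'\<in>?B. P y' x'}"
      then obtain k where k: "k \<in> G" "k ` x = x'" "k ` y' = y" unfolding P_def by blast
      have "(g \<circ> k) ` x \<in> suborbit y' x"
        using k(3) g(3) by (intro suborbitI comp_in g(1) k(1)) (simp only: image_comp[symmetric])
      moreover have "x' = h ` (g \<circ> k) ` x" using h(2) k(2) by (simp only: image_comp[symmetric])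
      ultimately show "x' \<in> (`) h ` suborbit y' x" by blast
    next
      fix x' assume "x' \<in> (`) h ` suborbit y' x"
      then obtain k where k: "k \<in> G" "k ` y' = y'" "x' = h ` k ` x" by (auto elim: suborbitE)
      have hk: "h \<circ> k \<in> G" "(h \<circ> k) ` x = x'" "(h \<circ> k) ` y' = y"
        using comp_in[OF h(1) k(1)] k h(2) g(3) by (simp_all only: image_comp[symmetric])
      then have "P y' x'" unfolding P_def by blast
      moreover have "R x' y" using inv[OF hk(1), of x y'] g hk by simp
      ultimately show "x' \<in> {x'\<in>?B. P y' x'}" using hk by blast
    qed
    then show ?thesis by (simp add: card_image[OF inj_image[OF h(1)]])
  qed
  have right: "{y'\<in>?A. P y' x'} = suborbit x y''"
    if x': "x' \<in> ?B" and y'': "y'' \<in> ?A" and P: "P y'' x'" for x' y''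
  proof -
    obtain k where k: "k \<in> G" "k ` x = x'" "k ` y'' = y" using P unfolding P_def by blast
    obtain g where g: "g \<in> G" "R x (g ` y)" "y'' = g ` y" using y'' by blast
    obtain k' where k': "k' \<in> G" "\<And>s. k' ` k ` s = s" "\<And>s. k ` k' ` s = s"
      using inverse_obtain[OF k(1)] by metis
    show ?thesis
    proof (intro equalityI subsetI)
      fix y' assume "y' \<in> {y'\<in>?A. P y' x'}"
      then obtain l where l: "l \<in> G" "l ` x = x'" "l ` y' = y" unfolding P_def by blast
      obtain l' where l': "l' \<in> G" "\<And>s. l' ` l ` s = s"
        using inverse_obtain[OF l(1)] by metis
      have "l' \<circ> k \<in> G" "(l' \<circ> k) ` x = x" "(l' \<circ> k) ` y'' = y'"
        using comp_in[OF l'(1) k(1)] k l l'(2) by (metis image_comp)+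
      then show "y' \<in> suborbit x y''" using suborbitI by metis
    next
      fix y' assume "y' \<in> suborbit x y''"
      then obtain l where l: "l \<in> G" "l ` x = x" "y' = l ` y''" by (rule suborbitE)
      obtain l' where l': "l' \<in> G" "\<And>s. l' ` l ` s = s"
        using inverse_obtain[OF l(1)] by metis
      have "k \<circ> l' \<in> G" "(k \<circ> l') ` x = x'" "(k \<circ> l') ` y' = y"
        using comp_in[OF k(1) l'(1)] k l l'(2) by (metis image_comp)+
      then have "P y' x'" unfolding P_def by blast
      moreover have "R x y'" using inv[OF l(1) g(2)] l(2,3) g(3) by simp
      moreover have "y' = (l \<circ> g) ` y" "l \<circ> g \<in> G"
        using l(3) g(3) comp_in[OF l(1) g(1)] by (simp_all add: image_comp)
      ultimately show "y' \<in> {y'\<in>?A. P y' x'}" by blast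
    qed
  qed
  have AY: "?A \<subseteq> Y" using image_in Y(2) by blast
  have wt: "\<kappa> = real (card (suborbit x y')) / real (card (suborbit y' x))" if "y' \<in> ?A" for y'
    using that ind unfolding index_def by force
  have inner_A: "(\<Sum>x'\<in>?B. if P y' x' then 1 / real (card (suborbit y' x)) else 0) = 1" if "y' \<in> ?A" for y'
  proof -
    have "(\<Sum>x'\<in>?B. if P y' x' then 1 / real (card (suborbit y' x)) else 0)
        = (\<Sum>x'\<in>{x'\<in>?B. P y' x'}. 1 / real (card (suborbit y' x)))"
      using finB by (intro sum.inter_filter[symmetric])
    also have "\<dots> = 1" using left[OF that] card_suborbit_pos[of y' x] AY that Y by auto
    finally show ?thesis .
  qed
  have inner_B: "(\<Sum>y'\<in>?A. if P y' x' then 1 / real (card (suborbit y' x)) else 0) = \<kappa>" if x': "x' \<in> ?B" for x'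
  proof -
    obtain h where h: "h \<in> G" "R (h ` x) y" "x' = h ` x" using x' by blast
    obtain h' where h': "h' \<in> G" "\<And>s. h' ` h ` s = s" "\<And>s. h ` h' ` s = s"
      using inverse_obtain[OF h(1)] by metis
    have "R x (h' ` y)" using inv[OF h'(1) h(2)] h'(2) by simp
    then have y'': "h' ` y \<in> ?A" using h'(1) by blast
    have P'': "P (h' ` y) x'"
      unfolding P_def using h(1,3) h'(3) by (intro bexI[of _ h]) simp_all
    have eq: "{y'\<in>?A. P y' x'} = suborbit x (h' ` y)" by (rule right[OF x' y'' P''])
    have "(\<Sum>y'\<in>?A. if P y' x' then 1 / real (card (suborbit y' x)) else 0)
        = (\<Sum>y'\<in>{y'\<in>?A. P y' x'}. 1 / real (card (suborbit y' x)))"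
      using finA by (intro sum.inter_filter[symmetric])
    also have "\<dots> = (\<Sum>y'\<in>{y'\<in>?A. P y' x'}. \<kappa> / real (card (suborbit x (h' ` y))))"
    proof (rule sum.cong[OF refl])
      fix y' assume y': "y' \<in> {y'\<in>?A. P y' x'}"
      then have "suborbit x y' = suborbit x (h' ` y)" using right[OF x', of y'] eq by simp
      then show "1 / real (card (suborbit y' x)) = \<kappa> / real (card (suborbit x (h' ` y)))"
        using wt[of y'] y' card_suborbit_pos[of x "h' ` y"] Y AY y'' by (auto simp: field_simps)
    qed
    also have "\<dots> = \<kappa>" unfolding eq using card_suborbit_pos[of x "h' ` y"] Y AY y'' by auto
    finally show ?thesis .
  qed
  have "real (card ?A) = (\<Sum>y'\<in>?A. \<Sum>x'\<in>?B. if P y' x' then 1 / real (card (suborbit y' x)) else 0)"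
    using inner_A by simp
  also have "\<dots> = (\<Sum>x'\<in>?B. \<Sum>y'\<in>?A. if P y' x' then 1 / real (card (suborbit y' x)) else 0)"
    by (rule sum.swap)
  also have "\<dots> = \<kappa> * real (card ?B)" using inner_B by simp
  finally show ?thesis .
qed

end

section \<open>Discrete valuation rings inside their fraction fields\<close>

text \<open>The ring is a subset of its field of fractions, so that ideals, lattices and vectors with
  denominators can be treated alike.  By \<open>dichotomy\<close> any element outside the ring has its inverse
  in the maximal ideal; by \<open>exhausted\<close> the powers of \<open>\<pi>\<close> clear all denominators.\<close>

locale valuation_ring =
  fixes \<O> :: "'k::field set" and \<pi> :: 'k and q :: nat
  assumes one_in: "1 \<in> \<O>"
    and diff_in: "x \<in> \<O> \<Longrightarrow> y \<in> \<O> \<Longrightarrow> x - y \<in> \<O>"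
    and mult_in: "x \<in> \<O> \<Longrightarrow> y \<in> \<O> \<Longrightarrow> x * y \<in> \<O>"
    and pi_in: "\<pi> \<in> \<O>"
    and pi_nonzero: "\<pi> \<noteq> 0"
    and pi_nonunit: "inverse \<pi> \<notin> \<O>"
    and dichotomy: "x \<notin> \<O> \<Longrightarrow> \<exists>y\<in>\<O>. inverse x = \<pi> * y"
    and exhausted: "\<exists>N. \<pi> ^ N * x \<in> \<O>"
    and residues: "\<exists>T\<subseteq>\<O>. finite T \<and> card T = q \<and> (\<forall>x\<in>\<O>. \<exists>!t. t \<in> T \<and> (\<exists>y\<in>\<O>. x - t = \<pi> * y))"
begin

definition \<P> :: "nat \<Rightarrow> 'k set" where
  "\<P> k = (\<lambda>x. \<pi> ^ k * x) ` \<O>"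

definition units :: "'k set" where
  "units = \<O> - \<P> 1"

lemma zero_in: "0 \<in> \<O>" using diff_in[OF one_in one_in] by simp

lemma uminus_in: "x \<in> \<O> \<Longrightarrow> - x \<in> \<O>" using diff_in[OF zero_in] by simp

lemma add_in: "x \<in> \<O> \<Longrightarrow> y \<in> \<O> \<Longrightarrow> x + y \<in> \<O>" using diff_in[OF _ uminus_in] by fastforce

lemma pi_power_in: "\<pi> ^ k \<in> \<O>" by (induction k) (simp_all add: one_in mult_in pi_in)

lemma P_0: "\<P> 0 = \<O>" unfolding \<P>_def by simp

lemma P_iff: "x \<in> \<P> k \<longleftrightarrow> x / \<pi> ^ k \<in> \<O>"
  unfolding \<P>_def using pi_nonzero by (auto simp: image_iff field_simps intro!: bexI[of _ "x / \<pi> ^ k"])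

lemma P_zero: "0 \<in> \<P> k" by (simp add: P_iff zero_in)

lemma P_add: "x \<in> \<P> k \<Longrightarrow> y \<in> \<P> k \<Longrightarrow> x + y \<in> \<P> k" by (simp add: P_iff add_in add_divide_distrib)

lemma P_diff: "x \<in> \<P> k \<Longrightarrow> y \<in> \<P> k \<Longrightarrow> x - y \<in> \<P> k" by (simp add: P_iff diff_in diff_divide_distrib)

lemma P_uminus_iff [simp]: "- x \<in> \<P> k \<longleftrightarrow> x \<in> \<P> k"
  using P_diff[OF P_zero, of x k] P_diff[OF P_zero, of "- x" k] by auto

lemma P_mult: "x \<in> \<P> j \<Longrightarrow> y \<in> \<P> k \<Longrightarrow> x * y \<in> \<P> (j + k)"
  using mult_in[of "x / \<pi> ^ j" "y / \<pi> ^ k"] by (simp add: P_iff power_add)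

lemma P_scale: "a \<in> \<O> \<Longrightarrow> x \<in> \<P> k \<Longrightarrow> a * x \<in> \<P> k"
  using P_mult[of a 0 x k] by (simp add: P_0)

lemma P_sum: "(\<And>i. i \<in> A \<Longrightarrow> f i \<in> \<P> k) \<Longrightarrow> sum f A \<in> \<P> k"
  by (induction A rule: infinite_finite_induct) (simp_all add: P_zero P_add)

lemma P_pi_power: "\<pi> ^ j * x \<in> \<P> (j + k) \<longleftrightarrow> x \<in> \<P> k"
  using pi_nonzero by (simp add: P_iff power_add)

lemma P_pi: "\<pi> * x \<in> \<P> (Suc k) \<longleftrightarrow> x \<in> \<P> k"
  using P_pi_power[of 1 x k] by simp

lemma P_antimono: "j \<le> k \<Longrightarrow> \<P> k \<subseteq> \<P> j"
proof
  fix x assume "j \<le> k" "x \<in> \<P> k"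
  then obtain y where y: "y \<in> \<O>" "x = \<pi> ^ k * y" unfolding \<P>_def by blast
  then have "x = \<pi> ^ j * (\<pi> ^ (k - j) * y)"
    using \<open>j \<le> k\<close> by (simp add: mult.assoc[symmetric] power_add[symmetric])
  then show "x \<in> \<P> j" unfolding \<P>_def using mult_in[OF pi_power_in y(1)] by blast
qed

lemma P_subset: "\<P> k \<subseteq> \<O>" using P_antimono[of 0 k] by (simp add: P_0)

lemma P_Suc_subset: "\<P> (Suc k) \<subseteq> \<P> k" by (rule P_antimono) simp

lemma pi_power_mem: "\<pi> ^ k \<in> \<P> k" by (simp add: P_iff one_in pi_nonzero)

lemma pi_power_notin: "\<pi> ^ k \<notin> \<P> (Suc k)"
  using pi_nonunit pi_nonzero by (simp add: P_iff inverse_eq_divide)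

lemma exhausted_le: "\<exists>N. \<forall>M\<ge>N. \<pi> ^ M * x \<in> \<O>"
proof -
  obtain N where N: "\<pi> ^ N * x \<in> \<O>" using exhausted by blast
  have "\<pi> ^ M * x \<in> \<O>" if "M \<ge> N" for M
  proof -
    have "\<pi> ^ M * x = \<pi> ^ (M - N) * (\<pi> ^ N * x)"
      using that by (simp add: mult.assoc[symmetric] power_add[symmetric])
    then show ?thesis using mult_in[OF pi_power_in[of "M - N"] N] by metis
  qed
  then show ?thesis by blast
qed

lemma units_subset: "units \<subseteq> \<O>" unfolding units_def by blast

lemma inverse_unit: "u \<in> units \<Longrightarrow> inverse u \<in> units"
proof -
  assume u: "u \<in> units"
  then have nz: "u \<noteq> 0" using P_zero unfolding units_def by auto
  have "inverse u \<in> \<O>"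
  proof (rule ccontr)
    assume "inverse u \<notin> \<O>"
    then obtain y where "y \<in> \<O>" "inverse (inverse u) = \<pi> * y" using dichotomy by blast
    then have "u \<in> \<P> 1" unfolding \<P>_def by auto
    then show False using u unfolding units_def by blast
  qed
  moreover have "inverse u \<notin> \<P> 1"
  proof
    assume "inverse u \<in> \<P> 1"
    then have "u * inverse u \<in> \<P> 1" using P_scale u units_subset by blast
    then show False using nz pi_power_notin[of 0] by simp
  qed
  ultimately show ?thesis unfolding units_def by blast
qed

lemma unit_nonzero: "u \<in> units \<Longrightarrow> u \<noteq> 0"
  using P_zero unfolding units_def by auto

lemma unit_mult_P_iff: "u \<in> units \<Longrightarrow> u * x \<in> \<P> k \<longleftrightarrow> x \<in> \<P> k"
  using P_scale[of u x k] P_scale[of "inverse u" "u * x" k] inverse_unit[of u] units_subset unit_nonzero[of u]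
  by (auto simp: mult.assoc[symmetric])

lemma one_unit: "1 \<in> units"
  unfolding units_def using one_in pi_power_notin[of 0] by simp

lemma unit_mult: "u \<in> units \<Longrightarrow> v \<in> units \<Longrightarrow> u * v \<in> units"
  using unit_mult_P_iff[of u v 1] mult_in units_subset unfolding units_def by blast

text \<open>Elements of exact valuation \<open>k\<close> generate \<open>\<P> k\<close>.\<close>

lemma level_divide:
  assumes "x \<in> \<P> k" "x \<notin> \<P> (Suc k)" "y \<in> \<P> k"
  shows "x \<noteq> 0" "y / x \<in> \<O>"
proof -
  show nz: "x \<noteq> 0" using assms(2) P_zero by auto
  have "x / \<pi> ^ k \<in> units"
    using assms(1,2) P_pi_power[of k "x / \<pi> ^ k" 1] pi_nonzero unfolding units_def by (simp add: P_iff)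
  then have "(y / \<pi> ^ k) * inverse (x / \<pi> ^ k) \<in> \<O>"
    using mult_in[OF P_iff[THEN iffD1, OF assms(3)] subsetD[OF units_subset inverse_unit]] by blast
  moreover have "(y / \<pi> ^ k) * inverse (x / \<pi> ^ k) = y / x"
    using nz pi_nonzero by (simp add: field_simps)
  ultimately show "y / x \<in> \<O>" by (simp only:)
qed

lemma level_divide_unit:
  assumes "x \<in> \<P> k" "x \<notin> \<P> (Suc k)" "y \<in> \<P> k" "y \<notin> \<P> (Suc k)"
  shows "y / x \<in> units"
proof -
  have "y / x \<notin> \<P> 1"
  proof
    assume "y / x \<in> \<P> 1"
    then have "(y / x) * x \<in> \<P> (1 + k)" using assms(1) P_mult by blast
    then show False using assms level_divide(1)[OF assms(1-3)] by simp
  qed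
  then show ?thesis using level_divide(2)[OF assms(1-3)] unfolding units_def by blast
qed

lemma residue_map_obtain:
  obtains T r where "T \<subseteq> \<O>" "finite T" "card T = q" "\<And>x. x \<in> \<O> \<Longrightarrow> r x \<in> T"
    "\<And>x. x \<in> \<O> \<Longrightarrow> x - r x \<in> \<P> 1" "\<And>t. t \<in> T \<Longrightarrow> r t = t"
    "\<And>x y. x \<in> \<O> \<Longrightarrow> y \<in> \<O> \<Longrightarrow> r x = r y \<longleftrightarrow> x - y \<in> \<P> 1"
proof -
  obtain T where T: "T \<subseteq> \<O>" "finite T" "card T = q"
    and ex: "\<And>x. x \<in> \<O> \<Longrightarrow> \<exists>!t. t \<in> T \<and> x - t \<in> \<P> 1"
    using residues unfolding \<P>_def image_iff by auto
  define r where "r x = (THE t. t \<in> T \<and> x - t \<in> \<P> 1)" for x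
  have r: "r x \<in> T \<and> x - r x \<in> \<P> 1" if "x \<in> \<O>" for x
    unfolding r_def by (rule theI'[OF ex[OF that]])
  have r_eq: "r x = t" if "x \<in> \<O>" "t \<in> T" "x - t \<in> \<P> 1" for x t
    using ex[OF that(1)] r[OF that(1)] that by blast
  have "r t = t" if "t \<in> T" for t using r_eq[of t t] that T(1) P_zero by auto
  moreover have "r x = r y \<longleftrightarrow> x - y \<in> \<P> 1" if xy: "x \<in> \<O>" "y \<in> \<O>" for x y
  proof
    assume "r x = r y"
    then have "(x - r x) - (y - r y) = x - y" by simp
    then show "x - y \<in> \<P> 1" using P_diff r xy by metis
  next
    assume "x - y \<in> \<P> 1"
    then have "(x - y) + (y - r y) \<in> \<P> 1" using P_add r xy by blast
    then have "x - r y \<in> \<P> 1" by simp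
    then show "r x = r y" using r_eq xy r by blast
  qed
  ultimately show thesis using that[OF T] r by blast
qed

text \<open>The first \<open>k\<close> digits of the \<open>\<pi>\<close>-adic expansion determine the class modulo \<open>\<P> k\<close>.\<close>

lemma finite_residues_power: "\<exists>T. finite T \<and> T \<subseteq> \<O> \<and> (\<forall>x\<in>\<O>. \<exists>t\<in>T. x - t \<in> \<P> k)"
proof (induction k)
  case 0
  show ?case using zero_in by (intro exI[of _ "{0}"]) (simp add: P_0)
next
  case (Suc k)
  then obtain T where T: "finite T" "T \<subseteq> \<O>" "\<And>x. x \<in> \<O> \<Longrightarrow> \<exists>t\<in>T. x - t \<in> \<P> k" by blast
  obtain T' r where T': "T' \<subseteq> \<O>" "finite T'" "\<And>x. x \<in> \<O> \<Longrightarrow> r x \<in> T'"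
    "\<And>x. x \<in> \<O> \<Longrightarrow> x - r x \<in> \<P> 1" by (rule residue_map_obtain) blast
  let ?S = "(\<lambda>(t, s). t + \<pi> ^ k * s) ` (T \<times> T')"
  have "\<exists>t\<in>?S. x - t \<in> \<P> (Suc k)" if "x \<in> \<O>" for x
  proof -
    obtain t where t: "t \<in> T" "x - t \<in> \<P> k" using T(3)[OF \<open>x \<in> \<O>\<close>] by blast
    then obtain y where y: "y \<in> \<O>" "x - t = \<pi> ^ k * y" unfolding \<P>_def by blast
    have "x - (t + \<pi> ^ k * r y) = \<pi> ^ k * (y - r y)"
      using y(2) by (simp add: algebra_simps)
    then have "x - (t + \<pi> ^ k * r y) \<in> \<P> (Suc k)"
      using P_pi_power[of k "y - r y" 1] T'(4)[OF y(1)] by simp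
    then show ?thesis using t(1) T'(3)[OF y(1)] by force
  qed
  moreover have "finite ?S" using T(1) T'(2) by simp
  moreover have "?S \<subseteq> \<O>"
    using T(2) T'(1) by (auto intro!: add_in mult_in pi_power_in simp: subset_iff)
  ultimately show ?case by blast
qed

text \<open>This counts the lines in \<open>\<bbbF>\<^sub>q\<^sup>I\<close> that are not contained in the coordinate subspace
  \<open>\<bbbF>\<^sub>q\<^sup>I\<^sup>-\<^sup>J\<close>; the function \<open>X\<close> names the line through the reduction of a vector of \<open>\<O>\<^sup>I\<close>.
  Vectors of digits represent the vectors over the residue field, and scaling by the \<open>q - 1\<close>
  nonzero residues is a simply transitive action on the nonzero ones on a line.\<close>

lemma card_lines:
  fixes X :: "('i \<Rightarrow> 'k) \<Rightarrow> 'b"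
  assumes I: "finite I" "J \<subseteq> I"
    and X: "\<And>t t'. t \<in> {t. (\<forall>i. t i \<in> \<O>) \<and> (\<exists>j\<in>J. t j \<in> units)} \<Longrightarrow>
      t' \<in> {t. (\<forall>i. t i \<in> \<O>) \<and> (\<exists>j\<in>J. t j \<in> units)} \<Longrightarrow>
      X t = X t' \<longleftrightarrow> (\<exists>u\<in>units. \<forall>i\<in>I. t' i - u * t i \<in> \<P> 1)"
  shows "real (card (X ` {t. (\<forall>i. t i \<in> \<O>) \<and> (\<exists>j\<in>J. t j \<in> units)})) * (real q - 1) =
    real q ^ card I - real q ^ (card I - card J)"
proof -
  define Q where "Q = {t :: 'i \<Rightarrow> 'k. (\<forall>i. t i \<in> \<O>) \<and> (\<exists>j\<in>J. t j \<in> units)}"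
  obtain T r where T: "T \<subseteq> \<O>" "finite T" "card T = q" and r: "\<And>x. x \<in> \<O> \<Longrightarrow> r x \<in> T"
    "\<And>x. x \<in> \<O> \<Longrightarrow> x - r x \<in> \<P> 1" "\<And>t. t \<in> T \<Longrightarrow> r t = t"
    "\<And>x y. x \<in> \<O> \<Longrightarrow> y \<in> \<O> \<Longrightarrow> r x = r y \<longleftrightarrow> x - y \<in> \<P> 1"
    by (rule residue_map_obtain) blast
  have r0: "r 0 \<in> T" using r(1) zero_in .
  have T_unit: "t \<in> units \<longleftrightarrow> t \<noteq> r 0" if "t \<in> T" for t
    using r(4)[of t 0] r(3)[OF that] that T(1) zero_in unfolding units_def by auto
  have r_unit: "r x \<in> units \<longleftrightarrow> x \<in> units" if "x \<in> \<O>" for x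
  proof -
    have "r x \<in> units \<longleftrightarrow> r x \<noteq> r 0" using T_unit r(1)[OF that] by blast
    also have "\<dots> \<longleftrightarrow> x \<in> units" using r(4)[OF that zero_in] that unfolding units_def by auto
    finally show ?thesis .
  qed
  define W where "W = {t \<in> I \<rightarrow>\<^sub>E T. \<exists>j\<in>J. t j \<in> units}"
  define ext where "ext t = (\<lambda>i. if i \<in> I then t i else (0::'k))" for t :: "'i \<Rightarrow> 'k"
  have ext_Q: "ext w \<in> Q" if "w \<in> W" for w
    using that T(1) I(2) zero_in unfolding W_def Q_def ext_def by (auto simp: PiE_iff)
  have finW: "finite W" unfolding W_def by (rule finite_subset[OF _ finite_PiE[of I "\<lambda>_. T"]]) (use I(1) T(2) in auto)
  have X': "X t = X t' \<longleftrightarrow> (\<exists>u\<in>units. \<forall>i\<in>I. t' i - u * t i \<in> \<P> 1)" if "t \<in> Q" "t' \<in> Q" for t t'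
    using X that unfolding Q_def by blast
  have image: "X ` Q = (X \<circ> ext) ` W"
  proof (intro equalityI subsetI)
    fix y assume "y \<in> X ` Q"
    then obtain t where t: "t \<in> Q" "y = X t" by blast
    define w where "w = restrict (r \<circ> t) I"
    have w: "w \<in> W" using t(1) r(1) r_unit I(2) unfolding w_def W_def Q_def by (auto simp: subset_iff)
    have "t i - ext w i \<in> \<P> 1" if "i \<in> I" for i
      using that r(2) t(1) unfolding w_def ext_def Q_def by simp
    then have "X (ext w) = X t" using X'[OF ext_Q[OF w] t(1)] one_unit by (auto intro!: bexI[of _ 1])
    then show "y \<in> (X \<circ> ext) ` W" using w t(2) by force
  next
    fix y assume "y \<in> (X \<circ> ext) ` W"
    then show "y \<in> X ` Q" using ext_Q by auto
  qed
  \<comment> \<open>the vectors of digits on the line of \<open>w\<close> are the reductions of the multiples of \<open>w\<close>\<close>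
  have fib: "card {w \<in> W. (X \<circ> ext) w = y} = q - 1" if y: "y \<in> (X \<circ> ext) ` W" for y
  proof -
    obtain w where w: "w \<in> W" "y = X (ext w)" using y by auto
    have wT: "w i \<in> T" if "i \<in> I" for i using w(1) that unfolding W_def by auto
    have wO: "w i \<in> \<O>" if "i \<in> I" for i using wT[OF that] T(1) by blast
    define m where "m s = restrict (\<lambda>i. r (s * w i)) I" for s
    obtain j where j: "j \<in> J" "w j \<in> units" using w(1) unfolding W_def by blast
    have jI: "j \<in> I" using j I(2) by blast
    have "{w' \<in> W. (X \<circ> ext) w' = y} = m ` (T - {r 0})"
    proof (intro equalityI subsetI)
      fix w' assume "w' \<in> {w' \<in> W. (X \<circ> ext) w' = y}"
      then have w': "w' \<in> W" "X (ext w) = X (ext w')" using w(2) by auto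
      then obtain u where u: "u \<in> units" "\<And>i. i \<in> I \<Longrightarrow> ext w' i - u * ext w i \<in> \<P> 1"
        using X'[OF ext_Q[OF w(1)] ext_Q[OF w'(1)]] by auto
      have uO: "u \<in> \<O>" using u(1) units_subset by blast
      have "w' i = r (r u * w i)" if i: "i \<in> I" for i
      proof -
        have wi': "w' i \<in> T" using w'(1) i unfolding W_def by auto
        have "w' i - u * w i \<in> \<P> 1" using u(2)[OF i] i unfolding ext_def by simp
        moreover have "w i * (u - r u) \<in> \<P> 1" using P_scale[OF wO[OF i] r(2)[OF uO]] .
        ultimately have "(w' i - u * w i) + w i * (u - r u) \<in> \<P> 1" by (rule P_add)
        moreover have "(w' i - u * w i) + w i * (u - r u) = w' i - r u * w i" by (simp add: algebra_simps)
        ultimately have "w' i - r u * w i \<in> \<P> 1" by simp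
        moreover have "r u * w i \<in> \<O>" using mult_in wO[OF i] r(1)[OF uO] T(1) by blast
        ultimately show ?thesis using r(4)[of "w' i" "r u * w i"] r(3)[OF wi'] wi' T(1) by auto
      qed
      then have "w' = m (r u)"
        using w'(1) unfolding m_def W_def by (intro ext) (auto simp: PiE_iff extensional_def)
      moreover have "r u \<in> T - {r 0}" using r(1)[OF uO] r_unit[OF uO] u(1) T_unit by blast
      ultimately show "w' \<in> m ` (T - {r 0})" by blast
    next
      fix w' assume "w' \<in> m ` (T - {r 0})"
      then obtain s where s: "s \<in> T" "s \<noteq> r 0" "w' = m s" by blast
      have su: "s \<in> units" using s T_unit by blast
      have sO: "s * w i \<in> \<O>" if "i \<in> I" for i using mult_in wO[OF that] s(1) T(1) by blast
      have "w' j \<in> units" using s(3) jI r_unit[OF sO[OF jI]] unit_mult[OF su j(2)] unfolding m_def by simp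
      moreover have "w' \<in> I \<rightarrow>\<^sub>E T" using s(3) sO r(1) unfolding m_def by auto
      ultimately have w': "w' \<in> W" using j(1) unfolding W_def by blast
      have "ext w' i - s * ext w i \<in> \<P> 1" if "i \<in> I" for i
      proof -
        have "- (s * w i - r (s * w i)) \<in> \<P> 1" using r(2)[OF sO[OF that]] by (simp only: P_uminus_iff)
        then show ?thesis using that s(3) unfolding ext_def m_def by simp
      qed
      then have "X (ext w) = X (ext w')"
        using X'[OF ext_Q[OF w(1)] ext_Q[OF w']] su by blast
      then show "w' \<in> {w' \<in> W. (X \<circ> ext) w' = y}" using w' w(2) by simp
    qed
    moreover have "inj_on m (T - {r 0})"
    proof (rule inj_onI)
      fix s s' assume s: "s \<in> T - {r 0}" "s' \<in> T - {r 0}" "m s = m s'"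
      then have "m s j = m s' j" by simp
      then have "r (s * w j) = r (s' * w j)" using jI unfolding m_def by simp
      then have "s * w j - s' * w j \<in> \<P> 1" using r(4) s(1,2) mult_in wO[OF jI] T(1) by blast
      then have "w j * (s - s') \<in> \<P> 1" by (simp add: algebra_simps)
      then have "s - s' \<in> \<P> 1" using unit_mult_P_iff[OF j(2)] by blast
      then show "s = s'" using r(3,4) s(1,2) T(1) by (metis DiffD1 subsetD)
    qed
    ultimately show ?thesis using T r0 by (simp add: card_image)
  qed
  have "card W = (\<Sum>y\<in>(X \<circ> ext) ` W. card {w \<in> W. (X \<circ> ext) w = y})"
    using sum.image_gen[OF finW, of "\<lambda>_. 1::nat" "X \<circ> ext"] by simp
  also have "\<dots> = card ((X \<circ> ext) ` W) * (q - 1)" using fib by simp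
  finally have cW: "card W = card (X ` Q) * (q - 1)" unfolding image .
  have "I \<rightarrow>\<^sub>E T = W \<union> (\<Pi>\<^sub>E i\<in>I. if i \<in> J then {r 0} else T)"
  proof (intro equalityI subsetI)
    fix t assume t: "t \<in> I \<rightarrow>\<^sub>E T"
    show "t \<in> W \<union> (\<Pi>\<^sub>E i\<in>I. if i \<in> J then {r 0} else T)"
    proof (cases "t \<in> W")
      case False
      then have "t j = r 0" if "j \<in> J" for j
        using t that I(2) T_unit[of "t j"] unfolding W_def by (auto simp: PiE_iff subset_iff)
      then show ?thesis using t by (auto simp: PiE_iff)
    qed simp
  next
    fix t assume "t \<in> W \<union> (\<Pi>\<^sub>E i\<in>I. if i \<in> J then {r 0} else T)"
    then show "t \<in> I \<rightarrow>\<^sub>E T" using r0 unfolding W_def by (auto simp: PiE_iff split: if_splits)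
  qed
  moreover have "W \<inter> (\<Pi>\<^sub>E i\<in>I. if i \<in> J then {r 0} else T) = {}"
  proof -
    have "t \<notin> (\<Pi>\<^sub>E i\<in>I. if i \<in> J then {r 0} else T)" if t: "t \<in> W" for t
    proof
      assume t': "t \<in> (\<Pi>\<^sub>E i\<in>I. if i \<in> J then {r 0} else T)"
      obtain j where j: "j \<in> J" "t j \<in> units" using t unfolding W_def by blast
      have "j \<in> I" using j(1) I(2) by blast
      then have "t j = r 0" using PiE_mem[OF t'] j(1) by force
      then show False using j(2) T_unit[OF r0] by simp
    qed
    then show ?thesis by blast
  qed
  moreover have fin: "finite (\<Pi>\<^sub>E i\<in>I. if i \<in> J then {r 0} else T)" using I(1) T(2) by (auto intro: finite_PiE)
  ultimately have "card (I \<rightarrow>\<^sub>E T) = card W + card (\<Pi>\<^sub>E i\<in>I. if i \<in> J then {r 0} else T)"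
    using card_Un_disjoint[OF finW] by simp
  moreover have "card (I \<rightarrow>\<^sub>E T) = q ^ card I" using I(1) T(3) by (simp add: card_PiE)
  moreover have "card (\<Pi>\<^sub>E i\<in>I. if i \<in> J then {r 0} else T) = q ^ (card I - card J)"
  proof -
    have "card (\<Pi>\<^sub>E i\<in>I. if i \<in> J then {r 0} else T) = (\<Prod>i\<in>I. if i \<in> J then 1 else q)"
      using I(1) T(3) by (subst card_PiE) (auto intro!: prod.cong)
    also have "\<dots> = (\<Prod>i\<in>I - J. q)"
      using I by (intro prod.mono_neutral_cong_right) auto
    finally show ?thesis using I by (simp add: card_Diff_subset finite_subset)
  qed
  ultimately have "q ^ card I = card (X ` Q) * (q - 1) + q ^ (card I - card J)" using cW by simp
  then have "real q ^ card I = real (card (X ` Q)) * real (q - 1) + real q ^ (card I - card J)"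
    by (metis of_nat_add of_nat_mult of_nat_power)
  moreover have "q \<ge> 1" using T(2,3) r0 by (metis One_nat_def Suc_leI card_gt_0_iff empty_iff)
  ultimately show ?thesis unfolding Q_def by (simp add: of_nat_diff)
qed

end

section \<open>The symplectic group generated by transvections\<close>

text \<open>A subset \<open>V\<close> of a type of vectors is used, rather than the type itself, so that the dimension
  \<open>2 n\<close> can be a variable; \<open>expand\<close> makes \<open>E\<close>, \<open>F\<close> a symplectic basis of \<open>V\<close>.\<close>

locale symplectic_space = valuation_ring \<O> \<pi> q for \<O> :: "'k::field set" and \<pi> q +
  fixes scale :: "'k \<Rightarrow> 'v::ab_group_add \<Rightarrow> 'v" (infixr "\<cdot>" 75)
    and B :: "'v \<Rightarrow> 'v \<Rightarrow> 'k" and V :: "'v set" and n :: nat and E F :: "nat \<Rightarrow> 'v"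
  assumes scale_right_distrib: "a \<cdot> (x + y) = a \<cdot> x + a \<cdot> y"
    and scale_left_distrib: "(a + b) \<cdot> x = a \<cdot> x + b \<cdot> x"
    and scale_scale [simp]: "a \<cdot> b \<cdot> x = (a * b) \<cdot> x"
    and scale_one [simp]: "1 \<cdot> x = x"
    and B_add_left: "B (x + y) z = B x z + B y z"
    and B_scale_left: "B (a \<cdot> x) z = a * B x z"
    and B_skew: "B x y = - B y x"
    and B_alt [simp]: "B x x = 0"
    and V_zero: "0 \<in> V"
    and V_add: "x \<in> V \<Longrightarrow> y \<in> V \<Longrightarrow> x + y \<in> V"
    and V_scale: "x \<in> V \<Longrightarrow> a \<cdot> x \<in> V"
    and E_in: "i < n \<Longrightarrow> E i \<in> V" and F_in: "i < n \<Longrightarrow> F i \<in> V"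
    and B_EF: "i < n \<Longrightarrow> j < n \<Longrightarrow> B (E i) (F j) = (if i = j then 1 else 0)"
    and B_EE: "i < n \<Longrightarrow> j < n \<Longrightarrow> B (E i) (E j) = 0"
    and B_FF: "i < n \<Longrightarrow> j < n \<Longrightarrow> B (F i) (F j) = 0"
    and expand: "x \<in> V \<Longrightarrow> x = (\<Sum>i<n. B x (F i) \<cdot> E i + B (E i) x \<cdot> F i)"
begin

lemma scale_zero_right [simp]: "a \<cdot> 0 = 0"
  using scale_right_distrib[of a 0 0] by simp

lemma scale_zero_left [simp]: "0 \<cdot> x = 0"
  using scale_left_distrib[of 0 0 x] by simp

lemma scale_minus_left [simp]: "(- a) \<cdot> x = - (a \<cdot> x)"
  using scale_left_distrib[of "- a" a x] by (simp add: eq_neg_iff_add_eq_0)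

lemma scale_minus_right [simp]: "a \<cdot> (- x) = - (a \<cdot> x)"
  using scale_right_distrib[of a "- x" x] by (simp add: eq_neg_iff_add_eq_0)

lemma scale_diff_left: "(a - b) \<cdot> x = a \<cdot> x - b \<cdot> x"
  using scale_left_distrib[of a "- b" x] by simp

lemma scale_sum_right: "a \<cdot> sum f A = (\<Sum>i\<in>A. a \<cdot> f i)"
  by (induction A rule: infinite_finite_induct) (simp_all add: scale_right_distrib)

lemma B_zero_left [simp]: "B 0 z = 0" using B_scale_left[of 0 0 z] by simp

lemma B_zero_right [simp]: "B z 0 = 0" using B_skew[of z 0] by simp

lemma B_add_right: "B z (x + y) = B z x + B z y"
  using B_skew[of z "x + y"] B_skew[of z x] B_skew[of z y] by (simp add: B_add_left)

lemma B_scale_right: "B z (a \<cdot> x) = a * B z x"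
  using B_skew[of z "a \<cdot> x"] B_skew[of z x] by (simp add: B_scale_left)

lemma B_minus_left: "B (- x) z = - B x z" using B_scale_left[of "- 1" x z] by simp

lemma B_minus_right: "B z (- x) = - B z x" using B_scale_right[of z "- 1" x] by simp

lemma B_diff_left: "B (x - y) z = B x z - B y z"
  using B_add_left[of x "- y" z] by (simp add: B_minus_left)

lemma B_diff_right: "B z (x - y) = B z x - B z y"
  using B_add_right[of z x "- y"] by (simp add: B_minus_right)

lemma B_sum_left: "B (sum f A) z = (\<Sum>i\<in>A. B (f i) z)"
  by (induction A rule: infinite_finite_induct) (simp_all add: B_add_left)

lemma B_sum_right: "B z (sum f A) = (\<Sum>i\<in>A. B z (f i))"
  by (induction A rule: infinite_finite_induct) (simp_all add: B_add_right)

lemmas B_linear = B_add_left B_add_right B_scale_left B_scale_right B_minus_left B_minus_right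
  B_diff_left B_diff_right B_sum_left B_sum_right

lemma V_uminus: "x \<in> V \<Longrightarrow> - x \<in> V" using V_scale[of x "- 1"] by simp

lemma V_diff: "x \<in> V \<Longrightarrow> y \<in> V \<Longrightarrow> x - y \<in> V" using V_add[OF _ V_uminus, of x y] by simp

lemma V_sum: "(\<And>i. i \<in> A \<Longrightarrow> f i \<in> V) \<Longrightarrow> sum f A \<in> V"
  by (induction A rule: infinite_finite_induct) (simp_all add: V_zero V_add)

text \<open>The index \<open>(i, False)\<close> stands for \<open>E i\<close> and \<open>(i, True)\<close> for \<open>F i\<close>.\<close>

definition basis :: "nat \<times> bool \<Rightarrow> 'v" where
  "basis j = (if snd j then F (fst j) else E (fst j))"

definition coord :: "'v \<Rightarrow> nat \<times> bool \<Rightarrow> 'k" where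
  "coord x j = (if snd j then B (E (fst j)) x else B x (F (fst j)))"

abbreviation indices :: "(nat \<times> bool) set" where
  "indices \<equiv> {..<n} \<times> UNIV"

lemma sum_indices: "(\<Sum>j\<in>indices. f j) = (\<Sum>i<n. f (i, False) + f (i, True))"
  for f :: "nat \<times> bool \<Rightarrow> 'c::comm_monoid_add"
  using sum.cartesian_product[of "\<lambda>i b. f (i, b)" "UNIV::bool set" "{..<n}"]
  by (simp add: UNIV_bool add.commute)

lemma expand_basis: "x \<in> V \<Longrightarrow> x = (\<Sum>j\<in>indices. coord x j \<cdot> basis j)"
  unfolding sum_indices coord_def basis_def using expand by simp

lemma basis_in: "j \<in> indices \<Longrightarrow> basis j \<in> V"
  unfolding basis_def using E_in F_in by auto

lemma coord_add: "coord (x + y) j = coord x j + coord y j"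
  unfolding coord_def by (simp add: B_linear)

lemma coord_diff: "coord (x - y) j = coord x j - coord y j"
  unfolding coord_def by (simp add: B_linear)

lemma coord_scale: "coord (a \<cdot> x) j = a * coord x j"
  unfolding coord_def by (simp add: B_linear)

lemma coord_zero: "coord 0 j = 0"
  unfolding coord_def by simp

lemma coord_sum: "coord (sum f A) j = (\<Sum>i\<in>A. coord (f i) j)"
  by (induction A rule: infinite_finite_induct) (simp_all add: coord_zero coord_add)

lemma coord_basis: "i \<in> indices \<Longrightarrow> j \<in> indices \<Longrightarrow> coord (basis i) j = (if i = j then 1 else 0)"
  unfolding coord_def basis_def using B_EF B_EE B_FF by (cases i; cases j) auto

lemma coord_comb: "j \<in> indices \<Longrightarrow> coord (\<Sum>i\<in>indices. t i \<cdot> basis i) j = t j"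
proof -
  assume j: "j \<in> indices"
  have "coord (\<Sum>i\<in>indices. t i \<cdot> basis i) j = (\<Sum>i\<in>indices. if i = j then t i else 0)"
    unfolding coord_sum using j by (intro sum.cong[OF refl]) (simp add: coord_scale coord_basis)
  also have "\<dots> = t j" using j by simp
  finally show ?thesis .
qed

lemma comb_in: "(\<Sum>i\<in>indices. t i \<cdot> basis i) \<in> V"
  by (intro V_sum V_scale basis_in)

lemma coord_eqI:
  assumes "x \<in> V" "y \<in> V" "\<And>j. j \<in> indices \<Longrightarrow> coord x j = coord y j"
  shows "x = y"
  using expand_basis[OF assms(1)] expand_basis[OF assms(2)] sum.cong[OF refl, of indices] assms(3)
  by (metis (no_types, lifting))

lemma B_coord:
  assumes "x \<in> V"
  shows "B x y = (\<Sum>i<n. coord x (i, False) * coord y (i, True) - coord x (i, True) * coord y (i, False))"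
proof -
  have "B x y = B (\<Sum>i<n. B x (F i) \<cdot> E i + B (E i) x \<cdot> F i) y" using expand[OF assms] by simp
  also have "\<dots> = (\<Sum>i<n. B x (F i) * B (E i) y + B (E i) x * B (F i) y)" by (simp add: B_linear)
  also have "\<dots> = (\<Sum>i<n. coord x (i, False) * coord y (i, True) - coord x (i, True) * coord y (i, False))"
    unfolding coord_def using B_skew[of "F _" y] by (intro sum.cong[OF refl]) simp
  finally show ?thesis .
qed

definition transvection :: "'v \<Rightarrow> 'k \<Rightarrow> 'v \<Rightarrow> 'v" where
  "transvection u a x = x + (a * B x u) \<cdot> u"

text \<open>Restricted to \<open>V\<close> this is the symplectic group.  The description by generators allows invariants
  of \<open>G\<close> to be determined by induction.\<close>

inductive_set G :: "('v \<Rightarrow> 'v) set" where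
  id_G: "id \<in> G"
| transvection_step: "g \<in> G \<Longrightarrow> u \<in> V \<Longrightarrow> transvection u a \<circ> g \<in> G"

lemma transvection_in: "u \<in> V \<Longrightarrow> transvection u a \<in> G"
  using transvection_step[OF id_G] by simp

lemma comp_G: "g \<in> G \<Longrightarrow> h \<in> G \<Longrightarrow> g \<circ> h \<in> G"
  by (induction rule: G.induct) (simp_all add: comp_assoc transvection_step)

lemma transvection_inverse: "transvection u (- a) \<circ> transvection u a = id"
  "transvection u a \<circ> transvection u (- a) = id"
  unfolding transvection_def by (auto simp: B_linear fun_eq_iff)

lemma inv_G: "g \<in> G \<Longrightarrow> \<exists>h\<in>G. h \<circ> g = id \<and> g \<circ> h = id"
proof (induction rule: G.induct)
  case id_G
  show ?case using G.id_G by (intro bexI[of _ id]) simp_all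
next
  case (transvection_step g u a)
  then obtain h where h: "h \<in> G" "h \<circ> g = id" "g \<circ> h = id" by blast
  have "(h \<circ> transvection u (- a)) \<circ> (transvection u a \<circ> g) = h \<circ> (transvection u (- a) \<circ> transvection u a) \<circ> g"
    by (simp only: comp_assoc)
  moreover have "(transvection u a \<circ> g) \<circ> (h \<circ> transvection u (- a)) = transvection u a \<circ> (g \<circ> h) \<circ> transvection u (- a)"
    by (simp only: comp_assoc)
  ultimately show ?case using h comp_G transvection_in[OF transvection_step(2)]
    by (intro bexI[of _ "h \<circ> transvection u (- a)"])
      (simp_all only: transvection_inverse comp_id id_comp simp_thms)
qed

lemma G_add: "g \<in> G \<Longrightarrow> g (x + y) = g x + g y"
  by (induction rule: G.induct)
    (simp_all add: transvection_def B_linear scale_left_distrib distrib_left algebra_simps)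

lemma G_scale: "g \<in> G \<Longrightarrow> g (a \<cdot> x) = a \<cdot> g x"
  by (induction rule: G.induct)
    (simp_all add: transvection_def B_linear scale_right_distrib mult.left_commute mult.commute)

lemma G_B: "g \<in> G \<Longrightarrow> B (g x) (g y) = B x y"
proof (induction rule: G.induct)
  case (transvection_step g u a)
  show ?case using B_skew[of "g y" u] B_skew[of u "g y"]
    by (simp add: transvection_def B_linear transvection_step)
qed simp

lemma G_V: "g \<in> G \<Longrightarrow> x \<in> V \<Longrightarrow> g x \<in> V"
  by (induction rule: G.induct) (simp_all add: transvection_def V_add V_scale)

lemma G_zero: "g \<in> G \<Longrightarrow> g 0 = 0" using G_add[of g 0 0] by simp

lemma G_uminus: "g \<in> G \<Longrightarrow> g (- x) = - g x" using G_scale[of g "- 1" x] by simp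

lemma G_diff: "g \<in> G \<Longrightarrow> g (x - y) = g x - g y"
  using G_add[of g x "- y"] by (simp add: G_uminus)

lemma G_sum: "g \<in> G \<Longrightarrow> g (sum f A) = (\<Sum>i\<in>A. g (f i))"
  by (induction A rule: infinite_finite_induct) (simp_all add: G_zero G_add)

lemma transvection_conjugate:
  assumes "h \<in> G" "h \<circ> h' = id"
  shows "h \<circ> transvection u a \<circ> h' = transvection (h u) a"
proof
  fix x
  have x: "h (h' x) = x" using assms(2) by (metis comp_apply id_apply)
  have "B (h' x) u = B x (h u)" using G_B[OF assms(1), of "h' x" u] x by simp
  then show "(h \<circ> transvection u a \<circ> h') x = transvection (h u) a x"
    using x by (simp add: transvection_def G_add[OF assms(1)] G_scale[OF assms(1)])
qed

lemma transvection_moves: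
  assumes "B u u' \<noteq> 0"
  shows "transvection (u' - u) (1 / B u u') u = u'"
  using assms by (simp add: transvection_def B_linear)

lemma move_direct:
  assumes "u \<in> V" "u' \<in> V" "B u u' \<noteq> 0" "\<And>w. w \<in> W \<Longrightarrow> B w u = B w u'"
  shows "\<exists>g\<in>G. g u = u' \<and> (\<forall>w\<in>W. g w = w)"
proof (intro bexI conjI ballI)
  show "transvection (u' - u) (1 / B u u') \<in> G" using assms by (intro transvection_in V_diff)
  show "transvection (u' - u) (1 / B u u') u = u'" by (rule transvection_moves[OF assms(3)])
  show "transvection (u' - u) (1 / B u u') w = w" if "w \<in> W" for w
    using assms(4)[OF that] by (simp add: transvection_def B_linear)
qed

text \<open>A transvection cannot move \<open>u\<close> to a different vector orthogonal to \<open>u\<close>, but two of them can, if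
  the first one moves \<open>u\<close> to a vector \<open>z\<close> that is orthogonal neither to \<open>u\<close> nor to \<open>u'\<close>.\<close>

lemma move_via:
  assumes "u \<in> V" "z \<in> V" "u' \<in> V" "B u z \<noteq> 0" "B z u' \<noteq> 0"
    and "\<And>w. w \<in> W \<Longrightarrow> B w u = B w z" "\<And>w. w \<in> W \<Longrightarrow> B w z = B w u'"
  shows "\<exists>g\<in>G. g u = u' \<and> (\<forall>w\<in>W. g w = w)"
proof -
  obtain g where g: "g \<in> G" "g u = z" "\<And>w. w \<in> W \<Longrightarrow> g w = w"
    using move_direct[OF assms(1,2,4,6)] by blast
  obtain h where h: "h \<in> G" "h z = u'" "\<And>w. w \<in> W \<Longrightarrow> h w = w"
    using move_direct[OF assms(2,3,5,7)] by blast
  show ?thesis using g h comp_G[OF h(1) g(1)] by (intro bexI[of _ "h \<circ> g"]) simp_all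
qed

definition frame :: "nat \<Rightarrow> (nat \<Rightarrow> 'v) \<Rightarrow> (nat \<Rightarrow> 'v) \<Rightarrow> bool" where
  "frame m e f \<longleftrightarrow> (\<forall>i<m. e i \<in> V \<and> f i \<in> V) \<and>
     (\<forall>i<m. \<forall>j<m. B (e i) (f j) = (if i = j then 1 else 0) \<and> B (e i) (e j) = 0 \<and> B (f i) (f j) = 0)"

lemma frame_standard: "frame n E F"
  unfolding frame_def using E_in F_in B_EF B_EE B_FF by simp

lemma frame_le: "frame m e f \<Longrightarrow> k \<le> m \<Longrightarrow> frame k e f"
  unfolding frame_def by auto

lemma frame_image: "frame m e f \<Longrightarrow> g \<in> G \<Longrightarrow> frame m (g \<circ> e) (g \<circ> f)"
  unfolding frame_def by (simp add: G_V G_B)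

lemma frameD:
  assumes "frame m e f" "i < m" "j < m"
  shows "e i \<in> V" "f i \<in> V" "B (e i) (f j) = (if i = j then 1 else 0)"
    "B (f j) (e i) = (if i = j then - 1 else 0)" "B (e i) (e j) = 0" "B (f i) (f j) = 0"
  using assms B_skew[of "f j" "e i"] unfolding frame_def by auto

text \<open>Each new vector is moved into place by transvections that fix the vectors already placed:
  \<open>e\<close> through an intermediate vector pairing nontrivially with \<open>e\<close> and its target, and then
  \<open>f\<close> directly or through \<open>f + e\<close>.\<close>

lemma G_transitive_frames:
  assumes "frame m e f" "frame m e' f'"
  shows "\<exists>g\<in>G. \<forall>i<m. g (e i) = e' i \<and> g (f i) = f' i"
  using assms
proof (induction m)
  case 0
  show ?case using id_G by blast
next
  case (Suc m)
  obtain g where g: "g \<in> G" "\<And>i. i < m \<Longrightarrow> g (e i) = e' i" "\<And>i. i < m \<Longrightarrow> g (f i) = f' i"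
    using Suc.IH[OF frame_le[OF Suc.prems(1)] frame_le[OF Suc.prems(2)]] by auto
  let ?W = "e' ` {..<m} \<union> f' ` {..<m}"
  have fr: "frame (Suc m) (g \<circ> e) (g \<circ> f)" using frame_image[OF Suc.prems(1) g(1)] .
  define e1 f1 e2 f2 where "e1 = g (e m)" and "f1 = g (f m)" and "e2 = e' m" and "f2 = f' m"
  have V: "e1 \<in> V" "f1 \<in> V" "e2 \<in> V" "f2 \<in> V"
    using frameD(1,2)[OF fr, of m m] frameD(1,2)[OF Suc.prems(2), of m m]
    unfolding e1_def f1_def e2_def f2_def by simp_all
  have ef: "B e1 f1 = 1" "B e2 f2 = 1" "B f1 e1 = - 1" "B f2 e2 = - 1"
    using frameD(3,4)[OF fr, of m m] frameD(3,4)[OF Suc.prems(2), of m m]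
    unfolding e1_def f1_def e2_def f2_def by simp_all
  have orth: "B w e1 = 0 \<and> B w f1 = 0 \<and> B w e2 = 0 \<and> B w f2 = 0" if w: "w \<in> ?W" for w
  proof -
    obtain i where i: "i < m" "w = e' i \<or> w = f' i" using w by blast
    then have "w = (g \<circ> e) i \<or> w = (g \<circ> f) i" using g by auto
    then show ?thesis
      using i frameD(3-6)[OF fr, of i m] frameD(3-6)[OF fr, of m i]
        frameD(3-6)[OF Suc.prems(2), of i m] frameD(3-6)[OF Suc.prems(2), of m i]
      unfolding e1_def f1_def e2_def f2_def by auto
  qed
  obtain z where z: "z \<in> V" "B e1 z \<noteq> 0" "B z e2 \<noteq> 0" "\<And>w. w \<in> ?W \<Longrightarrow> B w z = 0"
  proof (cases "B f1 e2 \<noteq> 0")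
    case True
    then show ?thesis using that[of f1] V ef orth by simp
  next
    case False
    show ?thesis
    proof (cases "B e1 f2 \<noteq> 0")
      case True
      then show ?thesis using that[of f2] V ef orth by simp
    next
      case False
      then show ?thesis using that[of "f1 + f2"] \<open>\<not> B f1 e2 \<noteq> 0\<close> V ef orth V_add by (simp add: B_linear)
    qed
  qed
  obtain h where h: "h \<in> G" "h e1 = e2" "\<And>w. w \<in> ?W \<Longrightarrow> h w = w"
    using move_via[OF V(1) z(1) V(3) z(2,3), of ?W] orth z(4) by auto
  have V': "h f1 \<in> V" using G_V[OF h(1)] V by blast
  have e2h: "B e2 (h f1) = 1" using G_B[OF h(1), of e1 f1] h(2) ef by simp
  have orth': "B w (h f1) = 0" if "w \<in> ?W" for w
    using G_B[OF h(1), of w f1] h(3)[OF that] orth[OF that] by simp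
  have "\<exists>k\<in>G. k (h f1) = f2 \<and> (\<forall>w\<in>insert e2 ?W. k w = w)"
  proof (cases "B (h f1) f2 = 0")
    case True
    have "B (h f1) (h f1 + e2) \<noteq> 0" using e2h B_skew[of "h f1" e2] by (simp add: B_linear)
    moreover have "B (h f1 + e2) f2 \<noteq> 0" using True ef by (simp add: B_linear)
    moreover have "B w e2 = 0" if "w \<in> insert e2 ?W" for w using that orth by auto
    ultimately show ?thesis
      using V V' V_add e2h ef orth orth'
      by (intro move_via[of _ "h f1 + e2"]) (auto simp: B_linear)
  next
    case False
    then show ?thesis using V V' e2h ef orth orth' by (intro move_direct) auto
  qed
  then obtain k where k: "k \<in> G" "k (h f1) = f2" "\<And>w. w \<in> insert e2 ?W \<Longrightarrow> k w = w" by blast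
  have "(k \<circ> h \<circ> g) (e i) = e' i \<and> (k \<circ> h \<circ> g) (f i) = f' i" if "i < Suc m" for i
  proof (cases "i = m")
    case True
    then show ?thesis using h(2) k(2) k(3)[of e2] unfolding e1_def f1_def e2_def f2_def by simp
  next
    case False
    then have "i < m" using that by simp
    then show ?thesis using g h(3) k(3) by simp
  qed
  then show ?case using comp_G[OF comp_G[OF k(1) h(1)] g(1)] by (intro bexI[of _ "k \<circ> h \<circ> g"]) simp_all
qed

lemma nondegenerate:
  assumes "u \<in> V" "u \<noteq> 0"
  obtains z where "z \<in> V" "B u z \<noteq> 0"
proof -
  have "\<exists>i<n. B u (F i) \<noteq> 0 \<or> B (E i) u \<noteq> 0"
  proof (rule ccontr)
    assume "\<not> ?thesis"
    then have "u = 0" using expand[OF assms(1)] by simp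
    then show False using assms(2) by simp
  qed
  then obtain i where i: "i < n" "B u (F i) \<noteq> 0 \<or> B (E i) u \<noteq> 0" by blast
  then show thesis using that[OF E_in[OF i(1)]] that[OF F_in[OF i(1)]] B_skew[of u "E i"] by auto
qed

lemma G_stretch:
  assumes "u \<in> V" "u \<noteq> 0" "c \<noteq> 0"
  shows "\<exists>g\<in>G. g u = c \<cdot> u"
proof -
  obtain z where z: "z \<in> V" "B u z \<noteq> 0" using nondegenerate[OF assms(1,2)] .
  then have "B z (c \<cdot> u) \<noteq> 0" using assms(3) B_skew[of z u] by (simp add: B_linear)
  then show ?thesis using move_via[OF assms(1) z(1) V_scale[OF assms(1)] z(2), of c "{}"] by auto
qed

end

section \<open>Lattices\<close>

context symplectic_space
begin

definition submod :: "'v set \<Rightarrow> bool" where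
  "submod L \<longleftrightarrow> L \<subseteq> V \<and> 0 \<in> L \<and> (\<forall>x\<in>L. \<forall>y\<in>L. x + y \<in> L) \<and> (\<forall>a\<in>\<O>. \<forall>x\<in>L. a \<cdot> x \<in> L)"

lemma submodD:
  assumes "submod L"
  shows "L \<subseteq> V" "0 \<in> L" "x \<in> L \<Longrightarrow> y \<in> L \<Longrightarrow> x + y \<in> L" "a \<in> \<O> \<Longrightarrow> x \<in> L \<Longrightarrow> a \<cdot> x \<in> L"
  using assms unfolding submod_def by auto

lemma submod_uminus: "submod L \<Longrightarrow> x \<in> L \<Longrightarrow> - x \<in> L"
  using submodD(4)[of L "- 1" x] uminus_in[OF one_in] by simp

lemma submod_diff: "submod L \<Longrightarrow> x \<in> L \<Longrightarrow> y \<in> L \<Longrightarrow> x - y \<in> L"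
  using submodD(3)[of L x "- y"] submod_uminus by simp

lemma submod_sum: "submod L \<Longrightarrow> (\<And>i. i \<in> A \<Longrightarrow> f i \<in> L) \<Longrightarrow> sum f A \<in> L"
  by (induction A rule: infinite_finite_induct) (simp_all add: submodD)

lemma submod_image:
  assumes g: "g \<in> G" and L: "submod L"
  shows "submod (g ` L)"
  unfolding submod_def
proof (intro conjI ballI)
  show "g ` L \<subseteq> V" using G_V[OF g] submodD(1)[OF L] by blast
  show "0 \<in> g ` L" using G_zero[OF g] submodD(2)[OF L] by (metis imageI)
  show "x + y \<in> g ` L" if "x \<in> g ` L" "y \<in> g ` L" for x y
    using that submodD(3)[OF L] by (auto simp flip: G_add[OF g])
  show "a \<cdot> x \<in> g ` L" if "a \<in> \<O>" "x \<in> g ` L" for a x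
    using that submodD(4)[OF L] by (auto simp flip: G_scale[OF g])
qed

definition lat :: "(nat \<times> bool \<Rightarrow> nat) \<Rightarrow> 'v set" where
  "lat w = {x \<in> V. \<forall>j\<in>indices. coord x j \<in> \<P> (w j)}"

lemma lat_iff: "x \<in> lat w \<longleftrightarrow> x \<in> V \<and> (\<forall>j\<in>indices. coord x j \<in> \<P> (w j))"
  unfolding lat_def by blast

lemma submod_lat: "submod (lat w)"
  unfolding submod_def
  by (auto simp: lat_iff V_zero V_add V_scale coord_zero coord_add coord_scale P_zero P_add P_scale)

abbreviation L0 :: "'v set" where "L0 \<equiv> lat (\<lambda>_. 0)"

lemma L0_iff: "x \<in> L0 \<longleftrightarrow> x \<in> V \<and> (\<forall>j\<in>indices. coord x j \<in> \<O>)"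
  by (simp add: lat_iff P_0)

lemma lat_subset_L0: "lat w \<subseteq> L0"
  unfolding lat_def P_0 using P_subset by blast

lemma basis_L0: "j \<in> indices \<Longrightarrow> basis j \<in> L0"
  by (auto simp: L0_iff basis_in coord_basis one_in zero_in)

lemma B_L0: "x \<in> L0 \<Longrightarrow> y \<in> L0 \<Longrightarrow> B x y \<in> \<O>"
  using P_sum[of "{..<n}" "\<lambda>i. coord x (i, False) * coord y (i, True) - coord x (i, True) * coord y (i, False)" 0]
  by (simp add: B_coord L0_iff P_0 diff_in mult_in)

lemma coord_eq_B: "coord x j = B x (basis (fst j, True)) \<or> coord x j = - B x (basis (fst j, False))"
  unfolding coord_def basis_def using B_skew[of "E (fst j)" x] by auto

lemma L0_self_dual:
  assumes "x \<in> V" "\<And>y. y \<in> L0 \<Longrightarrow> B x y \<in> \<O>"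
  shows "x \<in> L0"
  unfolding L0_iff
proof (intro conjI ballI assms(1))
  fix j assume "j \<in> indices"
  then have "(fst j, b) \<in> indices" for b by auto
  then show "coord x j \<in> \<O>" using coord_eq_B[of x j] assms(2) basis_L0 uminus_in by metis
qed

definition absorbs :: "'v set \<Rightarrow> 'v set \<Rightarrow> bool" where
  "absorbs x y \<longleftrightarrow> (\<exists>N. \<forall>v\<in>x. \<pi> ^ N \<cdot> v \<in> y)"

lemma absorbs_trans:
  assumes "absorbs x y" "absorbs y z"
  shows "absorbs x z"
proof -
  obtain N M where "\<forall>v\<in>x. \<pi> ^ N \<cdot> v \<in> y" "\<forall>v\<in>y. \<pi> ^ M \<cdot> v \<in> z"
    using assms unfolding absorbs_def by blast
  then have "\<forall>v\<in>x. \<pi> ^ (M + N) \<cdot> v \<in> z" by (metis power_add scale_scale)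
  then show ?thesis unfolding absorbs_def by blast
qed

lemma absorbs_image:
  assumes g: "g \<in> G" and "absorbs x y"
  shows "absorbs (g ` x) (g ` y)"
proof -
  obtain N where "\<forall>v\<in>x. \<pi> ^ N \<cdot> v \<in> y" using assms(2) unfolding absorbs_def by blast
  then have "\<forall>v\<in>g ` x. \<pi> ^ N \<cdot> v \<in> g ` y" by (auto simp flip: G_scale[OF g])
  then show ?thesis unfolding absorbs_def by blast
qed

lemma L0_absorbs_vector:
  assumes "v \<in> V"
  shows "\<exists>N. \<forall>M\<ge>N. \<pi> ^ M \<cdot> v \<in> L0"
proof -
  have "\<forall>j. \<exists>N. \<forall>M\<ge>N. \<pi> ^ M * coord v j \<in> \<O>" using exhausted_le by blast
  then obtain N where N: "\<And>j M. M \<ge> N j \<Longrightarrow> \<pi> ^ M * coord v j \<in> \<O>" by metis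
  have "\<pi> ^ M \<cdot> v \<in> L0" if M: "M \<ge> (\<Sum>j\<in>indices. N j)" for M
  proof -
    have "N j \<le> M" if "j \<in> indices" for j
      using member_le_sum[of j indices N] that M by simp
    then show ?thesis using N by (simp add: L0_iff V_scale assms coord_scale)
  qed
  then show ?thesis by blast
qed

text \<open>The scaled transvection differs from the identity by \<open>\<pi>\<^bsup>2 N\<^esup>\<close> times a fixed linear map.\<close>

lemma transvection_small:
  assumes "u \<in> V"
  shows "\<exists>M. \<forall>N\<ge>M. \<forall>x\<in>L0. transvection (\<pi> ^ N \<cdot> u) a x \<in> L0"
proof -
  obtain N where N: "\<And>M. M \<ge> N \<Longrightarrow> \<pi> ^ M \<cdot> u \<in> L0" using L0_absorbs_vector[OF assms] by blast
  obtain K where K: "\<And>M. M \<ge> K \<Longrightarrow> \<pi> ^ M * a \<in> \<O>" using exhausted_le by blast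
  have "transvection (\<pi> ^ M \<cdot> u) a x \<in> L0" if M: "M \<ge> N + K" and x: "x \<in> L0" for M x
  proof -
    have "\<pi> ^ M = \<pi> ^ (M - N) * \<pi> ^ N" using M by (simp flip: power_add)
    moreover have "\<pi> ^ (M - N) * a * B x (\<pi> ^ M \<cdot> u) \<in> \<O>"
      using mult_in[OF K[of "M - N"] B_L0[OF x N[of M]]] M by simp
    ultimately have "(\<pi> ^ (M - N) * a * B x (\<pi> ^ M \<cdot> u)) \<cdot> \<pi> ^ N \<cdot> u \<in> L0"
      using N submodD(4)[OF submod_lat] by blast
    moreover have "(\<pi> ^ (M - N) * a * B x (\<pi> ^ M \<cdot> u)) \<cdot> \<pi> ^ N \<cdot> u = (a * B x (\<pi> ^ M \<cdot> u)) \<cdot> \<pi> ^ M \<cdot> u"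
      using \<open>\<pi> ^ M = _\<close> by (simp add: mult_ac)
    ultimately show ?thesis unfolding transvection_def using x submodD(3)[OF submod_lat] by simp
  qed
  then show ?thesis by blast
qed

lemma transvection_preserves:
  assumes "\<And>x. x \<in> L \<Longrightarrow> transvection u a x \<in> L" "\<And>x. x \<in> L \<Longrightarrow> transvection u (- a) x \<in> L"
  shows "transvection u a ` L = L"
proof
  show "transvection u a ` L \<subseteq> L" using assms(1) by blast
  show "L \<subseteq> transvection u a ` L"
  proof
    fix x assume "x \<in> L"
    then have "transvection u a (transvection u (- a) x) \<in> transvection u a ` L" using assms(2) by blast
    then show "x \<in> transvection u a ` L" using fun_cong[OF transvection_inverse(2), of u a x] by simp
  qed
qed

lemma transvection_absorbs:
  assumes "u \<in> V"
  shows "absorbs (transvection u a ` L0) L0"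
proof -
  obtain N where N: "\<And>M. M \<ge> N \<Longrightarrow> \<pi> ^ M \<cdot> u \<in> L0" using L0_absorbs_vector[OF assms] by blast
  obtain K where K: "\<And>M. M \<ge> K \<Longrightarrow> \<pi> ^ M * a \<in> \<O>" using exhausted_le by blast
  have "\<pi> ^ (K + N + N) \<cdot> transvection u a x \<in> L0" if x: "x \<in> L0" for x
  proof -
    have "\<pi> ^ K * a * B x (\<pi> ^ N \<cdot> u) \<in> \<O>"
      by (rule mult_in[OF K[OF order_refl] B_L0[OF x N[OF order_refl]]])
    then have "(\<pi> ^ K * a * B x (\<pi> ^ N \<cdot> u)) \<cdot> \<pi> ^ N \<cdot> u \<in> L0"
      using N submodD(4)[OF submod_lat] by blast
    moreover have "\<pi> ^ (K + N + N) \<cdot> x \<in> L0" using x submodD(4)[OF submod_lat] pi_power_in by blast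
    moreover have "\<pi> ^ (K + N + N) \<cdot> transvection u a x =
        \<pi> ^ (K + N + N) \<cdot> x + (\<pi> ^ K * a * B x (\<pi> ^ N \<cdot> u)) \<cdot> \<pi> ^ N \<cdot> u"
      by (simp add: transvection_def scale_right_distrib B_linear power_add mult_ac)
    ultimately show ?thesis using submodD(3)[OF submod_lat] by simp
  qed
  then show ?thesis unfolding absorbs_def by blast
qed

lemma G_absorbs: "g \<in> G \<Longrightarrow> absorbs (g ` L0) L0"
proof (induction rule: G.induct)
  case id_G
  show ?case unfolding absorbs_def by (intro exI[of _ 0]) simp
next
  case (transvection_step g u a)
  have "absorbs (transvection u a ` g ` L0) (transvection u a ` L0)"
    by (rule absorbs_image[OF transvection_in[OF transvection_step(2)] transvection_step(3)])
  then show ?case using absorbs_trans transvection_absorbs[OF transvection_step(2)]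
    by (metis image_comp)
qed

lemma G_absorbs': assumes "g \<in> G" shows "absorbs L0 (g ` L0)"
proof -
  obtain h where h: "h \<in> G" "g \<circ> h = id" using inv_G[OF assms] by blast
  have "absorbs (g ` h ` L0) (g ` L0)" by (rule absorbs_image[OF assms G_absorbs[OF h(1)]])
  then show ?thesis using h(2) by (simp add: image_comp)
qed

text \<open>The lattices commensurable with \<open>L0\<close>; among the submodules of \<open>V\<close> these are the lattices of
  full rank.\<close>

definition Y :: "'v set set" where
  "Y = {x. submod x \<and> absorbs x L0 \<and> absorbs L0 x}"

lemma G_Y: assumes "g \<in> G" "x \<in> Y" shows "g ` x \<in> Y"
  using assms submod_image absorbs_trans[OF absorbs_image[of g x L0] G_absorbs[of g]]
    absorbs_trans[OF G_absorbs'[of g] absorbs_image[of g L0 x]]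
  unfolding Y_def by blast

text \<open>These submodules are unions of classes of \<open>\<pi>\<^sup>-\<^sup>N L0\<close> modulo \<open>\<pi>\<^sup>N L0\<close>, of which there are finitely
  many.\<close>

lemma finite_between:
  "finite {z. submod z \<and> (\<forall>v\<in>L0. \<pi> ^ N \<cdot> v \<in> z) \<and> (\<forall>v\<in>z. \<pi> ^ N \<cdot> v \<in> L0)}"
proof -
  obtain T where T: "finite T" "T \<subseteq> \<O>" "\<And>x. x \<in> \<O> \<Longrightarrow> \<exists>t\<in>T. x - t \<in> \<P> (N + N)"
    using finite_residues_power[of "N + N"] by blast
  define R where "R = (\<lambda>t. inverse (\<pi> ^ N) \<cdot> (\<Sum>j\<in>indices. t j \<cdot> basis j)) ` (indices \<rightarrow>\<^sub>E T)"
  have finR: "finite R" unfolding R_def using T(1) by (intro finite_imageI finite_PiE) auto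
  have rep: "\<exists>\<rho>\<in>R. \<exists>y\<in>L0. v = \<rho> + \<pi> ^ N \<cdot> y" if v: "v \<in> V" "\<pi> ^ N \<cdot> v \<in> L0" for v
  proof -
    have "\<exists>t. t \<in> T \<and> coord (\<pi> ^ N \<cdot> v) j - t \<in> \<P> (N + N)" if "j \<in> indices" for j
      using v(2) that T(3) unfolding L0_iff by blast
    then obtain t where t: "\<And>j. j \<in> indices \<Longrightarrow> t j \<in> T \<and> coord (\<pi> ^ N \<cdot> v) j - t j \<in> \<P> (N + N)"
      by metis
    let ?t = "restrict t indices"
    let ?\<rho> = "inverse (\<pi> ^ N) \<cdot> (\<Sum>j\<in>indices. ?t j \<cdot> basis j)"
    let ?y = "inverse (\<pi> ^ N) \<cdot> (v - ?\<rho>)"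
    have "?\<rho> \<in> R" unfolding R_def by (intro imageI PiE_I) (simp_all only: restrict_apply t if_True if_False)
    moreover have "?y \<in> L0"
      unfolding L0_iff
    proof (intro conjI ballI)
      show "?y \<in> V" using v(1) comb_in by (intro V_scale V_diff) auto
      fix j assume j: "j \<in> indices"
      have "\<pi> ^ (N + N) * coord ?y j = coord (\<pi> ^ N \<cdot> v) j - t j"
        using j coord_comb[OF j, of ?t] pi_nonzero
        by (simp add: coord_scale coord_diff power_add field_simps)
      then have "\<pi> ^ (N + N) * coord ?y j \<in> \<P> (N + N + 0)" using t[OF j] by simp
      then show "coord ?y j \<in> \<O>" using P_pi_power[of "N + N" _ 0] P_0 by blast
    qed
    moreover have "v = ?\<rho> + \<pi> ^ N \<cdot> ?y" using pi_nonzero by simp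
    ultimately show ?thesis by blast
  qed
  let ?\<phi> = "\<lambda>S. {v. \<exists>\<rho>\<in>S. \<exists>y\<in>L0. v = \<rho> + \<pi> ^ N \<cdot> y}"
  have "z \<in> ?\<phi> ` Pow R"
    if z: "submod z" "\<forall>v\<in>L0. \<pi> ^ N \<cdot> v \<in> z" "\<forall>v\<in>z. \<pi> ^ N \<cdot> v \<in> L0" for z
  proof -
    have "z = ?\<phi> (z \<inter> R)"
    proof (intro equalityI subsetI)
      fix v assume v: "v \<in> z"
      then obtain \<rho> y where y: "\<rho> \<in> R" "y \<in> L0" "v = \<rho> + \<pi> ^ N \<cdot> y"
        using rep z(3) submodD(1)[OF z(1)] by blast
      then have "\<rho> \<in> z" using submod_diff[OF z(1) v, of "\<pi> ^ N \<cdot> y"] z(2) by simp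
      then show "v \<in> ?\<phi> (z \<inter> R)" using y by blast
    next
      fix v assume "v \<in> ?\<phi> (z \<inter> R)"
      then show "v \<in> z" using z(2) submodD(3)[OF z(1)] by blast
    qed
    then show ?thesis by blast
  qed
  then have "{z. submod z \<and> (\<forall>v\<in>L0. \<pi> ^ N \<cdot> v \<in> z) \<and> (\<forall>v\<in>z. \<pi> ^ N \<cdot> v \<in> L0)} \<subseteq> ?\<phi> ` Pow R"
    by (intro subsetI) (elim CollectE conjE)
  moreover have "finite (?\<phi> ` Pow R)" by (intro finite_imageI) (simp add: finR)
  ultimately show ?thesis by (rule finite_subset)
qed

text \<open>The stabilizer of \<open>x\<close> keeps \<open>y\<close> between fixed multiples of \<open>x\<close>.\<close>

lemma finite_suborbit_Y:
  assumes "x \<in> Y" "y \<in> Y"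
  shows "finite {g ` y |g. g \<in> G \<and> g ` x = x}"
proof -
  have "absorbs x y" "absorbs y x" using assms absorbs_trans unfolding Y_def by blast+
  then obtain N M where N: "\<forall>v\<in>x. \<pi> ^ N \<cdot> v \<in> y" and M: "\<forall>v\<in>y. \<pi> ^ M \<cdot> v \<in> x"
    unfolding absorbs_def by blast
  obtain N' M' where N': "\<forall>v\<in>L0. \<pi> ^ N' \<cdot> v \<in> x" and M': "\<forall>v\<in>x. \<pi> ^ M' \<cdot> v \<in> L0"
    using assms unfolding Y_def absorbs_def by blast
  let ?K = "(N + N') + (M + M')"
  have "submod (g ` y) \<and> (\<forall>v\<in>L0. \<pi> ^ ?K \<cdot> v \<in> g ` y) \<and> (\<forall>v\<in>g ` y. \<pi> ^ ?K \<cdot> v \<in> L0)"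
    if g: "g \<in> G" "g ` x = x" for g
  proof (intro conjI ballI)
    show sub: "submod (g ` y)" using submod_image[OF g(1)] assms(2) unfolding Y_def by blast
    fix v assume "v \<in> L0"
    then have "\<pi> ^ N' \<cdot> v \<in> g ` x" using N' g(2) by simp
    then obtain v' where v': "v' \<in> x" "\<pi> ^ N' \<cdot> v = g v'" by blast
    then have "\<pi> ^ N \<cdot> \<pi> ^ N' \<cdot> v \<in> g ` y" using N by (simp flip: G_scale[OF g(1)])
    then have "\<pi> ^ (M + M') \<cdot> \<pi> ^ N \<cdot> \<pi> ^ N' \<cdot> v \<in> g ` y" using submodD(4)[OF sub pi_power_in] by blast
    then show "\<pi> ^ ?K \<cdot> v \<in> g ` y" by (simp add: power_add mult_ac)
  next
    fix v assume "v \<in> g ` y"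
    then obtain v' where v': "v' \<in> y" "v = g v'" by blast
    then have "\<pi> ^ M \<cdot> v \<in> g ` x" using M by (simp flip: G_scale[OF g(1)])
    then have "\<pi> ^ M \<cdot> v \<in> x" by (simp only: g(2))
    then have "\<pi> ^ M' \<cdot> \<pi> ^ M \<cdot> v \<in> L0" using M' by blast
    then have "\<pi> ^ (N + N') \<cdot> \<pi> ^ M' \<cdot> \<pi> ^ M \<cdot> v \<in> L0" using submodD(4)[OF submod_lat pi_power_in] by blast
    then show "\<pi> ^ ?K \<cdot> v \<in> L0" by (simp add: power_add mult_ac)
  qed
  then show ?thesis by (intro finite_subset[OF _ finite_between[of ?K]] subsetI) (elim CollectE exE conjE, simp)
qed

sublocale set_action G Y
proof
  show "id \<in> G" by (rule id_G)
  show "g \<circ> h \<in> G" if "g \<in> G" "h \<in> G" for g h using that by (rule comp_G)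
  show "\<exists>h\<in>G. h \<circ> g = id \<and> g \<circ> h = id" if "g \<in> G" for g using that by (rule inv_G)
  show "g ` x \<in> Y" if "g \<in> G" "x \<in> Y" for g x using that by (rule G_Y)
  show "finite {g ` y |g. g \<in> G \<and> g ` x = x}" if "x \<in> Y" "y \<in> Y" for x y
    using that by (rule finite_suborbit_Y)
qed

lemma lat_Y: "lat w \<in> Y"
  unfolding Y_def
proof (intro CollectI conjI submod_lat)
  show "absorbs (lat w) L0"
    unfolding absorbs_def using lat_subset_L0 by (intro exI[of _ 0]) auto
  let ?N = "\<Sum>j\<in>indices. w j"
  have "\<pi> ^ ?N \<cdot> v \<in> lat w" if v: "v \<in> L0" for v
    unfolding lat_iff
  proof (intro conjI ballI)
    show "\<pi> ^ ?N \<cdot> v \<in> V" using v V_scale L0_iff by blast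
    fix j assume j: "j \<in> indices"
    have "w j \<le> ?N" using member_le_sum[of j indices w] j by simp
    moreover have "\<pi> ^ ?N * coord v j \<in> \<P> (?N + 0)" using P_mult[OF pi_power_mem] v j P_0 L0_iff by blast
    ultimately show "coord (\<pi> ^ ?N \<cdot> v) j \<in> \<P> (w j)" using P_antimono by (auto simp: coord_scale)
  qed
  then show "absorbs L0 (lat w)" unfolding absorbs_def by blast
qed

text \<open>The symplectic group has no nontrivial character with values in the positive reals, because
  it is generated by transvections and each of them is conjugate to one that is congruent to the
  identity modulo a high power of \<open>\<pi>\<close>, hence stabilizes \<open>L0\<close>.\<close>

lemma index_L0_orbit: "g \<in> G \<Longrightarrow> index L0 (g ` L0) = 1"
proof (induction rule: G.induct)
  case id_G
  show ?case by (simp add: index_self lat_Y)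
next
  case (transvection_step g u a)
  have "index L0 (transvection u a ` L0) = 1"
  proof (cases "u = 0")
    case True
    then have "transvection u a ` L0 = L0" unfolding transvection_def by simp
    then show ?thesis by (simp add: index_self lat_Y)
  next
    case False
    obtain M where M: "\<And>N x. N \<ge> M \<Longrightarrow> x \<in> L0 \<Longrightarrow> transvection (\<pi> ^ N \<cdot> u) a x \<in> L0"
      using transvection_small[OF transvection_step(2), of a] by blast
    obtain M' where M': "\<And>N x. N \<ge> M' \<Longrightarrow> x \<in> L0 \<Longrightarrow> transvection (\<pi> ^ N \<cdot> u) (- a) x \<in> L0"
      using transvection_small[OF transvection_step(2), of "- a"] by blast
    let ?u = "\<pi> ^ (M + M') \<cdot> u"
    have fixed: "transvection ?u a ` L0 = L0" using M M' by (intro transvection_preserves) auto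
    have nz: "\<pi> ^ (M + M') \<noteq> 0" using pi_nonzero by simp
    obtain h where h: "h \<in> G" "h u = ?u" using G_stretch[OF transvection_step(2) False nz] by blast
    obtain h' where h': "h' \<in> G" "h' \<circ> h = id" "h \<circ> h' = id" using inv_G[OF h(1)] by blast
    have "(h \<circ> transvection u a \<circ> h') ` L0 = L0"
      by (simp only: transvection_conjugate[OF h(1) h'(3)] h(2) fixed)
    then show ?thesis
      by (rule index_conjugate[OF lat_Y h(1) h'(1) transvection_in[OF transvection_step(2)] h'(2)])
  qed
  then show ?case
    using index_hom[OF lat_Y transvection_in[OF transvection_step(2)] transvection_step(1)]
      transvection_step(3) by simp
qed

text \<open>Gram-Schmidt: a vector of a self-dual lattice that is not divisible by \<open>\<pi>\<close> has a partner
  with pairing \<open>1\<close>, and the orthogonal complement of the two is handled in the same way.\<close>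

lemma self_dual_orbit:
  assumes L: "submod L" "absorbs L L0"
    and dual: "\<And>x. x \<in> V \<Longrightarrow> x \<in> L \<longleftrightarrow> (\<forall>y\<in>L. B x y \<in> \<O>)"
  shows "\<exists>g\<in>G. g ` L0 = L"
proof -
  obtain N where N: "\<And>y. y \<in> L \<Longrightarrow> \<pi> ^ N \<cdot> y \<in> L0" using L(2) unfolding absorbs_def by blast
  have "\<exists>e f. frame m e f \<and> (\<forall>i<m. e i \<in> L \<and> f i \<in> L)" if "m \<le> n" for m
    using that
  proof (induction m)
    case 0
    show ?case unfolding frame_def by simp
  next
    case (Suc m)
    then obtain e f where ef: "frame m e f" "\<And>i. i < m \<Longrightarrow> e i \<in> L \<and> f i \<in> L" by auto
    have m: "m < n" using Suc.prems by simp
    obtain g where g: "g \<in> G" "\<And>i. i < m \<Longrightarrow> g (E i) = e i" "\<And>i. i < m \<Longrightarrow> g (F i) = f i"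
      using G_transitive_frames[OF frame_le[OF frame_standard] ef(1)] m by auto
    define v0 where "v0 = g (E m)"
    have v0V: "v0 \<in> V" unfolding v0_def using G_V[OF g(1) E_in[OF m]] .
    have v0_orth: "B v0 (e i) = 0" "B v0 (f i) = 0" if "i < m" for i
      using G_B[OF g(1), of "E m" "E i"] G_B[OF g(1), of "E m" "F i"] g(2,3)[OF that]
        B_EE[OF m, of i] B_EF[OF m, of i] that m
      unfolding v0_def by auto
    obtain K where K: "\<pi> ^ K \<cdot> g (F m) \<in> L0" using L0_absorbs_vector[OF G_V[OF g(1) F_in[OF m]]] by blast
    obtain M where M: "\<pi> ^ M \<cdot> v0 \<in> L0" using L0_absorbs_vector[OF v0V] by blast
    have start: "\<pi> ^ (M + N) \<cdot> v0 \<in> L"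
    proof -
      have "B (\<pi> ^ (M + N) \<cdot> v0) y \<in> \<O>" if "y \<in> L" for y
        using B_L0[OF M N[OF that]] by (simp add: B_linear power_add mult_ac)
      then show ?thesis using dual[OF V_scale[OF v0V]] by blast
    qed
    \<comment> \<open>divide by \<open>\<pi>\<close> as long as the quotient stays in \<open>L\<close>, to get a vector not divisible by \<open>\<pi>\<close>\<close>
    define w where "w k = inverse (\<pi> ^ k) \<cdot> \<pi> ^ (M + N) \<cdot> v0" for k
    have "\<exists>k. w k \<in> L \<and> w (Suc k) \<notin> L"
    proof (rule ccontr)
      assume "\<nexists>k. w k \<in> L \<and> w (Suc k) \<notin> L"
      then have step: "w k \<in> L \<Longrightarrow> w (Suc k) \<in> L" for k by blast
      have all: "w k \<in> L" for k
        by (induction k) (use start step in \<open>simp_all add: w_def\<close>)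
      have "B (\<pi> ^ N \<cdot> w (N + K + (M + N) + 1)) (\<pi> ^ K \<cdot> g (F m)) \<in> \<O>" using B_L0[OF N[OF all] K] .
      moreover have "B (\<pi> ^ N \<cdot> w (N + K + (M + N) + 1)) (\<pi> ^ K \<cdot> g (F m)) = inverse \<pi>"
        using G_B[OF g(1), of "E m" "F m"] B_EF[OF m m] pi_nonzero
        unfolding w_def v0_def by (simp add: B_linear power_add field_simps)
      ultimately show False using pi_nonunit by simp
    qed
    then obtain k where k: "w k \<in> L" "w (Suc k) \<notin> L" by blast
    define v where "v = w k"
    have vV: "v \<in> V" using k(1) submodD(1)[OF L(1)] unfolding v_def by blast
    have v_orth: "B v (e i) = 0" "B v (f i) = 0" if "i < m" for i
      using v0_orth[OF that] unfolding v_def w_def by (simp_all add: B_linear)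
    have "inverse \<pi> \<cdot> v = w (Suc k)" unfolding v_def w_def by (simp add: field_simps)
    then have "inverse \<pi> \<cdot> v \<notin> L" using k(2) by simp
    then obtain y where y: "y \<in> L" "B (inverse \<pi> \<cdot> v) y \<notin> \<O>" using dual[OF V_scale[OF vV]] by blast
    have "B v y \<in> \<O>" using dual[OF vV] k(1) y(1) unfolding v_def by blast
    moreover have "B v y \<notin> \<P> 1" using y(2) pi_nonzero by (simp add: P_iff B_linear divide_inverse mult.commute)
    ultimately have unit: "B v y \<in> units" unfolding units_def by blast
    define y' where "y' = inverse (B v y) \<cdot> y"
    have y': "y' \<in> L" "B v y' = 1"
      using y(1) inverse_unit[OF unit] units_subset submodD(4)[OF L(1)] unit_nonzero[OF unit]
      unfolding y'_def by (auto simp: B_linear)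
    have LB: "B x x' \<in> \<O>" if "x \<in> L" "x' \<in> L" for x x'
      using dual[of x] that submodD(1)[OF L(1)] by blast
    define z where "z = y' - (\<Sum>i<m. B y' (f i) \<cdot> e i + B (e i) y' \<cdot> f i)"
    have zL: "z \<in> L"
      unfolding z_def using y'(1) ef(2) LB
      by (intro submod_diff submod_sum L(1) submodD(3)[OF L(1)] submodD(4)[OF L(1)]) auto
    have z_orth: "B z (e j) = 0 \<and> B z (f j) = 0" if j: "j < m" for j
    proof -
      have "(\<Sum>i<m. B y' (f i) * B (e i) (e j) + B (e i) y' * B (f i) (e j)) =
          (\<Sum>i<m. if i = j then - B (e i) y' else 0)"
        using frameD(4,5)[OF ef(1) _ j] frameD(4)[OF ef(1) j] j by (intro sum.cong[OF refl]) auto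
      moreover have "(\<Sum>i<m. B y' (f i) * B (e i) (f j) + B (e i) y' * B (f i) (f j)) =
          (\<Sum>i<m. if i = j then B y' (f i) else 0)"
        using frameD(3,6)[OF ef(1) _ j] j by (intro sum.cong[OF refl]) auto
      ultimately show ?thesis using j B_skew[of y' "e j"] unfolding z_def by (simp add: B_linear)
    qed
    have vz: "B v z = 1" unfolding z_def using y'(2) v_orth by (simp add: B_linear)
    have rev: "B (e i) v = 0" "B (f i) v = 0" "B (e i) z = 0" "B (f i) z = 0" if "i < m" for i
      using v_orth[OF that] z_orth[OF that] B_skew[of "e i" v] B_skew[of "f i" v]
        B_skew[of "e i" z] B_skew[of "f i" z] by simp_all
    have zV: "z \<in> V" using zL submodD(1)[OF L(1)] by blast
    have "frame (Suc m) (e(m := v)) (f(m := z))"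
      unfolding frame_def
    proof (intro conjI allI impI)
      fix i assume "i < Suc m"
      then show "(e(m := v)) i \<in> V" "(f(m := z)) i \<in> V"
        using frameD(1,2)[OF ef(1), of i i] vV zV by (auto simp: less_Suc_eq)
    next
      fix i j assume ij: "i < Suc m" "j < Suc m"
      show "B ((e(m := v)) i) ((f(m := z)) j) = (if i = j then 1 else 0)"
        "B ((e(m := v)) i) ((e(m := v)) j) = 0" "B ((f(m := z)) i) ((f(m := z)) j) = 0"
        using ij frameD(3,5,6)[OF ef(1), of i j] v_orth z_orth rev vz
        by (cases "i = m"; cases "j = m"; simp)+
    qed
    moreover have "\<forall>i<Suc m. (e(m := v)) i \<in> L \<and> (f(m := z)) i \<in> L"
      using ef(2) zL k(1) unfolding v_def by (simp add: less_Suc_eq)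
    ultimately show ?case by blast
  qed
  then obtain e f where ef: "frame n e f" "\<And>i. i < n \<Longrightarrow> e i \<in> L \<and> f i \<in> L" by blast
  obtain g where g: "g \<in> G" "\<And>i. i < n \<Longrightarrow> g (E i) = e i" "\<And>i. i < n \<Longrightarrow> g (F i) = f i"
    using G_transitive_frames[OF frame_standard ef(1)] by blast
  have sub: "g x \<in> L" if x: "x \<in> L0" for x
  proof -
    have "g x = (\<Sum>j\<in>indices. coord x j \<cdot> g (basis j))"
      using arg_cong[OF expand_basis, of x g] x by (simp add: L0_iff G_sum[OF g(1)] G_scale[OF g(1)])
    moreover have "g (basis j) \<in> L" if "j \<in> indices" for j
      using that g(2,3) ef(2) unfolding basis_def by auto
    moreover have "coord x j \<in> \<O>" if "j \<in> indices" for j using x that unfolding L0_iff by blast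
    ultimately show ?thesis
      by (simp only:) (intro submod_sum[OF L(1)] submodD(4)[OF L(1)])
  qed
  obtain h where h: "h \<in> G" "g \<circ> h = id" using inv_G[OF g(1)] by blast
  have "y \<in> g ` L0" if y: "y \<in> L" for y
  proof -
    have gh: "g (h y) = y" using h(2) by (metis comp_apply id_apply)
    have yV: "y \<in> V" using y submodD(1)[OF L(1)] by blast
    have "B (h y) x \<in> \<O>" if "x \<in> L0" for x
      using G_B[OF g(1), of "h y" x] gh dual[OF yV] y sub[OF that] by metis
    then have "h y \<in> L0" using L0_self_dual G_V[OF h(1) yV] by blast
    then show ?thesis using gh by (metis imageI)
  qed
  then have "g ` L0 = L" using sub by blast
  then show ?thesis using g(1) by blast
qed

end

section \<open>The index of one step\<close>

context symplectic_space
begin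

text \<open>If \<open>\<Lambda>\<close> has a basis with Gram matrix of type \<open>\<mu>\<close>, then \<open>\<pi>\<^sup>-\<^sup>M B\<close> induces an alternating form over the
  residue field on \<open>level M \<Lambda>\<close>; modulo its radical, it is the symplectic space belonging to the parts
  of \<open>\<mu>\<close> equal to \<open>M\<close>.  The vectors outside the radical are those of \<open>prim M \<Lambda>\<close>.  The stabilizer of \<open>\<Lambda>\<close>
  permutes them transitively, so the neighbours \<open>enlarge \<Lambda> v\<close> that they define form one suborbit, and
  so do the neighbours \<open>shrink M \<Lambda> v\<close>.\<close>

definition level :: "nat \<Rightarrow> 'v set \<Rightarrow> 'v set" where
  "level M \<Lambda> = {v \<in> \<Lambda>. \<forall>x\<in>\<Lambda>. B v x \<in> \<P> M}"

definition prim :: "nat \<Rightarrow> 'v set \<Rightarrow> 'v set" where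
  "prim M \<Lambda> = {v \<in> level M \<Lambda>. \<exists>z\<in>level M \<Lambda>. B v z \<notin> \<P> (Suc M)}"

definition enlarge :: "'v set \<Rightarrow> 'v \<Rightarrow> 'v set" where
  "enlarge \<Lambda> v = {x + a \<cdot> inverse \<pi> \<cdot> v |x a. x \<in> \<Lambda> \<and> a \<in> \<O>}"

definition shrink :: "nat \<Rightarrow> 'v set \<Rightarrow> 'v \<Rightarrow> 'v set" where
  "shrink M \<Lambda> w = {x \<in> \<Lambda>. B x w \<in> \<P> (Suc M)}"

lemma level_add: "submod \<Lambda> \<Longrightarrow> v \<in> level M \<Lambda> \<Longrightarrow> w \<in> level M \<Lambda> \<Longrightarrow> v + w \<in> level M \<Lambda>"
  unfolding level_def by (simp add: submodD B_linear P_add)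

lemma level_diff: "submod \<Lambda> \<Longrightarrow> v \<in> level M \<Lambda> \<Longrightarrow> w \<in> level M \<Lambda> \<Longrightarrow> v - w \<in> level M \<Lambda>"
  unfolding level_def by (simp add: submod_diff B_linear P_diff)

lemma level_subset: "level M \<Lambda> \<subseteq> \<Lambda>" unfolding level_def by blast

lemma level_pairing: "v \<in> level M \<Lambda> \<Longrightarrow> x \<in> \<Lambda> \<Longrightarrow> B v x \<in> \<P> M \<and> B x v \<in> \<P> M"
  unfolding level_def using B_skew[of x v] by simp

lemma prim_subset: "prim M \<Lambda> \<subseteq> level M \<Lambda>" unfolding prim_def by blast

text \<open>If \<open>B u u'\<close> generates the ideal that contains all pairings of \<open>u' - u\<close> with \<open>\<Lambda>\<close>, then the
  transvection moving \<open>u\<close> to \<open>u'\<close> is integral on \<open>\<Lambda>\<close>.\<close>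

lemma stabilizer_moves_direct:
  assumes \<Lambda>: "submod \<Lambda>" and u: "u \<in> level M \<Lambda>" "u' \<in> level M \<Lambda>" "B u u' \<notin> \<P> (Suc M)"
  shows "\<exists>g\<in>G. g ` \<Lambda> = \<Lambda> \<and> g u = u'"
proof (intro bexI conjI)
  have d: "u' - u \<in> level M \<Lambda>" using level_diff[OF \<Lambda>] u by blast
  have uu: "B u u' \<in> \<P> M" using level_pairing[OF u(1)] u(2) level_subset by blast
  have int: "B x (u' - u) / B u u' \<in> \<O>" if "x \<in> \<Lambda>" for x
    using level_divide(2)[OF uu u(3)] level_pairing[OF d that] by blast
  have dL: "u' - u \<in> \<Lambda>" using d level_subset by blast
  show "transvection (u' - u) (1 / B u u') ` \<Lambda> = \<Lambda>"
  proof (rule transvection_preserves)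
    fix x assume x: "x \<in> \<Lambda>"
    then show "transvection (u' - u) (1 / B u u') x \<in> \<Lambda>"
      using submodD(3)[OF \<Lambda> x submodD(4)[OF \<Lambda> int[OF x] dL]] by (simp add: transvection_def)
    show "transvection (u' - u) (- (1 / B u u')) x \<in> \<Lambda>"
      using submodD(3)[OF \<Lambda> x submod_uminus[OF \<Lambda> submodD(4)[OF \<Lambda> int[OF x] dL]]]
      by (simp add: transvection_def)
  qed
  show "transvection (u' - u) (1 / B u u') u = u'"
    using level_divide(1)[OF uu u(3) uu] by (rule transvection_moves)
  show "transvection (u' - u) (1 / B u u') \<in> G"
    using dL submodD(1)[OF \<Lambda>] by (intro transvection_in) blast
qed

text \<open>Two direct moves suffice, through a vector \<open>y\<close> whose pairings with \<open>v\<close> and \<open>v'\<close> both have exact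
  valuation \<open>M\<close>.\<close>

lemma stabilizer_transitive:
  assumes \<Lambda>: "submod \<Lambda>" and v: "v \<in> prim M \<Lambda>" "v' \<in> prim M \<Lambda>"
  shows "\<exists>g\<in>G. g ` \<Lambda> = \<Lambda> \<and> g v = v'"
proof -
  obtain z z' where z: "z \<in> level M \<Lambda>" "B v z \<notin> \<P> (Suc M)" and z': "z' \<in> level M \<Lambda>" "B v' z' \<notin> \<P> (Suc M)"
    using v unfolding prim_def by blast
  have vl: "v \<in> level M \<Lambda>" "v' \<in> level M \<Lambda>" using v prim_subset by blast+
  \<comment> \<open>two proper subspaces do not cover the residue space\<close>
  have "\<exists>y\<in>level M \<Lambda>. B v y \<notin> \<P> (Suc M) \<and> B v' y \<notin> \<P> (Suc M)"
  proof (cases "B v' z \<in> \<P> (Suc M)")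
    case True
    show ?thesis
    proof (cases "B v z' \<in> \<P> (Suc M)")
      case True
      have "B v (z + z') - B v z' \<notin> \<P> (Suc M)" "B v' (z + z') - B v' z \<notin> \<P> (Suc M)"
        using z z' by (simp_all add: B_linear)
      then have "B v (z + z') \<notin> \<P> (Suc M)" "B v' (z + z') \<notin> \<P> (Suc M)"
        using True \<open>B v' z \<in> _\<close> P_diff by blast+
      then show ?thesis using level_add[OF \<Lambda> z(1) z'(1)] by blast
    next
      case False
      then show ?thesis using z' by blast
    qed
  next
    case False
    then show ?thesis using z by blast
  qed
  then obtain y where y: "y \<in> level M \<Lambda>" "B v y \<notin> \<P> (Suc M)" "B v' y \<notin> \<P> (Suc M)" by blast
  obtain g where g: "g \<in> G" "g ` \<Lambda> = \<Lambda>" "g v = y"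
    using stabilizer_moves_direct[OF \<Lambda> vl(1) y(1,2)] by blast
  have "B y v' \<notin> \<P> (Suc M)" using y(3) B_skew[of y v'] by simp
  then obtain h where h: "h \<in> G" "h ` \<Lambda> = \<Lambda>" "h y = v'"
    using stabilizer_moves_direct[OF \<Lambda> y(1) vl(2)] by blast
  have "(h \<circ> g) ` \<Lambda> = \<Lambda>" "(h \<circ> g) v = v'" using g h by (simp_all only: image_comp[symmetric] comp_apply)
  then show ?thesis using comp_G[OF h(1) g(1)] by blast
qed

lemma level_stabilizer:
  assumes g: "g \<in> G" "g ` \<Lambda> = \<Lambda>" and v: "v \<in> level M \<Lambda>"
  shows "g v \<in> level M \<Lambda>"
proof -
  have "B (g v) x \<in> \<P> M" if x: "x \<in> \<Lambda>" for x
  proof -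
    obtain x' where "x' \<in> \<Lambda>" "x = g x'" using x g(2) by blast
    then show ?thesis using level_pairing[OF v] G_B[OF g(1)] by simp
  qed
  moreover have "g v \<in> \<Lambda>" using v level_subset g(2) by blast
  ultimately show ?thesis unfolding level_def by blast
qed

lemma prim_stabilizer:
  assumes g: "g \<in> G" "g ` \<Lambda> = \<Lambda>" and v: "v \<in> prim M \<Lambda>"
  shows "g v \<in> prim M \<Lambda>"
proof -
  obtain z where z: "z \<in> level M \<Lambda>" "B v z \<notin> \<P> (Suc M)" "v \<in> level M \<Lambda>" using v unfolding prim_def by blast
  then show ?thesis
    using level_stabilizer[OF g] G_B[OF g(1), of v z] unfolding prim_def by (auto intro!: bexI[of _ "g z"])
qed

lemma enlarge_image: "g \<in> G \<Longrightarrow> g ` enlarge \<Lambda> v = enlarge (g ` \<Lambda>) (g v)"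
  unfolding enlarge_def by (auto simp: G_add G_scale image_iff simp del: scale_scale) (metis G_add G_scale)+

lemma shrink_image: "g \<in> G \<Longrightarrow> g ` shrink M \<Lambda> w = shrink M (g ` \<Lambda>) (g w)"
  unfolding shrink_def by (auto simp: G_B)

lemma suborbit_enlarge:
  assumes "submod \<Lambda>" "v \<in> prim M \<Lambda>"
  shows "suborbit \<Lambda> (enlarge \<Lambda> v) = enlarge \<Lambda> ` prim M \<Lambda>"
proof (intro equalityI subsetI)
  fix s assume "s \<in> suborbit \<Lambda> (enlarge \<Lambda> v)"
  then obtain g where "g \<in> G" "g ` \<Lambda> = \<Lambda>" "s = g ` enlarge \<Lambda> v" by (rule suborbitE)
  then show "s \<in> enlarge \<Lambda> ` prim M \<Lambda>" using enlarge_image prim_stabilizer[OF _ _ assms(2)] by auto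
next
  fix s assume "s \<in> enlarge \<Lambda> ` prim M \<Lambda>"
  then obtain v' where v': "v' \<in> prim M \<Lambda>" "s = enlarge \<Lambda> v'" by blast
  obtain g where g: "g \<in> G" "g ` \<Lambda> = \<Lambda>" "g v = v'" using stabilizer_transitive[OF assms v'(1)] by blast
  then show "s \<in> suborbit \<Lambda> (enlarge \<Lambda> v)"
    using suborbitI[OF g(1,2), of "enlarge \<Lambda> v"] v'(2) enlarge_image[OF g(1), of \<Lambda> v] by simp
qed

lemma suborbit_shrink:
  assumes "submod \<Lambda>" "w \<in> prim M \<Lambda>"
  shows "suborbit \<Lambda> (shrink M \<Lambda> w) = shrink M \<Lambda> ` prim M \<Lambda>"
proof (intro equalityI subsetI)
  fix s assume "s \<in> suborbit \<Lambda> (shrink M \<Lambda> w)"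
  then obtain g where "g \<in> G" "g ` \<Lambda> = \<Lambda>" "s = g ` shrink M \<Lambda> w" by (rule suborbitE)
  then show "s \<in> shrink M \<Lambda> ` prim M \<Lambda>" using shrink_image prim_stabilizer[OF _ _ assms(2)] by auto
next
  fix s assume "s \<in> shrink M \<Lambda> ` prim M \<Lambda>"
  then obtain w' where w': "w' \<in> prim M \<Lambda>" "s = shrink M \<Lambda> w'" by blast
  obtain g where g: "g \<in> G" "g ` \<Lambda> = \<Lambda>" "g w = w'" using stabilizer_transitive[OF assms w'(1)] by blast
  then show "s \<in> suborbit \<Lambda> (shrink M \<Lambda> w)"
    using suborbitI[OF g(1,2), of "shrink M \<Lambda> w"] w'(2) shrink_image[OF g(1), of M \<Lambda> w] by simp
qed

lemma enlarge_subset: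
  assumes "submod \<Lambda>" "u \<in> units" "x \<in> \<Lambda>" "v' = u \<cdot> v + \<pi> \<cdot> x"
  shows "enlarge \<Lambda> v' \<subseteq> enlarge \<Lambda> v"
proof
  fix y assume "y \<in> enlarge \<Lambda> v'"
  then obtain z a where z: "z \<in> \<Lambda>" "a \<in> \<O>" "y = z + a \<cdot> inverse \<pi> \<cdot> v'" unfolding enlarge_def by blast
  have "y = (z + a \<cdot> x) + (a * u) \<cdot> inverse \<pi> \<cdot> v"
    unfolding z(3) assms(4) using pi_nonzero by (simp add: scale_right_distrib mult_ac add_ac)
  moreover have "z + a \<cdot> x \<in> \<Lambda>" "a * u \<in> \<O>"
    using z assms submodD(3,4)[OF assms(1)] mult_in units_subset by auto
  ultimately show "y \<in> enlarge \<Lambda> v" unfolding enlarge_def by blast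
qed

text \<open>The overlattice depends only on the line spanned by \<open>v\<close> in \<open>\<Lambda> / \<pi> \<Lambda>\<close>.\<close>

lemma enlarge_eq_iff:
  assumes \<Lambda>: "submod \<Lambda>" and v: "v \<in> prim M \<Lambda>" "v' \<in> prim M \<Lambda>"
  shows "enlarge \<Lambda> v = enlarge \<Lambda> v' \<longleftrightarrow> (\<exists>u\<in>units. \<exists>x\<in>\<Lambda>. v' - u \<cdot> v = \<pi> \<cdot> x)"
proof
  assume eq: "enlarge \<Lambda> v = enlarge \<Lambda> v'"
  have "inverse \<pi> \<cdot> v' \<in> enlarge \<Lambda> v'"
    unfolding enlarge_def using submodD(2)[OF \<Lambda>] one_in by (auto intro!: exI[of _ 0] exI[of _ 1])
  then have "inverse \<pi> \<cdot> v' \<in> enlarge \<Lambda> v" by (simp only: eq)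
  then obtain x a where x: "x \<in> \<Lambda>" "a \<in> \<O>" "inverse \<pi> \<cdot> v' = x + a \<cdot> inverse \<pi> \<cdot> v"
    unfolding enlarge_def by blast
  have "v' = \<pi> \<cdot> inverse \<pi> \<cdot> v'" using pi_nonzero by simp
  also have "\<dots> = \<pi> \<cdot> x + (\<pi> * (a * inverse \<pi>)) \<cdot> v" unfolding x(3) by (simp add: scale_right_distrib)
  also have "\<pi> * (a * inverse \<pi>) = a" using pi_nonzero by (simp add: field_simps)
  finally have v': "v' = \<pi> \<cdot> x + a \<cdot> v" .
  have "a \<notin> \<P> 1"
  proof
    assume "a \<in> \<P> 1"
    obtain z where z: "z \<in> level M \<Lambda>" "B v' z \<notin> \<P> (Suc M)" using v(2) unfolding prim_def by blast
    have zL: "z \<in> \<Lambda>" using z(1) level_subset by blast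
    have vl: "v \<in> level M \<Lambda>" using v(1) prim_subset by blast
    have "B v' z = \<pi> * B x z + a * B v z" unfolding v' by (simp add: B_linear)
    moreover have "\<pi> * B x z \<in> \<P> (Suc M)" using level_pairing[OF z(1) x(1)] by (simp add: P_pi)
    moreover have "a * B v z \<in> \<P> (Suc M)" using P_mult[OF \<open>a \<in> \<P> 1\<close>] level_pairing[OF vl zL] by simp
    ultimately show False using z(2) P_add by simp
  qed
  then have "a \<in> units" using x(2) unfolding units_def by blast
  moreover have "v' - a \<cdot> v = \<pi> \<cdot> x" using v' by simp
  ultimately show "\<exists>u\<in>units. \<exists>x\<in>\<Lambda>. v' - u \<cdot> v = \<pi> \<cdot> x" using x(1) by blast
next
  assume "\<exists>u\<in>units. \<exists>x\<in>\<Lambda>. v' - u \<cdot> v = \<pi> \<cdot> x"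
  then obtain u x where u: "u \<in> units" "x \<in> \<Lambda>" "v' - u \<cdot> v = \<pi> \<cdot> x" by blast
  then have v': "v' = u \<cdot> v + \<pi> \<cdot> x" by (simp add: algebra_simps)
  have "- inverse u \<cdot> x \<in> \<Lambda>"
    using submodD(4)[OF \<Lambda> uminus_in] inverse_unit[OF u(1)] units_subset u(2) by blast
  moreover have "v = inverse u \<cdot> v' + \<pi> \<cdot> (- inverse u \<cdot> x)"
    unfolding v' using unit_nonzero[OF u(1)] by (simp add: scale_right_distrib mult_ac)
  ultimately show "enlarge \<Lambda> v = enlarge \<Lambda> v'"
    using enlarge_subset[OF \<Lambda> u(1,2) v'] enlarge_subset[OF \<Lambda> inverse_unit[OF u(1)]] by blast
qed

text \<open>The sublattice is the kernel of the functional \<open>B w\<close> with values in \<open>\<P> M / \<P> (M + 1)\<close>, and a kernel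
  determines a functional up to a scalar.\<close>

lemma shrink_eq_iff:
  assumes \<Lambda>: "submod \<Lambda>" and w: "w \<in> prim M \<Lambda>" "w' \<in> prim M \<Lambda>"
  shows "shrink M \<Lambda> w = shrink M \<Lambda> w' \<longleftrightarrow> (\<exists>u\<in>units. \<forall>x\<in>\<Lambda>. B (w' - u \<cdot> w) x \<in> \<P> (Suc M))"
proof
  assume eq: "shrink M \<Lambda> w = shrink M \<Lambda> w'"
  have wl: "w \<in> level M \<Lambda>" "w' \<in> level M \<Lambda>" using w prim_subset by blast+
  obtain z where z: "z \<in> level M \<Lambda>" "B w z \<notin> \<P> (Suc M)" using w(1) unfolding prim_def by blast
  have zL: "z \<in> \<Lambda>" using z(1) level_subset by blast
  have mem: "B w x \<in> \<P> (Suc M) \<longleftrightarrow> B w' x \<in> \<P> (Suc M)" if "x \<in> \<Lambda>" for x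
    using eq that B_skew[of w x] B_skew[of w' x] unfolding shrink_def by fastforce
  have wz: "B w z \<in> \<P> M" "B w' z \<in> \<P> M" using level_pairing wl zL by blast+
  define u where "u = B w' z / B w z"
  have u: "u \<in> units"
    unfolding u_def using level_divide_unit[OF wz(1) z(2) wz(2)] mem[OF zL] z(2) by blast
  have "B (w' - u \<cdot> w) x \<in> \<P> (Suc M)" if x: "x \<in> \<Lambda>" for x
  proof -
    define a where "a = B w x / B w z"
    have a: "a \<in> \<O>" unfolding a_def using level_divide(2)[OF wz(1) z(2)] level_pairing[OF wl(1) x] by blast
    have nz: "B w z \<noteq> 0" using level_divide(1)[OF wz(1) z(2) wz(1)] .
    have "B w (x - a \<cdot> z) = 0" unfolding a_def using nz by (simp add: B_linear)
    then have "B w (x - a \<cdot> z) \<in> \<P> (Suc M)" using P_zero by simp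
    then have "B w' (x - a \<cdot> z) \<in> \<P> (Suc M)"
      using mem submod_diff[OF \<Lambda> x submodD(4)[OF \<Lambda> a zL]] by blast
    moreover have "B w' (x - a \<cdot> z) = B (w' - u \<cdot> w) x"
      unfolding a_def u_def using nz by (simp add: B_linear)
    ultimately show ?thesis by simp
  qed
  then show "\<exists>u\<in>units. \<forall>x\<in>\<Lambda>. B (w' - u \<cdot> w) x \<in> \<P> (Suc M)" using u by blast
next
  assume "\<exists>u\<in>units. \<forall>x\<in>\<Lambda>. B (w' - u \<cdot> w) x \<in> \<P> (Suc M)"
  then obtain u where u: "u \<in> units" "\<And>x. x \<in> \<Lambda> \<Longrightarrow> B (w' - u \<cdot> w) x \<in> \<P> (Suc M)" by blast
  have "B x w \<in> \<P> (Suc M) \<longleftrightarrow> B x w' \<in> \<P> (Suc M)" if x: "x \<in> \<Lambda>" for x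
  proof -
    have "B x w \<in> \<P> (Suc M) \<longleftrightarrow> u * B w x \<in> \<P> (Suc M)"
      using unit_mult_P_iff[OF u(1)] B_skew[of x w] by simp
    also have "\<dots> \<longleftrightarrow> B w' x \<in> \<P> (Suc M)"
      using u(2)[OF x] P_add[of "B w' x - u * B w x" "Suc M" "u * B w x"]
        P_diff[of "B w' x" "Suc M" "B w' x - u * B w x"] by (auto simp: B_linear)
    also have "\<dots> \<longleftrightarrow> B x w' \<in> \<P> (Suc M)" using B_skew[of x w'] by simp
    finally show ?thesis .
  qed
  then show "shrink M \<Lambda> w = shrink M \<Lambda> w'" unfolding shrink_def by blast
qed

text \<open>With these exponents \<open>lat (wt \<mu>)\<close> is the lattice with basis \<open>\<pi>\<^bsup>\<mu> i\<^esup> E i\<close>, \<open>F i\<close>, whose Gram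
  matrix has type \<open>\<mu>\<close>.\<close>

definition wt :: "(nat \<Rightarrow> nat) \<Rightarrow> nat \<times> bool \<Rightarrow> nat" where
  "wt \<mu> j = (if snd j then 0 else \<mu> (fst j))"

definition opp :: "nat \<times> bool \<Rightarrow> nat \<times> bool" where
  "opp j = (fst j, \<not> snd j)"

lemma wt_opp: "wt \<mu> j + wt \<mu> (opp j) = \<mu> (fst j)"
  unfolding wt_def opp_def by simp

lemma opp_in: "j \<in> indices \<Longrightarrow> opp j \<in> indices"
  unfolding opp_def by auto

lemma fst_opp: "fst (opp j) = fst j" unfolding opp_def by simp

lemma B_basis_opp: "B x (c \<cdot> basis (opp j)) = c * coord x j \<or> B x (c \<cdot> basis (opp j)) = - (c * coord x j)"
  unfolding coord_def basis_def opp_def using B_skew[of x "E (fst j)"] by (simp add: B_linear)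

lemma B_coord_mem:
  assumes "x \<in> V" "\<And>j. j \<in> indices \<Longrightarrow> coord x j * coord y (opp j) \<in> \<P> k"
  shows "B x y \<in> \<P> k"
  unfolding B_coord[OF assms(1)] using assms(2)[of "(_, False)"] assms(2)[of "(_, True)"]
  by (intro P_sum P_diff) (auto simp: opp_def)

lemma latD: "x \<in> lat w \<Longrightarrow> j \<in> indices \<Longrightarrow> coord x j \<in> \<P> (w j)"
  unfolding lat_def by blast

lemma scaled_basis_lat: "j \<in> indices \<Longrightarrow> \<pi> ^ wt \<mu> j \<cdot> basis j \<in> lat (wt \<mu>)"
  by (auto simp: lat_iff V_scale basis_in coord_scale coord_basis pi_power_mem P_zero)

text \<open>The pairing with the basis vector of \<open>lat (wt \<mu>)\<close> opposite to \<open>j\<close> isolates the coordinate \<open>j\<close>.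
  The subtraction is truncated: parts greater than \<open>M\<close> impose no condition beyond membership.\<close>

lemma level_lat_iff:
  "v \<in> level M (lat (wt \<mu>)) \<longleftrightarrow>
     v \<in> V \<and> (\<forall>j\<in>indices. coord v j \<in> \<P> (wt \<mu> j + (M - \<mu> (fst j))))"
proof (intro iffI conjI ballI)
  assume v: "v \<in> level M (lat (wt \<mu>))"
  then have vlat: "v \<in> lat (wt \<mu>)" using level_subset by blast
  then show "v \<in> V" unfolding lat_iff by blast
  fix j assume j: "j \<in> indices"
  have "B v (\<pi> ^ wt \<mu> (opp j) \<cdot> basis (opp j)) \<in> \<P> M"
    using level_pairing[OF v scaled_basis_lat[OF opp_in[OF j]]] by blast
  then have c: "\<pi> ^ wt \<mu> (opp j) * coord v j \<in> \<P> M" using B_basis_opp[of v _ j] P_uminus_iff by metis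
  show "coord v j \<in> \<P> (wt \<mu> j + (M - \<mu> (fst j)))"
  proof (cases "\<mu> (fst j) \<le> M")
    case True
    then have "M = wt \<mu> (opp j) + (wt \<mu> j + (M - \<mu> (fst j)))" using wt_opp[of \<mu> j] by simp
    then show ?thesis using c P_pi_power by metis
  next
    case False
    moreover have "coord v j \<in> \<P> (wt \<mu> j)" using vlat j unfolding lat_iff by blast
    ultimately show ?thesis by simp
  qed
next
  assume v: "v \<in> V \<and> (\<forall>j\<in>indices. coord v j \<in> \<P> (wt \<mu> j + (M - \<mu> (fst j))))"
  have vlat: "v \<in> lat (wt \<mu>)"
    unfolding lat_iff using v P_antimono[OF le_add1, of "wt \<mu> _"] by blast
  moreover have "B v x \<in> \<P> M" if x: "x \<in> lat (wt \<mu>)" for x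
  proof (rule B_coord_mem)
    show "v \<in> V" using v by blast
    fix j assume j: "j \<in> indices"
    have "coord v j * coord x (opp j) \<in> \<P> (wt \<mu> j + (M - \<mu> (fst j)) + wt \<mu> (opp j))"
      by (rule P_mult[OF bspec[OF conjunct2[OF v] j] latD[OF x opp_in[OF j]]])
    moreover have "M \<le> wt \<mu> j + (M - \<mu> (fst j)) + wt \<mu> (opp j)" using wt_opp[of \<mu> j] by simp
    ultimately show "coord v j * coord x (opp j) \<in> \<P> M" using P_antimono by blast
  qed
  ultimately show "v \<in> level M (lat (wt \<mu>))" unfolding level_def by blast
qed

text \<open>Integral coefficients \<open>t\<close> parametrize \<open>level M (lat (wt \<mu>))\<close>, by \<open>level_lat_iff\<close>.\<close>

definition level_exp :: "nat \<Rightarrow> (nat \<Rightarrow> nat) \<Rightarrow> nat \<times> bool \<Rightarrow> nat" where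
  "level_exp M \<mu> j = wt \<mu> j + (M - \<mu> (fst j))"

definition level_comb :: "nat \<Rightarrow> (nat \<Rightarrow> nat) \<Rightarrow> (nat \<times> bool \<Rightarrow> 'k) \<Rightarrow> 'v" where
  "level_comb M \<mu> t = (\<Sum>j\<in>indices. (\<pi> ^ level_exp M \<mu> j * t j) \<cdot> basis j)"

lemma level_comb_V: "level_comb M \<mu> t \<in> V"
  unfolding level_comb_def by (rule comb_in)

lemma coord_level_comb: "j \<in> indices \<Longrightarrow> coord (level_comb M \<mu> t) j = \<pi> ^ level_exp M \<mu> j * t j"
  unfolding level_comb_def by (rule coord_comb)

lemma level_comb_level: "(\<And>j. t j \<in> \<O>) \<Longrightarrow> level_comb M \<mu> t \<in> level M (lat (wt \<mu>))"
  unfolding level_lat_iff using coord_level_comb[of _ M \<mu> t] level_comb_V P_pi_power[of _ _ 0]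
  by (auto simp: level_exp_def P_0 simp del: power_add) 

lemma level_comb_obtain:
  assumes "v \<in> level M (lat (wt \<mu>))"
  obtains t where "\<And>j. t j \<in> \<O>" "v = level_comb M \<mu> t"
proof -
  define t where "t j = (if j \<in> indices then coord v j / \<pi> ^ level_exp M \<mu> j else 0)" for j
  have "t j \<in> \<O>" for j
    using assms zero_in unfolding level_lat_iff t_def level_exp_def P_iff by auto
  moreover have "v = level_comb M \<mu> t"
    using assms pi_nonzero unfolding level_lat_iff
    by (intro coord_eqI) (auto simp: level_comb_V coord_level_comb t_def)
  ultimately show thesis using that by blast
qed

lemma level_exp_opp: "level_exp M \<mu> j + level_exp M \<mu> (opp j) = \<mu> (fst j) + 2 * (M - \<mu> (fst j))"
  unfolding level_exp_def using wt_opp[of \<mu> j] by (simp add: fst_opp)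

text \<open>The parts of \<open>\<mu>\<close> different from \<open>M\<close> contribute to pairings of vectors of level \<open>M\<close> only
  in \<open>\<P> (M + 1)\<close>.\<close>

lemma level_comb_prim_iff:
  assumes t: "\<And>j. t j \<in> \<O>"
  shows "level_comb M \<mu> t \<in> prim M (lat (wt \<mu>)) \<longleftrightarrow> (\<exists>j\<in>{j \<in> indices. \<mu> (fst j) = M}. t j \<in> units)"
proof
  assume "level_comb M \<mu> t \<in> prim M (lat (wt \<mu>))"
  then obtain z where z: "z \<in> level M (lat (wt \<mu>))" "B (level_comb M \<mu> t) z \<notin> \<P> (Suc M)"
    unfolding prim_def by blast
  obtain s where s: "\<And>j. s j \<in> \<O>" "z = level_comb M \<mu> s" using level_comb_obtain[OF z(1)] by blast
  show "\<exists>j\<in>{j \<in> indices. \<mu> (fst j) = M}. t j \<in> units"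
  proof (rule ccontr)
    assume none: "\<not> ?thesis"
    have "B (level_comb M \<mu> t) z \<in> \<P> (Suc M)"
    proof (rule B_coord_mem[OF level_comb_V])
      fix j assume j: "j \<in> indices"
      have "coord (level_comb M \<mu> t) j * coord z (opp j) =
          \<pi> ^ (\<mu> (fst j) + 2 * (M - \<mu> (fst j))) * (t j * s (opp j))"
        unfolding s(2) coord_level_comb[OF j] coord_level_comb[OF opp_in[OF j]] level_exp_opp[symmetric]
        by (simp add: power_add mult_ac)
      moreover have "\<dots> \<in> \<P> (Suc M)"
      proof (cases "\<mu> (fst j) = M")
        case True
        then have "t j \<in> \<P> 1" using none j t unfolding units_def by auto
        then have "t j * s (opp j) \<in> \<P> 1" using P_scale[OF s(1)] by (simp add: mult.commute)
        then show ?thesis using True P_pi_power[of M _ 1] by simp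
      next
        case False
        then have "Suc M \<le> \<mu> (fst j) + 2 * (M - \<mu> (fst j))" by linarith
        moreover have "\<pi> ^ (\<mu> (fst j) + 2 * (M - \<mu> (fst j))) * (t j * s (opp j))
            \<in> \<P> (\<mu> (fst j) + 2 * (M - \<mu> (fst j)) + 0)"
          unfolding P_pi_power P_0 using mult_in t s(1) by blast
        ultimately show ?thesis using P_antimono by auto
      qed
      ultimately show "coord (level_comb M \<mu> t) j * coord z (opp j) \<in> \<P> (Suc M)" by simp
    qed
    then show False using z(2) by blast
  qed
next
  assume "\<exists>j\<in>{j \<in> indices. \<mu> (fst j) = M}. t j \<in> units"
  then obtain j where j: "j \<in> indices" "\<mu> (fst j) = M" "t j \<in> units" by blast
  let ?z = "\<pi> ^ level_exp M \<mu> (opp j) \<cdot> basis (opp j)"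
  have "\<pi> ^ level_exp M \<mu> (opp j) * coord (level_comb M \<mu> t) j = \<pi> ^ M * t j"
    using level_exp_opp[of M \<mu> j] j(2) unfolding coord_level_comb[OF j(1)]
    by (metis (no_types, lifting) add.commute diff_self_eq_0 mult.assoc mult_0_right add_0_right power_add)
  moreover have "\<pi> ^ M * t j \<notin> \<P> (Suc M)" using P_pi_power[of M "t j" 1] j(3) unfolding units_def by simp
  ultimately have "B (level_comb M \<mu> t) ?z \<notin> \<P> (Suc M)"
    using B_basis_opp[of "level_comb M \<mu> t" _ j] P_uminus_iff by metis
  moreover have "?z \<in> level M (lat (wt \<mu>))"
    unfolding level_lat_iff using opp_in[OF j(1)]
    by (auto simp: V_scale basis_in coord_scale coord_basis level_exp_def[symmetric] pi_power_mem P_zero)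
  ultimately show "level_comb M \<mu> t \<in> prim M (lat (wt \<mu>))" using level_comb_level[of t, OF t] unfolding prim_def by blast
qed

lemma level_comb_diff_scale: "level_comb M \<mu> t' - u \<cdot> level_comb M \<mu> t = level_comb M \<mu> (\<lambda>j. t' j - u * t j)"
  unfolding level_comb_def by (simp add: scale_sum_right sum_subtractf[symmetric] scale_diff_left[symmetric] algebra_simps)

text \<open>Where \<open>\<mu> < M\<close>, the factor \<open>\<pi>\<close> is already present in the definition of \<open>level_comb\<close>.\<close>

lemma level_comb_pi_iff:
  assumes "\<And>j. s j \<in> \<O>"
  shows "(\<exists>x\<in>lat (wt \<mu>). level_comb M \<mu> s = \<pi> \<cdot> x) \<longleftrightarrow> (\<forall>j\<in>{j \<in> indices. M \<le> \<mu> (fst j)}. s j \<in> \<P> 1)"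
proof -
  have "(\<exists>x\<in>lat (wt \<mu>). level_comb M \<mu> s = \<pi> \<cdot> x) \<longleftrightarrow> inverse \<pi> \<cdot> level_comb M \<mu> s \<in> lat (wt \<mu>)"
  proof
    assume "\<exists>x\<in>lat (wt \<mu>). level_comb M \<mu> s = \<pi> \<cdot> x"
    then show "inverse \<pi> \<cdot> level_comb M \<mu> s \<in> lat (wt \<mu>)" using pi_nonzero by auto
  next
    assume "inverse \<pi> \<cdot> level_comb M \<mu> s \<in> lat (wt \<mu>)"
    then show "\<exists>x\<in>lat (wt \<mu>). level_comb M \<mu> s = \<pi> \<cdot> x"
      using pi_nonzero by (intro bexI[of _ "inverse \<pi> \<cdot> level_comb M \<mu> s"]) simp_all
  qed
  also have "\<dots> \<longleftrightarrow> (\<forall>j\<in>indices. \<pi> ^ level_exp M \<mu> j * s j \<in> \<P> (Suc (wt \<mu> j)))"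
    unfolding lat_iff using level_comb_V V_scale P_pi[of "inverse \<pi> * (_ * _)"] pi_nonzero
    by (auto simp: coord_scale coord_level_comb mult.assoc[symmetric])
  also have "\<dots> \<longleftrightarrow> (\<forall>j\<in>indices. M \<le> \<mu> (fst j) \<longrightarrow> s j \<in> \<P> 1)"
  proof (intro ball_cong refl)
    fix j
    show "\<pi> ^ level_exp M \<mu> j * s j \<in> \<P> (Suc (wt \<mu> j)) \<longleftrightarrow> (M \<le> \<mu> (fst j) \<longrightarrow> s j \<in> \<P> 1)"
    proof (cases "M \<le> \<mu> (fst j)")
      case True
      then show ?thesis using P_pi_power[of "wt \<mu> j" "s j" 1] by (simp add: level_exp_def)
    next
      case False
      then have "Suc (wt \<mu> j) \<le> level_exp M \<mu> j" unfolding level_exp_def by simp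
      moreover have "\<pi> ^ level_exp M \<mu> j * s j \<in> \<P> (level_exp M \<mu> j + 0)"
        unfolding P_pi_power P_0 by (rule assms)
      ultimately show ?thesis using P_antimono False by auto
    qed
  qed
  finally show ?thesis by blast
qed

text \<open>Where \<open>\<mu> > M\<close>, the conditions defining the levels \<open>M\<close> and \<open>M + 1\<close> agree.\<close>

lemma level_comb_level_Suc_iff:
  assumes "\<And>j. s j \<in> \<O>"
  shows "(\<forall>x\<in>lat (wt \<mu>). B (level_comb M \<mu> s) x \<in> \<P> (Suc M)) \<longleftrightarrow>
    (\<forall>j\<in>{j \<in> indices. \<mu> (fst j) \<le> M}. s j \<in> \<P> 1)"
proof -
  have "level_comb M \<mu> s \<in> lat (wt \<mu>)" using level_comb_level[of s, OF assms] level_subset by blast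
  then have "(\<forall>x\<in>lat (wt \<mu>). B (level_comb M \<mu> s) x \<in> \<P> (Suc M)) \<longleftrightarrow> level_comb M \<mu> s \<in> level (Suc M) (lat (wt \<mu>))"
    unfolding level_def by blast
  also have "\<dots> \<longleftrightarrow> (\<forall>j\<in>indices. \<pi> ^ level_exp M \<mu> j * s j \<in> \<P> (wt \<mu> j + (Suc M - \<mu> (fst j))))"
    unfolding level_lat_iff using level_comb_V by (simp add: coord_level_comb)
  also have "\<dots> \<longleftrightarrow> (\<forall>j\<in>indices. \<mu> (fst j) \<le> M \<longrightarrow> s j \<in> \<P> 1)"
  proof (intro ball_cong refl)
    fix j
    show "\<pi> ^ level_exp M \<mu> j * s j \<in> \<P> (wt \<mu> j + (Suc M - \<mu> (fst j))) \<longleftrightarrow>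
        (\<mu> (fst j) \<le> M \<longrightarrow> s j \<in> \<P> 1)"
    proof (cases "\<mu> (fst j) \<le> M")
      case True
      then have "wt \<mu> j + (Suc M - \<mu> (fst j)) = level_exp M \<mu> j + 1" unfolding level_exp_def by simp
      then show ?thesis using True P_pi_power[of _ "s j" 1] by simp
    next
      case False
      then have "\<pi> ^ level_exp M \<mu> j * s j \<in> \<P> (wt \<mu> j + (Suc M - \<mu> (fst j)) + 0)"
        unfolding level_exp_def using P_pi_power[of "wt \<mu> j" "s j" 0] P_0 assms[of j] by simp
      then show ?thesis using False by simp
    qed
  qed
  finally show ?thesis by blast
qed

lemma prim_image:
  "prim M (lat (wt \<mu>)) =
     level_comb M \<mu> ` {t. (\<forall>j. t j \<in> \<O>) \<and> (\<exists>j\<in>{j \<in> indices. \<mu> (fst j) = M}. t j \<in> units)}"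
proof (intro equalityI subsetI)
  fix v assume v: "v \<in> prim M (lat (wt \<mu>))"
  obtain t where t: "\<And>j. t j \<in> \<O>" "v = level_comb M \<mu> t" using level_comb_obtain v prim_subset by blast
  then show "v \<in> level_comb M \<mu> ` {t. (\<forall>j. t j \<in> \<O>) \<and> (\<exists>j\<in>{j \<in> indices. \<mu> (fst j) = M}. t j \<in> units)}"
    using level_comb_prim_iff[of t M \<mu>] t v by auto
next
  fix v assume "v \<in> level_comb M \<mu> ` {t. (\<forall>j. t j \<in> \<O>) \<and> (\<exists>j\<in>{j \<in> indices. \<mu> (fst j) = M}. t j \<in> units)}"
  then obtain t where t: "\<And>j. t j \<in> \<O>" "v = level_comb M \<mu> t"
    "\<exists>j\<in>{j \<in> indices. \<mu> (fst j) = M}. t j \<in> units" by auto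
  show "v \<in> prim M (lat (wt \<mu>))" unfolding t(2) using t(3) level_comb_prim_iff[OF t(1)] by (rule iffD2[rotated])
qed

lemma card_indices: "card {j \<in> indices. Q (fst j)} = 2 * card {i. i < n \<and> Q i}"
proof -
  have "{j \<in> indices. Q (fst j)} = {i. i < n \<and> Q i} \<times> (UNIV :: bool set)" by auto
  then show ?thesis by (simp add: card_cartesian_product)
qed

text \<open>The suborbit is the set of lines in \<open>\<Lambda> / \<pi> \<Lambda>\<close> spanned by the vectors of \<open>prim M \<Lambda>\<close>.  In terms of
  the coefficients of \<open>level_comb\<close>, only the coordinates with \<open>\<mu> \<ge> M\<close> survive modulo \<open>\<pi> \<Lambda>\<close>, and one of
  those with \<open>\<mu> = M\<close> has to be a unit.\<close>

lemma card_suborbit_enlarge: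
  assumes "v \<in> prim M (lat (wt \<mu>))"
  shows "real (card (suborbit (lat (wt \<mu>)) (enlarge (lat (wt \<mu>)) v))) * (real q - 1) =
    real q ^ (2 * card {i. i < n \<and> M \<le> \<mu> i}) -
    real q ^ (2 * card {i. i < n \<and> M \<le> \<mu> i} - 2 * card {i. i < n \<and> \<mu> i = M})"
proof -
  let ?Q = "{t. (\<forall>j. t j \<in> \<O>) \<and> (\<exists>j\<in>{j \<in> indices. \<mu> (fst j) = M}. t j \<in> units)}"
  have "enlarge (lat (wt \<mu>)) (level_comb M \<mu> t) = enlarge (lat (wt \<mu>)) (level_comb M \<mu> t') \<longleftrightarrow>
      (\<exists>u\<in>units. \<forall>j\<in>{j \<in> indices. M \<le> \<mu> (fst j)}. t' j - u * t j \<in> \<P> 1)"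
    if "t \<in> ?Q" "t' \<in> ?Q" for t t'
  proof -
    have "level_comb M \<mu> t \<in> prim M (lat (wt \<mu>))" "level_comb M \<mu> t' \<in> prim M (lat (wt \<mu>))"
      using that prim_image by blast+
    then have "enlarge (lat (wt \<mu>)) (level_comb M \<mu> t) = enlarge (lat (wt \<mu>)) (level_comb M \<mu> t') \<longleftrightarrow>
      (\<exists>u\<in>units. \<exists>x\<in>lat (wt \<mu>). level_comb M \<mu> (\<lambda>j. t' j - u * t j) = \<pi> \<cdot> x)"
      by (simp only: enlarge_eq_iff[OF submod_lat] level_comb_diff_scale)
    also have "\<dots> \<longleftrightarrow> (\<exists>u\<in>units. \<forall>j\<in>{j \<in> indices. M \<le> \<mu> (fst j)}. t' j - u * t j \<in> \<P> 1)"
      using that units_subset by (intro bex_cong refl level_comb_pi_iff diff_in mult_in) auto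
    finally show ?thesis .
  qed
  moreover have "finite {j \<in> indices. M \<le> \<mu> (fst j)}" by simp
  moreover have "{j \<in> indices. \<mu> (fst j) = M} \<subseteq> {j \<in> indices. M \<le> \<mu> (fst j)}" by auto
  ultimately have "real (card ((\<lambda>t. enlarge (lat (wt \<mu>)) (level_comb M \<mu> t)) ` ?Q)) * (real q - 1) =
    real q ^ card {j \<in> indices. M \<le> \<mu> (fst j)} -
    real q ^ (card {j \<in> indices. M \<le> \<mu> (fst j)} - card {j \<in> indices. \<mu> (fst j) = M})"
    by (intro card_lines)
  moreover have "(\<lambda>t. enlarge (lat (wt \<mu>)) (level_comb M \<mu> t)) ` ?Q = suborbit (lat (wt \<mu>)) (enlarge (lat (wt \<mu>)) v)"
    unfolding suborbit_enlarge[OF submod_lat assms] prim_image image_image ..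
  ultimately show ?thesis by (simp only: card_indices[of "\<lambda>i. M \<le> \<mu> i"] card_indices[of "\<lambda>i. \<mu> i = M"])
qed

text \<open>The dual count: as functionals modulo \<open>\<P> (M + 1)\<close>, the vectors of level \<open>M\<close> are determined by their
  coordinates with \<open>\<mu> \<le> M\<close>.\<close>

lemma card_suborbit_shrink:
  assumes "w \<in> prim M (lat (wt \<mu>))"
  shows "real (card (suborbit (lat (wt \<mu>)) (shrink M (lat (wt \<mu>)) w))) * (real q - 1) =
    real q ^ (2 * card {i. i < n \<and> \<mu> i \<le> M}) -
    real q ^ (2 * card {i. i < n \<and> \<mu> i \<le> M} - 2 * card {i. i < n \<and> \<mu> i = M})"
proof -
  let ?Q = "{t. (\<forall>j. t j \<in> \<O>) \<and> (\<exists>j\<in>{j \<in> indices. \<mu> (fst j) = M}. t j \<in> units)}"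
  have "shrink M (lat (wt \<mu>)) (level_comb M \<mu> t) = shrink M (lat (wt \<mu>)) (level_comb M \<mu> t') \<longleftrightarrow>
      (\<exists>u\<in>units. \<forall>j\<in>{j \<in> indices. \<mu> (fst j) \<le> M}. t' j - u * t j \<in> \<P> 1)"
    if "t \<in> ?Q" "t' \<in> ?Q" for t t'
  proof -
    have "level_comb M \<mu> t \<in> prim M (lat (wt \<mu>))" "level_comb M \<mu> t' \<in> prim M (lat (wt \<mu>))"
      using that prim_image by blast+
    then have "shrink M (lat (wt \<mu>)) (level_comb M \<mu> t) = shrink M (lat (wt \<mu>)) (level_comb M \<mu> t') \<longleftrightarrow>
      (\<exists>u\<in>units. \<forall>x\<in>lat (wt \<mu>). B (level_comb M \<mu> (\<lambda>j. t' j - u * t j)) x \<in> \<P> (Suc M))"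
      by (simp only: shrink_eq_iff[OF submod_lat] level_comb_diff_scale)
    also have "\<dots> \<longleftrightarrow> (\<exists>u\<in>units. \<forall>j\<in>{j \<in> indices. \<mu> (fst j) \<le> M}. t' j - u * t j \<in> \<P> 1)"
      using that units_subset by (intro bex_cong refl level_comb_level_Suc_iff diff_in mult_in) auto
    finally show ?thesis .
  qed
  moreover have "finite {j \<in> indices. \<mu> (fst j) \<le> M}" by simp
  moreover have "{j \<in> indices. \<mu> (fst j) = M} \<subseteq> {j \<in> indices. \<mu> (fst j) \<le> M}" by auto
  ultimately have "real (card ((\<lambda>t. shrink M (lat (wt \<mu>)) (level_comb M \<mu> t)) ` ?Q)) * (real q - 1) =
    real q ^ card {j \<in> indices. \<mu> (fst j) \<le> M} -
    real q ^ (card {j \<in> indices. \<mu> (fst j) \<le> M} - card {j \<in> indices. \<mu> (fst j) = M})"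
    by (intro card_lines)
  moreover have "(\<lambda>t. shrink M (lat (wt \<mu>)) (level_comb M \<mu> t)) ` ?Q = suborbit (lat (wt \<mu>)) (shrink M (lat (wt \<mu>)) w)"
    unfolding suborbit_shrink[OF submod_lat assms] prim_image image_image ..
  ultimately show ?thesis by (simp only: card_indices[of "\<lambda>i. \<mu> i \<le> M"] card_indices[of "\<lambda>i. \<mu> i = M"])
qed

lemma q_ge_2: "q \<ge> 2"
proof -
  obtain T r where T: "T \<subseteq> \<O>" "finite T" "card T = q" "\<And>x. x \<in> \<O> \<Longrightarrow> r x \<in> T"
    "\<And>x y. x \<in> \<O> \<Longrightarrow> y \<in> \<O> \<Longrightarrow> r x = r y \<longleftrightarrow> x - y \<in> \<P> 1"
    by (rule residue_map_obtain) blast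
  have "r 1 \<noteq> r 0" using T(5)[OF one_in zero_in] one_unit unfolding units_def by simp
  then have "card {r 1, r 0} = 2" by simp
  moreover have "{r 1, r 0} \<subseteq> T" using T(4) one_in zero_in by blast
  ultimately show ?thesis using card_mono[OF T(2), of "{r 1, r 0}"] T(3) by simp
qed

lemma scaled_basis_level:
  "j \<in> indices \<Longrightarrow> \<pi> ^ level_exp M \<mu> j \<cdot> basis j \<in> level M (lat (wt \<mu>))"
  unfolding level_lat_iff
  by (auto simp: V_scale basis_in coord_scale coord_basis level_exp_def[symmetric] pi_power_mem P_zero)

text \<open>The lattice of type \<open>\<mu>'\<close> arises from that of type \<open>\<mu>\<close> by adjoining \<open>\<pi>\<^sup>m E i\<close>, and conversely the
  latter consists of the vectors of the former whose pairing with \<open>F i\<close> is in \<open>\<P> (m + 1)\<close>.  So the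
  two counts of lines give the two suborbits; the common factor \<open>q - 1\<close> cancels.\<close>

lemma index_step:
  assumes i: "i < n" and \<mu>: "\<mu>' i = m" "\<mu> = \<mu>'(i := Suc m)"
  defines "A \<equiv> card {i. i < n \<and> \<mu>' i \<le> m}" and "s \<equiv> card {i. i < n \<and> \<mu>' i = m}"
    and "C \<equiv> card {i. i < n \<and> Suc m \<le> \<mu> i}" and "r \<equiv> card {i. i < n \<and> \<mu> i = Suc m}"
  shows "index (lat (wt \<mu>')) (lat (wt \<mu>)) =
    (real q ^ (2 * A) - real q ^ (2 * A - 2 * s)) / (real q ^ (2 * C) - real q ^ (2 * C - 2 * r))"
proof -
  let ?v = "\<pi> ^ Suc m \<cdot> E i"
  let ?e = "(i, False)" and ?f = "(i, True)"
  have ind: "?e \<in> indices" "?f \<in> indices" using i by auto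
  have \<mu>i: "\<mu> i = Suc m" unfolding \<mu>(2) by simp
  have EV: "?v \<in> V" "F i \<in> V" using V_scale E_in F_in i by blast+
  have v_level: "?v \<in> level (Suc m) (lat (wt \<mu>))" "F i \<in> level (Suc m) (lat (wt \<mu>))"
    using scaled_basis_level[OF ind(1), of "Suc m" \<mu>] scaled_basis_level[OF ind(2), of "Suc m" \<mu>] \<mu>i
    unfolding level_exp_def wt_def basis_def by simp_all
  have w_level: "\<pi> ^ m \<cdot> E i \<in> level m (lat (wt \<mu>'))" "F i \<in> level m (lat (wt \<mu>'))"
    using scaled_basis_level[OF ind(1), of m \<mu>'] scaled_basis_level[OF ind(2), of m \<mu>'] \<mu>(1)
    unfolding level_exp_def wt_def basis_def by simp_all
  have v: "?v \<in> prim (Suc m) (lat (wt \<mu>))"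
    using v_level pi_power_notin[of "Suc m"] B_EF[OF i i] unfolding prim_def
    by (auto simp: B_linear intro!: bexI[of _ "F i"])
  have w: "F i \<in> prim m (lat (wt \<mu>'))"
    using w_level pi_power_notin[of m] B_EF[OF i i] B_skew[of "F i" "E i"] unfolding prim_def
    by (auto simp: B_linear intro!: bexI[of _ "\<pi> ^ m \<cdot> E i"])
  have coordF: "coord x ?e = B x (F i)" for x unfolding coord_def by simp
  have lat_step: "x \<in> lat (wt \<mu>) \<longleftrightarrow> x \<in> lat (wt \<mu>') \<and> B x (F i) \<in> \<P> (Suc m)" for x
  proof -
    have w: "wt \<mu> j = (if j = ?e then Suc m else wt \<mu>' j)" for j
      unfolding wt_def \<mu>(2) by (cases j) auto
    have w': "wt \<mu>' ?e = m" unfolding wt_def using \<mu>(1) by simp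
    show ?thesis
    proof (intro iffI conjI)
      assume x: "x \<in> lat (wt \<mu>)"
      show c: "B x (F i) \<in> \<P> (Suc m)" using latD[OF x ind(1)] unfolding w coordF by simp
      have "coord x j \<in> \<P> (wt \<mu>' j)" if "j \<in> indices" for j
        using latD[OF x that] c P_Suc_subset[of m] w' coordF[of x] unfolding w by (cases "j = ?e") auto
      then show "x \<in> lat (wt \<mu>')" using x unfolding lat_def by simp
    next
      assume x: "x \<in> lat (wt \<mu>') \<and> B x (F i) \<in> \<P> (Suc m)"
      have "coord x j \<in> \<P> (wt \<mu> j)" if "j \<in> indices" for j
        using latD[OF conjunct1[OF x] that] x coordF[of x] unfolding w by (cases "j = ?e") auto
      then show "x \<in> lat (wt \<mu>)" using x unfolding lat_def by simp
    qed
  qed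
  have shrink: "shrink m (lat (wt \<mu>')) (F i) = lat (wt \<mu>)"
    unfolding shrink_def using lat_step by blast
  have piv: "a \<cdot> inverse \<pi> \<cdot> ?v = (a * \<pi> ^ m) \<cdot> E i" for a
    using pi_nonzero by (simp add: field_simps)
  have enlarge: "enlarge (lat (wt \<mu>)) ?v = lat (wt \<mu>')"
  proof (intro equalityI subsetI)
    fix y assume "y \<in> enlarge (lat (wt \<mu>)) ?v"
    then obtain x a where x: "x \<in> lat (wt \<mu>)" "a \<in> \<O>" "y = x + a \<cdot> inverse \<pi> \<cdot> ?v"
      unfolding enlarge_def by blast
    have y: "y = x + a \<cdot> \<pi> ^ m \<cdot> E i" unfolding x(3) piv by simp
    have "\<pi> ^ m \<cdot> E i \<in> lat (wt \<mu>')" using w_level(1) level_subset by blast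
    then show "y \<in> lat (wt \<mu>')"
      unfolding y using x(1,2) lat_step submodD(3,4)[OF submod_lat] by blast
  next
    fix y assume y: "y \<in> lat (wt \<mu>')"
    define a where "a = B y (F i) / \<pi> ^ m"
    have "coord y ?e \<in> \<P> (wt \<mu>' ?e)" using y ind(1) unfolding lat_iff by blast
    then have "B y (F i) \<in> \<P> m" unfolding coordF wt_def using \<mu>(1) by simp
    then have a: "a \<in> \<O>" unfolding a_def P_iff .
    let ?x = "y - a \<cdot> \<pi> ^ m \<cdot> E i"
    have "?x \<in> lat (wt \<mu>')"
      using y a w_level(1) level_subset submod_diff[OF submod_lat] submodD(4)[OF submod_lat] by blast
    moreover have "B ?x (F i) = 0" unfolding a_def using B_EF[OF i i] pi_nonzero by (simp add: B_linear)
    ultimately have "?x \<in> lat (wt \<mu>)" using lat_step P_zero by simp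
    moreover have "y = ?x + a \<cdot> inverse \<pi> \<cdot> ?v" unfolding piv by simp
    ultimately show "y \<in> enlarge (lat (wt \<mu>)) ?v" unfolding enlarge_def using a by blast
  qed
  have up: "real (card (suborbit (lat (wt \<mu>)) (lat (wt \<mu>')))) * (real q - 1) =
      real q ^ (2 * C) - real q ^ (2 * C - 2 * r)"
    using card_suborbit_enlarge[OF v] unfolding enlarge C_def r_def .
  have down: "real (card (suborbit (lat (wt \<mu>')) (lat (wt \<mu>)))) * (real q - 1) =
      real q ^ (2 * A) - real q ^ (2 * A - 2 * s)"
    using card_suborbit_shrink[OF w] unfolding shrink A_def s_def .
  have "real q - 1 \<noteq> 0" using q_ge_2 by simp
  then show ?thesis unfolding index_def up[symmetric] down[symmetric] by simp
qed

end

section \<open>The Birkhoff number as a product of step indices\<close>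

lemma count_list_update:
  assumes "i < length xs" "xs ! i = x" "x \<noteq> y"
  shows "count_list xs x = Suc (count_list (xs[i := y]) x)"
    and "count_list (xs[i := y]) y = Suc (count_list xs y)"
    and "z \<noteq> x \<Longrightarrow> z \<noteq> y \<Longrightarrow> count_list (xs[i := y]) z = count_list xs z"
proof -
  define D where "D = mset xs - {#x#}"
  have "x \<in># mset xs" using assms by auto
  then have m: "mset xs = add_mset x D" unfolding D_def by simp
  have m': "mset (xs[i := y]) = add_mset y D"
    unfolding D_def using assms by (simp only: mset_update)
  have *: "count_list xs z = (if z = x then 1 else 0) + count D z"
    "count_list (xs[i := y]) z = (if z = y then 1 else 0) + count D z" for z
    by (simp_all only: count_mset[symmetric] m m' count_add_mset) auto
  show "count_list xs x = Suc (count_list (xs[i := y]) x)"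
    "count_list (xs[i := y]) y = Suc (count_list xs y)"
    using assms(3) by (simp_all add: *)
  show "count_list (xs[i := y]) z = count_list xs z" if "z \<noteq> x" "z \<noteq> y"
    using that by (simp add: *)
qed

lemma q_fact_Suc: "q_fact (Suc r) Y = q_fact r Y * q_int (Suc r) Y"
  unfolding q_fact_def by simp

lemma q_int_pos: "0 < Y \<Longrightarrow> Y < 1 \<Longrightarrow> q_int (Suc r) Y > 0"
  unfolding q_int_def using power_Suc_less_one[of Y r] by simp

lemma q_fact_pos: "0 < Y \<Longrightarrow> Y < 1 \<Longrightarrow> q_fact r Y > 0"
  by (induction r) (simp_all add: q_fact_Suc q_int_pos, simp add: q_fact_def)

lemma birkhoff_denominator:
  assumes "finite S" "set mu \<subseteq> S"
  shows "(\<Prod>j\<in>set mu. q_fact (count_list mu j) Y) = (\<Prod>j\<in>S. q_fact (count_list mu j) Y)"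
  using assms by (intro prod.mono_neutral_left) (auto simp: count_list_0_iff q_fact_def)

text \<open>Only the factors of the multiplicities of \<open>m + 1\<close> and \<open>m\<close> change, each by one \<open>q\<close>-integer, and the
  power of \<open>Q\<close> changes by the coefficient of the part that is lowered.  List positions start at \<open>0\<close>,
  so this coefficient is \<open>n - 1 - 2 i\<close>.\<close>

lemma birkhoff_decrement:
  assumes Q: "Q > 1" and mu: "length mu = n" "i < n" "mu ! i = Suc m"
  shows "birkhoff n mu Q = birkhoff n (mu[i := m]) Q *
    (Q powi (int n - 1 - 2 * int i) *
      ((1 - inverse Q ^ count_list (mu[i := m]) m) / (1 - inverse Q ^ count_list mu (Suc m))))"
proof -
  let ?mu' = "mu[i := m]" and ?Y = "inverse Q"
  have Y: "0 < ?Y" "?Y < 1" using Q by (simp_all add: field_simps)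
  note count = count_list_update[of i mu "Suc m" m]
  have r: "count_list mu (Suc m) = Suc (count_list ?mu' (Suc m))"
    and s: "count_list ?mu' m = Suc (count_list mu m)"
    and other: "\<And>z. z \<noteq> Suc m \<Longrightarrow> z \<noteq> m \<Longrightarrow> count_list ?mu' z = count_list mu z"
    using count mu by simp_all
  define S where "S = {m, Suc m} \<union> (set mu \<union> set ?mu' - {m, Suc m})"
  define R where "R = set mu \<union> set ?mu' - {m, Suc m}"
  have S: "finite S" "set mu \<subseteq> S" "set ?mu' \<subseteq> S" unfolding S_def by auto
  have split: "(\<Prod>j\<in>S. f j) = f m * f (Suc m) * (\<Prod>j\<in>R. f j)" for f :: "nat \<Rightarrow> real"
    unfolding S_def R_def by (subst prod.union_disjoint) auto
  have R: "(\<Prod>j\<in>R. q_fact (count_list ?mu' j) ?Y) = (\<Prod>j\<in>R. q_fact (count_list mu j) ?Y)"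
    using other unfolding R_def by (intro prod.cong) auto
  let ?D = "\<lambda>mu. \<Prod>j\<in>set mu. q_fact (count_list mu j) ?Y"
  have D: "?D mu * q_int (count_list ?mu' m) ?Y = ?D ?mu' * q_int (count_list mu (Suc m)) ?Y"
    unfolding birkhoff_denominator[OF S(1,2)] birkhoff_denominator[OF S(1,3)] split R r s q_fact_Suc
    by simp
  have pos: "?D mu > 0" "?D ?mu' > 0" using q_fact_pos[OF Y] by (auto intro: prod_pos)
  have qpos: "q_int (count_list ?mu' m) ?Y > 0" "q_int (count_list mu (Suc m)) ?Y > 0"
    using q_int_pos[OF Y] r s by simp_all
  have cross: "inverse a = inverse c * (b / d)" if "a * b = c * d" "a > 0" "c > 0" "d > 0" for a b c d :: real
    using that by (simp add: field_simps)
  have Dr: "inverse (?D mu) = inverse (?D ?mu') *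
      ((1 - ?Y ^ count_list ?mu' m) / (1 - ?Y ^ count_list mu (Suc m)))"
  proof -
    have "inverse (?D mu) = inverse (?D ?mu') * (q_int (count_list ?mu' m) ?Y / q_int (count_list mu (Suc m)) ?Y)"
      by (rule cross[OF D pos qpos(2)])
    also have "q_int (count_list ?mu' m) ?Y / q_int (count_list mu (Suc m)) ?Y =
        (1 - ?Y ^ count_list ?mu' m) / (1 - ?Y ^ count_list mu (Suc m))"
      unfolding q_int_def using Y by simp
    finally show ?thesis .
  qed
  let ?e = "\<lambda>mu. \<Sum>i=1..n. (int n + 1 - 2 * int i) * int (mu ! (i - 1))"
  have "?e mu = ?e ?mu' + (int n - 1 - 2 * int i)"
  proof -
    have "?e mu - ?e ?mu' = (\<Sum>k=1..n. (int n + 1 - 2 * int k) * (if k = Suc i then 1 else 0))"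
      unfolding sum_subtractf[symmetric]
      using mu by (intro sum.cong refl) (auto simp: nth_list_update algebra_simps)
    also have "\<dots> = (\<Sum>k=1..n. if k = Suc i then int n + 1 - 2 * int k else 0)"
      by (intro sum.cong) auto
    also have "\<dots> = int n - 1 - 2 * int i" using mu by simp
    finally show ?thesis by simp
  qed
  then have "Q powi ?e mu = Q powi ?e ?mu' * Q powi (int n - 1 - 2 * int i)"
    using Q by (simp add: power_int_add)
  then show ?thesis unfolding birkhoff_def divide_inverse[of "q_fact n ?Y"] Dr by simp
qed

lemma birkhoff_zero:
  assumes "Q > 1" "length mu = n" "\<And>i. i < n \<Longrightarrow> mu ! i = 0"
  shows "birkhoff n mu Q = 1"
proof -
  have mu: "mu = replicate n 0" using assms(2,3) by (intro nth_equalityI) auto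
  have Y: "0 < inverse Q" "inverse Q < 1" using assms(1) by (simp_all add: field_simps)
  have "(\<Prod>j\<in>set mu. q_fact (count_list mu j) (inverse Q)) = q_fact n (inverse Q)"
  proof (cases "n = 0")
    case True
    then show ?thesis unfolding mu by (simp add: q_fact_def)
  next
    case False
    then show ?thesis unfolding mu by (simp add: count_list_eq_length_filter)
  qed
  moreover have "(\<Sum>i=1..n. (int n + 1 - 2 * int i) * int (mu ! (i - 1))) = 0"
    using assms(3) by (intro sum.neutral) auto
  ultimately show ?thesis unfolding birkhoff_def using q_fact_pos[OF Y, of n] by simp
qed

lemma partition_antimono:
  assumes "mu \<in> partitions n" "i \<le> j" "j < n"
  shows "mu ! j \<le> mu ! i"
  using assms sorted_wrt_nth_less[of "(\<ge>)" mu i j] unfolding partitions_def by (cases "i = j") auto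

lemma partition_last_part:
  assumes mu: "mu \<in> partitions n" and nz: "\<exists>i<n. mu ! i \<noteq> 0"
  obtains i m where "i < n" "mu ! i = Suc m" "mu[i := m] \<in> partitions n"
    "\<And>j. i < j \<Longrightarrow> j < n \<Longrightarrow> mu ! j = 0"
proof -
  define i where "i = Max {i. i < n \<and> mu ! i \<noteq> 0}"
  have "i \<in> {i. i < n \<and> mu ! i \<noteq> 0}" unfolding i_def using nz by (intro Max_in) auto
  then have i: "i < n" "mu ! i \<noteq> 0" by auto
  have zero: "mu ! j = 0" if "i < j" "j < n" for j
  proof (rule ccontr)
    assume "mu ! j \<noteq> 0"
    then have "j \<le> i" unfolding i_def using that by (intro Max_ge) auto
    then show False using that by simp
  qed
  obtain m where m: "mu ! i = Suc m" using i(2) not0_implies_Suc by blast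
  have len: "length mu = n" using mu unfolding partitions_def by simp
  have "(mu[i := m]) ! k \<le> (mu[i := m]) ! j" if "j < k" "k < n" for j k
    using that zero[of k] partition_antimono[OF mu, of j k] m len i(1)
    by (cases "j = i"; cases "k = i") auto
  then have "mu[i := m] \<in> partitions n"
    unfolding partitions_def sorted_wrt_iff_nth_less using len by auto
  then show thesis using that i(1) m zero by blast
qed

context symplectic_space
begin

lemma lat_cong: "(\<And>i. i < n \<Longrightarrow> \<mu> i = \<mu>' i) \<Longrightarrow> lat (wt \<mu>) = lat (wt \<mu>')"
  unfolding lat_def wt_def by auto

text \<open>Induction on the size of \<open>\<mu>\<close>, lowering the last nonzero part.  If its position is \<open>i\<close>, exactly \<open>i + 1\<close>
  parts are at least as large as it, and \<open>n - i\<close> parts of the smaller partition are at most as large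
  as the lowered part.  The quotient of the leading powers is \<open>Q\<^bsup>n - i\<^esup> / Q\<^bsup>i + 1\<^esup>\<close> with \<open>Q = q\<^sup>2\<close>, and the
  multiplicities of the two values supply the remaining factors.\<close>

lemma index_birkhoff:
  assumes "mu \<in> partitions n"
  shows "index L0 (lat (wt ((!) mu))) = birkhoff n mu ((real q)\<^sup>2)"
  using assms
proof (induction "sum_list mu" arbitrary: mu rule: less_induct)
  case less
  have len: "length mu = n" using less.prems unfolding partitions_def by simp
  let ?Q = "(real q)\<^sup>2"
  have Q: "?Q > 1" using q_ge_2 by (simp add: one_less_power)
  show ?case
  proof (cases "\<exists>i<n. mu ! i \<noteq> 0")
    case False
    then have "lat (wt ((!) mu)) = lat (wt (\<lambda>_. 0))" by (intro lat_cong) simp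
    also have "wt (\<lambda>_. 0) = (\<lambda>_. 0)" unfolding wt_def by auto
    finally show ?thesis using birkhoff_zero[OF Q len] False index_self[OF lat_Y] by simp
  next
    case True
    obtain i m where i: "i < n" "mu ! i = Suc m" "mu[i := m] \<in> partitions n"
      and zero: "\<And>j. i < j \<Longrightarrow> j < n \<Longrightarrow> mu ! j = 0"
      using partition_last_part[OF less.prems True] by blast
    let ?mu' = "mu[i := m]"
    have "sum_list ?mu' < sum_list mu"
      using i len elem_le_sum_list[of i mu] by (simp add: sum_list_update)
    then have IH: "index L0 (lat (wt ((!) ?mu'))) = birkhoff n ?mu' ?Q" using less.hyps i(3) by blast
    define r s where "r = count_list mu (Suc m)" and "s = count_list ?mu' m"
    have count: "count_list xs z = card {j. j < n \<and> xs ! j = z}" if "length xs = n" for xs and z :: nat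
      using that unfolding count_list_eq_length_filter length_filter_conv_card
      by (intro arg_cong[where f = card]) auto
    have C: "{j. j < n \<and> Suc m \<le> mu ! j} = {..i}"
    proof (rule Set.set_eqI)
      fix j show "j \<in> {j. j < n \<and> Suc m \<le> mu ! j} \<longleftrightarrow> j \<in> {..i}"
        using partition_antimono[OF less.prems, of j i] zero[of j] i(1,2) by (cases "j \<le> i") auto
    qed
    have A: "{j. j < n \<and> ?mu' ! j \<le> m} = {i..<n}"
    proof (rule Set.set_eqI)
      fix j show "j \<in> {j. j < n \<and> ?mu' ! j \<le> m} \<longleftrightarrow> j \<in> {i..<n}"
        using partition_antimono[OF less.prems, of j i] zero[of j] i(1,2) len
        by (cases "j < i"; cases "j = i") auto
    qed
    have step: "index (lat (wt ((!) ?mu'))) (lat (wt ((!) mu))) =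
      (real q ^ (2 * (n - i)) - real q ^ (2 * (n - i) - 2 * s)) /
      (real q ^ (2 * Suc i) - real q ^ (2 * Suc i - 2 * r))"
    proof -
      let ?f = "((!) ?mu')(i := Suc m)"
      have f: "?f j = mu ! j" if "j < n" for j
        using i(2) len that by (auto simp: nth_list_update)
      then have upd: "lat (wt ?f) = lat (wt ((!) mu))" by (rule lat_cong)
      have C': "{j. j < n \<and> Suc m \<le> ?f j} = {..i}" 
        unfolding C[symmetric] by (intro Collect_cong conj_cong refl) (simp only: f)
      have r': "card {j. j < n \<and> ?f j = Suc m} = r"
        unfolding r_def count[OF len]
        by (intro arg_cong[where f = card] Collect_cong conj_cong refl) (simp only: f)
      have s': "card {j. j < n \<and> ?mu' ! j = m} = s" unfolding s_def using count[of ?mu' m] len by simp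
      have "?mu' ! i = m" using i len by simp
      from index_step[of i "(!) ?mu'" m, OF i(1) this refl]
      show ?thesis
        unfolding upd C' r' s' A by simp
    qed
    have "r \<le> Suc i"
    proof -
      have "r \<le> card {..i}" unfolding r_def count[OF len] C[symmetric] by (intro card_mono) auto
      then show ?thesis by simp
    qed
    have "s \<le> n - i"
    proof -
      have "s \<le> card {i..<n}" unfolding s_def A[symmetric]
        using count[of ?mu' m] len by (auto intro!: card_mono)
      then show ?thesis by simp
    qed
    have pw: "real q ^ (2 * a) - real q ^ (2 * a - 2 * b) = ?Q ^ a * (1 - inverse ?Q ^ b)" if "b \<le> a" for a b
    proof -
      have "real q ^ (2 * a - 2 * b) = ?Q ^ (a - b)" by (simp add: power_mult[symmetric] diff_mult_distrib2)
      also have "\<dots> = ?Q ^ a * inverse ?Q ^ b" 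
        using Q by (subst power_diff[OF _ that]) (simp_all only: power_inverse divide_inverse)
      finally show ?thesis by (simp add: power_mult right_diff_distrib)
    qed
    have "index (lat (wt ((!) ?mu'))) (lat (wt ((!) mu))) =
        ?Q powi (int n - 1 - 2 * int i) * ((1 - inverse ?Q ^ s) / (1 - inverse ?Q ^ r))"
    proof -
      have "?Q ^ (n - i) / ?Q ^ Suc i = ?Q powi (int n - 1 - 2 * int i)"
      proof -
        have "?Q powi (int n - 1 - 2 * int i) = ?Q powi (int (n - i)) / ?Q powi (int (Suc i))"
          using Q i(1) by (subst power_int_diff[symmetric]) (auto simp: of_nat_diff algebra_simps)
        then show ?thesis by (simp only: power_int_of_nat)
      qed
      then show ?thesis
        unfolding step pw[OF \<open>s \<le> n - i\<close>] pw[OF \<open>r \<le> Suc i\<close>] by (simp only: times_divide_times_eq[symmetric])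
    qed
    moreover have "index L0 (lat (wt ((!) mu))) =
        index L0 (lat (wt ((!) ?mu'))) * index (lat (wt ((!) ?mu'))) (lat (wt ((!) mu)))"
      by (rule index_trans[OF lat_Y lat_Y lat_Y])
    ultimately show ?thesis
      using IH birkhoff_decrement[OF Q len i(1,2)] unfolding r_def s_def by simp
  qed
qed

end

section \<open>The fraction field of a compact discrete valuation ring\<close>

lemma to_fract_power: "to_fract (x ^ k) = to_fract x ^ k"
  by (induction k) (simp_all add: to_fract_mult)

lemma PIdl_class_ring: "PIdl\<^bsub>class_ring\<^esub> a = {x :: 'a::comm_ring_1. a dvd x}"
  unfolding cgenideal_def by (auto simp: dvd_def mult.commute)

lemma Units_class_ring: "Units (class_ring :: 'a::comm_ring_1 ring) = {x. x dvd 1}"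
  unfolding Units_def by (auto simp: dvd_def mult.commute)

text \<open>An element divisible by all powers of the uniformizer \<open>p\<close> is zero because otherwise the quotients
  would generate a strictly increasing chain of ideals.\<close>

lemma compact_dvr_uniformizer:
  fixes p :: "'a::idom"
  assumes "compact_dvr (class_ring :: 'a ring) p q"
  shows "p \<noteq> 0" and "\<not> p dvd 1" and "\<not> x dvd 1 \<Longrightarrow> p dvd x"
    and "x \<noteq> 0 \<Longrightarrow> \<exists>k. \<not> p ^ k dvd x"
proof -
  interpret R: compact_dvr "class_ring :: 'a ring" p q by (rule assms)
  have cr: "cring (class_ring :: 'a ring)" by unfold_locales
  have max: "maximalideal {x. p dvd x} (class_ring :: 'a ring)"
    using R.uniformizer unfolding uniformizer_def PIdl_class_ring by blast
  show nonunit: "\<not> p dvd 1"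
  proof
    assume "p dvd 1"
    then have "carrier (class_ring :: 'a ring) = {x. p dvd x}" using dvd_trans by auto
    then show False using maximalideal.I_notcarr[OF max] by blast
  qed
  show "p \<noteq> 0"
  proof
    assume "p = 0"
    then have "maximalideal {\<zero>\<^bsub>class_ring\<^esub>} (class_ring :: 'a ring)" using max by simp
    then show False using cring.zeromaximalideal_eq_field[OF cr] R.not_field by blast
  qed
  show dvd: "p dvd x" if x: "\<not> x dvd 1" for x
  proof (cases "x = 0")
    case False
    then have x': "x \<in> carrier class_ring - {\<zero>\<^bsub>class_ring\<^esub>}" "x \<notin> Units class_ring"
      using x unfolding Units_class_ring by simp_all
    obtain b where "b \<in> carrier (class_ring :: 'a ring)"
      and b: "ring_irreducible\<^bsub>class_ring\<^esub> b" "b divides\<^bsub>class_ring\<^esub> x"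
      by (rule R.exists_irreducible_divisor[OF x'])
    obtain P where uniq: "\<And>P'. maximalideal P' (class_ring :: 'a ring) \<Longrightarrow> P' = P"
      using R.local by blast
    have "maximalideal {x. b dvd x} (class_ring :: 'a ring)"
      using R.irreducible_imp_maximalideal[of b] b(1) unfolding PIdl_class_ring by simp
    then have "{x. b dvd x} = {x. p dvd x}" using uniq[OF max] uniq by metis
    then have "p dvd b" using dvd_refl[of b] by blast
    moreover have "b dvd x" using b(2) unfolding factor_def by (auto simp: dvd_def)
    ultimately show ?thesis by (rule dvd_trans)
  qed simp
  show "\<exists>k. \<not> p ^ k dvd x" if x: "x \<noteq> 0" for x
  proof (rule ccontr)
    assume "\<nexists>k. \<not> p ^ k dvd x"
    then have "\<forall>k. \<exists>y. x = p ^ k * y" unfolding dvd_def by blast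
    then obtain y where y: "\<And>k. x = p ^ k * y k" by metis
    have p0: "p \<noteq> 0" using y[of 1] x by auto
    have y_Suc: "y k = p * y (Suc k)" for k
    proof -
      have "p ^ k * y k = p ^ k * (p * y (Suc k))" using y[of k] y[of "Suc k"] by (metis mult.assoc power_Suc2)
      then show ?thesis using p0 by (metis mult_left_cancel power_not_zero)
    qed
    have y_dvd: "y l dvd y k" if "k \<le> l" for k l
      using that
    proof (induction l rule: dec_induct)
      case (step l)
      then show ?case using y_Suc[of l] dvd_trans dvd_triv_right by metis
    qed simp
    define C where "C = range (\<lambda>k. {z. y k dvd z})"
    have "subset.chain {I. ideal I (class_ring :: 'a ring)} C"
      unfolding subset_chain_def
    proof (intro conjI ballI subsetI)
      fix I assume "I \<in> C"
      then obtain k where "I = {z. y k dvd z}" unfolding C_def by blast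
      then show "I \<in> {I. ideal I (class_ring :: 'a ring)}"
        using cring.cgenideal_ideal[OF cr, of "y k"] unfolding PIdl_class_ring by simp
    next
      fix I J assume "I \<in> C" "J \<in> C"
      then obtain k l where kl: "I = {z. y k dvd z}" "J = {z. y l dvd z}" unfolding C_def by blast
      show "I \<subseteq> J \<or> J \<subseteq> I"
      proof (cases "k \<le> l")
        case True
        then show ?thesis unfolding kl using dvd_trans[OF y_dvd[of k l]] by blast
      next
        case False
        then have "l \<le> k" by simp
        then show ?thesis unfolding kl using dvd_trans[OF y_dvd[of l k]] by blast
      qed
    qed
    then have "\<Union> C \<in> C" by (intro R.ideal_chain_is_trivial) (auto simp: C_def)
    then obtain k where "\<Union> C = {z. y k dvd z}" unfolding C_def by blast
    then have "y k dvd y (Suc k)" using dvd_refl[of "y (Suc k)"] unfolding C_def by blast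
    then obtain r where "y (Suc k) = y k * r" by (rule dvdE)
    then have "y (Suc k) = p * y (Suc k) * r" using y_Suc[of k] by simp
    then have "y (Suc k) * (p * r) = y (Suc k) * 1" by (simp add: mult_ac)
    moreover have "y (Suc k) \<noteq> 0" using y[of "Suc k"] x by auto
    ultimately have "p * r = 1" by (metis mult_left_cancel)
    then show False using nonunit by (metis dvd_triv_left)
  qed
qed

lemma compact_dvr_decompose:
  fixes p :: "'a::idom"
  assumes "compact_dvr (class_ring :: 'a ring) p q" "x \<noteq> 0"
  obtains k u v where "x = p ^ k * u" "u * v = 1"
proof -
  obtain m where m: "\<not> p ^ m dvd x" using compact_dvr_uniformizer(4)[OF assms] by blast
  define l where "l = (LEAST m. \<not> p ^ m dvd x)"
  have l: "\<not> p ^ l dvd x" unfolding l_def using m by (rule LeastI)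
  then have "l \<noteq> 0" by (metis one_dvd power_0)
  then obtain k where k: "l = Suc k" using not0_implies_Suc by blast
  then have "p ^ k dvd x" using not_less_Least[of k "\<lambda>m. \<not> p ^ m dvd x"] unfolding l_def[symmetric] by auto
  then obtain u where u: "x = p ^ k * u" unfolding dvd_def by blast
  have "\<not> p dvd u" using l unfolding k u by (metis mult_dvd_mono dvd_refl power_Suc2)
  then have "u dvd 1" using compact_dvr_uniformizer(3)[OF assms(1)] by blast
  then show thesis using that u unfolding dvd_def by metis
qed

lemma compact_dvr_residues:
  fixes p :: "'a::idom"
  assumes "compact_dvr (class_ring :: 'a ring) p q"
  shows "\<exists>T. finite T \<and> card T = q \<and> (\<forall>x. \<exists>!t. t \<in> T \<and> p dvd x - t)"
proof -
  interpret R: compact_dvr "class_ring :: 'a ring" p q by (rule assms)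
  have cr: "cring (class_ring :: 'a ring)" by unfold_locales
  define c where "c x = {y :: 'a. p dvd y - x}" for x
  have "PIdl\<^bsub>class_ring\<^esub> p +>\<^bsub>class_ring\<^esub> x = c x" for x
    using cring.adic_coset[OF cr, of p x 1] R.uniformizer
    unfolding c_def uniformizer_def PIdl_class_ring by (simp add: class_ring_simps)
  then have car: "carrier ((class_ring :: 'a ring) Quot PIdl\<^bsub>class_ring\<^esub> p) = range c"
    unfolding FactRing_def A_RCOSETS_def' by auto
  have fin: "finite (range c)" "card (range c) = q"
    using R.finite_residue R.residue_card unfolding car by simp_all
  have c_eq: "c x = c y \<longleftrightarrow> p dvd x - y" for x y
  proof
    assume "c x = c y"
    moreover have "x \<in> c x" unfolding c_def by simp
    ultimately show "p dvd x - y" unfolding c_def by blast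
  next
    assume "p dvd x - y"
    then have "p dvd z - x \<longleftrightarrow> p dvd z - y" for z
      using dvd_add[of p "z - x" "x - y"] dvd_diff[of p "z - y" "x - y"] by auto
    then show "c x = c y" unfolding c_def by blast
  qed
  define T where "T = inv_into UNIV c ` range c"
  have inv: "c (inv_into UNIV c X) = X" if "X \<in> range c" for X using that by (simp add: f_inv_into_f)
  have "card T = q" unfolding T_def using fin(2) by (simp add: card_image inj_on_inv_into)
  moreover have "finite T" unfolding T_def using fin(1) by simp
  moreover have "\<exists>!t. t \<in> T \<and> p dvd x - t" for x
  proof (rule ex1I[of _ "inv_into UNIV c (c x)"])
    show "inv_into UNIV c (c x) \<in> T \<and> p dvd x - inv_into UNIV c (c x)"
      unfolding c_eq[symmetric] T_def using inv by auto
    fix t assume "t \<in> T \<and> p dvd x - t"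
    then obtain X where "X \<in> range c" "t = inv_into UNIV c X" "c x = c t" unfolding T_def c_eq by blast
    then show "t = inv_into UNIV c (c x)" using inv by simp
  qed
  ultimately show ?thesis by blast
qed

lemma compact_dvr_valuation_ring:
  fixes p :: "'a::idom"
  assumes dvr: "compact_dvr (class_ring :: 'a ring) p q"
  shows "valuation_ring (range to_fract) (to_fract p) q"
proof
  note unif = compact_dvr_uniformizer[OF dvr]
  have unit: "to_fract u * to_fract v = 1" if "u * v = 1" for u v :: 'a
    using that by (metis to_fract_1 to_fract_mult)
  have frac: "x \<in> range to_fract \<or>
      (\<exists>a. inverse x = to_fract p * to_fract a)" for x :: "'a fract"
  proof (cases x)
    case (Fract a b)
    then have x: "x = to_fract a / to_fract b" by (simp add: Fract_conv_to_fract)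
    show ?thesis
    proof (cases "a = 0")
      case True
      then show ?thesis using x by (metis div_0 rangeI to_fract_0)
    next
      case False
      obtain i u u' where a: "a = p ^ i * u" "u * u' = 1" using compact_dvr_decompose[OF dvr False] .
      obtain j v v' where b: "b = p ^ j * v" "v * v' = 1" using compact_dvr_decompose[OF dvr Fract(2)] .
      have u: "to_fract u \<noteq> 0" "inverse (to_fract u) = to_fract u'"
        using unit[OF a(2)] by (auto simp: inverse_unique)
      have v: "to_fract v \<noteq> 0" "inverse (to_fract v) = to_fract v'"
        using unit[OF b(2)] by (auto simp: inverse_unique)
      have p: "to_fract p \<noteq> 0" using unif(1) by simp
      show ?thesis
      proof (cases "j \<le> i")
        case True
        then have "to_fract p ^ i = to_fract p ^ (i - j) * to_fract p ^ j" by (simp flip: power_add)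
        then have "x = to_fract (p ^ (i - j) * u * v')"
          unfolding x a(1) b(1) using p v by (simp add: to_fract_mult to_fract_power divide_inverse)
        then show ?thesis by blast
      next
        case False
        then obtain d where d: "j = Suc (i + d)" by (metis less_imp_Suc_add not_le)
        then have "to_fract p ^ j = to_fract p * to_fract p ^ d * to_fract p ^ i"
          by (simp add: power_add mult_ac)
        then have "inverse x = to_fract p * to_fract (p ^ d * v * u')"
          unfolding x a(1) b(1) using p u by (simp add: to_fract_mult to_fract_power divide_inverse)
        then show ?thesis by blast
      qed
    qed
  qed
  show "1 \<in> range (to_fract :: 'a \<Rightarrow> _)" by (metis rangeI to_fract_1)
  show "x - y \<in> range to_fract" if "x \<in> range to_fract" "y \<in> range to_fract" for x y :: "'a fract"
    using that by (auto simp flip: to_fract_diff)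
  show "x * y \<in> range to_fract" if "x \<in> range to_fract" "y \<in> range to_fract" for x y :: "'a fract"
    using that by (auto simp flip: to_fract_mult)
  show "to_fract p \<in> range to_fract" by blast
  show nz: "to_fract p \<noteq> 0" using unif(1) by simp
  show "inverse (to_fract p) \<notin> range to_fract"
  proof
    assume "inverse (to_fract p) \<in> range to_fract"
    then obtain y where "inverse (to_fract p) = to_fract y" by blast
    then have "to_fract (p * y) = to_fract 1" using nz by (metis right_inverse to_fract_1 to_fract_mult)
    then have "p * y = 1" by (simp only: to_fract_eq_iff)
    then show False using unif(2) by (metis dvd_triv_left)
  qed
  show "\<exists>y\<in>range to_fract. inverse x = to_fract p * y" if "x \<notin> range to_fract" for x :: "'a fract"
    using frac[of x] that by blast
  show "\<exists>N. to_fract p ^ N * x \<in> range to_fract" for x :: "'a fract"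
  proof (cases x)
    case (Fract a b)
    obtain j v v' where b: "b = p ^ j * v" "v * v' = 1" using compact_dvr_decompose[OF dvr Fract(2)] .
    have v: "inverse (to_fract v) = to_fract v'" using unit[OF b(2)] by (auto simp: inverse_unique)
    have "to_fract p ^ j * x = to_fract (a * v')"
      unfolding Fract(1) b(1) using nz v by (simp add: Fract_conv_to_fract to_fract_mult to_fract_power divide_inverse)
    then show ?thesis by blast
  qed
  obtain T where T: "finite T" "card T = q" "\<And>x. \<exists>!t. t \<in> T \<and> p dvd x - t"
    using compact_dvr_residues[OF dvr] by blast
  show "\<exists>T\<subseteq>range to_fract. finite T \<and> card T = q \<and>
      (\<forall>x\<in>range to_fract. \<exists>!t. t \<in> T \<and> (\<exists>y\<in>range to_fract. x - t = to_fract p * y))"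
  proof (intro exI[of _ "to_fract ` T"] conjI ballI)
    show "card (to_fract ` T) = q" using T(2) by (simp add: card_image inj_on_def)
    fix x :: "'a fract" assume "x \<in> range to_fract"
    then obtain a where a: "x = to_fract a" by blast
    have iff: "(\<exists>y\<in>range to_fract. x - to_fract t = to_fract p * y) \<longleftrightarrow> p dvd a - t" for t
    proof -
      have "(\<exists>y\<in>range to_fract. x - to_fract t = to_fract p * y) \<longleftrightarrow> (\<exists>y. to_fract (a - t) = to_fract (p * y))"
        unfolding a by (auto simp: to_fract_diff to_fract_mult)
      then show ?thesis unfolding dvd_def by (simp only: to_fract_eq_iff)
    qed
    obtain t where t: "t \<in> T" "p dvd a - t" "\<And>s. s \<in> T \<Longrightarrow> p dvd a - s \<Longrightarrow> s = t" using T(3)[of a] by blast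
    show "\<exists>!t. t \<in> to_fract ` T \<and> (\<exists>y\<in>range to_fract. x - t = to_fract p * y)"
    proof (rule ex1I[of _ "to_fract t"])
      show "to_fract t \<in> to_fract ` T \<and> (\<exists>y\<in>range to_fract. x - to_fract t = to_fract p * y)"
        using t(1,2) iff by blast
      fix s assume s: "s \<in> to_fract ` T \<and> (\<exists>y\<in>range to_fract. x - s = to_fract p * y)"
      then obtain s' where s': "s' \<in> T" "s = to_fract s'" by blast
      then have "p dvd a - s'" using s iff by simp
      then show "s = to_fract t" using t(3)[OF s'(1)] s'(2) by simp
    qed
  qed (use T(1) in auto)
qed

section \<open>Modules given by a surjection\<close>

text \<open>The modules in question are images of submodules of function spaces; their axioms and their
  isomorphisms are read off from the surjection.\<close>

definition submodule_of :: "('a::comm_ring_1 \<Rightarrow> 'v \<Rightarrow> 'v::ab_group_add) \<Rightarrow> 'v set \<Rightarrow> bool" where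
  "submodule_of s L \<longleftrightarrow> 0 \<in> L \<and> (\<forall>x\<in>L. \<forall>y\<in>L. x + y \<in> L) \<and> (\<forall>a. \<forall>x\<in>L. s a x \<in> L)"

definition surjection ::
  "('a::comm_ring_1 \<Rightarrow> 'v \<Rightarrow> 'v::ab_group_add) \<Rightarrow> 'v set \<Rightarrow> ('a, 'm, 'c) module_scheme \<Rightarrow> ('v \<Rightarrow> 'm) \<Rightarrow> bool"
  where
  "surjection s L M \<theta> \<longleftrightarrow> \<theta> ` L = carrier M \<and>
     (\<forall>x\<in>L. \<forall>y\<in>L. \<theta> (x + y) = \<theta> x \<oplus>\<^bsub>M\<^esub> \<theta> y) \<and> (\<forall>a. \<forall>x\<in>L. \<theta> (s a x) = a \<odot>\<^bsub>M\<^esub> \<theta> x)"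

text \<open>This says that \<open>T\<close> is isomorphic to \<open>L / \<Lambda>\<close>, without forming the quotient; linear bijections of
  the surrounding space then transport it at once.\<close>

definition has_quotient ::
  "('a::comm_ring_1 \<Rightarrow> 'v \<Rightarrow> 'v::ab_group_add) \<Rightarrow> ('a, 'm, 'c) module_scheme \<Rightarrow> 'v set \<Rightarrow> 'v set \<Rightarrow> bool"
  where
  "has_quotient s T L \<Lambda> \<longleftrightarrow> (\<exists>h. surjection s L T h \<and> (\<forall>x\<in>L. \<forall>y\<in>L. h x = h y \<longleftrightarrow> x - y \<in> \<Lambda>))"

lemma surjectionD:
  assumes "surjection s L M \<theta>"
  shows "\<theta> ` L = carrier M" "x \<in> L \<Longrightarrow> y \<in> L \<Longrightarrow> \<theta> (x + y) = \<theta> x \<oplus>\<^bsub>M\<^esub> \<theta> y"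
    "x \<in> L \<Longrightarrow> \<theta> (s a x) = a \<odot>\<^bsub>M\<^esub> \<theta> x"
  using assms unfolding surjection_def by auto

lemma submodule_ofD:
  assumes "submodule_of s L"
  shows "0 \<in> L" "x \<in> L \<Longrightarrow> y \<in> L \<Longrightarrow> x + y \<in> L" "x \<in> L \<Longrightarrow> s a x \<in> L"
  using assms unfolding submodule_of_def by auto

locale ring_action =
  fixes s :: "'a::comm_ring_1 \<Rightarrow> 'v \<Rightarrow> 'v::ab_group_add"
  assumes s_add_right: "s a (x + y) = s a x + s a y"
    and s_add_left: "s (a + b) x = s a x + s b x"
    and s_mult: "s (a * b) x = s a (s b x)"
    and s_one: "s 1 x = x"
begin

lemma s_zero_left: "s 0 x = 0" using s_add_left[of 0 0 x] by simp

lemma s_minus: "s (- 1) x = - x"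
  using s_add_left[of 1 "- 1" x] by (simp add: s_zero_left s_one eq_neg_iff_add_eq_0 add.commute)

lemma submodule_of_uminus: "submodule_of s L \<Longrightarrow> x \<in> L \<Longrightarrow> - x \<in> L"
  using submodule_ofD(3)[of s L x "- 1"] by (simp add: s_minus)

lemma submodule_of_diff: "submodule_of s L \<Longrightarrow> x \<in> L \<Longrightarrow> y \<in> L \<Longrightarrow> x - y \<in> L"
  using submodule_ofD(2)[of s L x "- y"] submodule_of_uminus by simp

lemma module_surjection:
  assumes L: "submodule_of s L" and \<theta>: "surjection s L M \<theta>" and zero: "\<zero>\<^bsub>M\<^esub> = \<theta> 0"
  shows "module (class_ring :: 'a ring) M"
proof -
  have pre: "\<exists>x\<in>L. X = \<theta> x" if "X \<in> carrier M" for X using that surjectionD(1)[OF \<theta>] by blast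
  have mem: "\<theta> x \<in> carrier M" if "x \<in> L" for x using that surjectionD(1)[OF \<theta>] by blast
  note add = surjectionD(2)[OF \<theta>, symmetric] and smult = surjectionD(3)[OF \<theta>, symmetric]
  note closed = submodule_ofD[OF L]
  have "abelian_group M"
  proof (rule abelian_groupI)
    show "\<zero>\<^bsub>M\<^esub> \<in> carrier M" using mem closed(1) zero by simp
    fix X assume X: "X \<in> carrier M"
    then obtain x where x: "x \<in> L" "X = \<theta> x" using pre by blast
    show "\<zero>\<^bsub>M\<^esub> \<oplus>\<^bsub>M\<^esub> X = X" using x closed(1) by (simp add: zero add)
    have "- x \<in> L" using submodule_of_uminus[OF L x(1)] .
    then show "\<exists>Y\<in>carrier M. Y \<oplus>\<^bsub>M\<^esub> X = \<zero>\<^bsub>M\<^esub>"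
      using x mem by (intro bexI[of _ "\<theta> (- x)"]) (simp_all add: zero add)
    fix Y assume Y: "Y \<in> carrier M"
    then obtain y where y: "y \<in> L" "Y = \<theta> y" using pre by blast
    show "X \<oplus>\<^bsub>M\<^esub> Y \<in> carrier M" using x y closed mem by (simp add: add)
    show "X \<oplus>\<^bsub>M\<^esub> Y = Y \<oplus>\<^bsub>M\<^esub> X" using x y by (simp add: add add.commute)
    fix Z assume Z: "Z \<in> carrier M"
    then obtain z where z: "z \<in> L" "Z = \<theta> z" using pre by blast
    show "X \<oplus>\<^bsub>M\<^esub> Y \<oplus>\<^bsub>M\<^esub> Z = X \<oplus>\<^bsub>M\<^esub> (Y \<oplus>\<^bsub>M\<^esub> Z)"
      using x y z closed by (simp add: add add.assoc)
  qed
  moreover have "cring (class_ring :: 'a ring)" by unfold_locales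
  moreover have "module_axioms (class_ring :: 'a ring) M"
  proof
    fix a b :: 'a and X assume X: "X \<in> carrier M"
    then obtain x where x: "x \<in> L" "X = \<theta> x" using pre by blast
    show "a \<odot>\<^bsub>M\<^esub> X \<in> carrier M" using x closed mem by (simp add: smult)
    show "(a \<oplus>\<^bsub>class_ring\<^esub> b) \<odot>\<^bsub>M\<^esub> X = a \<odot>\<^bsub>M\<^esub> X \<oplus>\<^bsub>M\<^esub> b \<odot>\<^bsub>M\<^esub> X"
      using x closed by (simp add: smult add s_add_left)
    show "(a \<otimes>\<^bsub>class_ring\<^esub> b) \<odot>\<^bsub>M\<^esub> X = a \<odot>\<^bsub>M\<^esub> (b \<odot>\<^bsub>M\<^esub> X)"
      using x closed by (simp add: smult s_mult)
    show "\<one>\<^bsub>class_ring\<^esub> \<odot>\<^bsub>M\<^esub> X = X" using x by (simp add: smult s_one)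
    fix Y assume "Y \<in> carrier M"
    then obtain y where y: "y \<in> L" "Y = \<theta> y" using pre by blast
    show "a \<odot>\<^bsub>M\<^esub> (X \<oplus>\<^bsub>M\<^esub> Y) = a \<odot>\<^bsub>M\<^esub> X \<oplus>\<^bsub>M\<^esub> a \<odot>\<^bsub>M\<^esub> Y"
      using x y closed by (simp add: smult add s_add_right)
  qed
  ultimately show ?thesis by (intro module.intro)
qed

lemma isomorphic_iff_has_quotient:
  assumes L: "submodule_of s L" and \<theta>: "surjection s L M \<theta>"
    and ker: "\<And>x y. x \<in> L \<Longrightarrow> y \<in> L \<Longrightarrow> \<theta> x = \<theta> y \<longleftrightarrow> x - y \<in> \<Lambda>"
  shows "module_isomorphic class_ring M T \<longleftrightarrow> has_quotient s T L \<Lambda>"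
proof
  assume "module_isomorphic class_ring M T"
  then obtain f where f: "f \<in> module_hom class_ring M T" "bij_betw f (carrier M) (carrier T)"
    unfolding module_isomorphic_def by blast
  have mem: "\<theta> x \<in> carrier M" if "x \<in> L" for x using that surjectionD(1)[OF \<theta>] by blast
  have "surjection s L T (f \<circ> \<theta>)"
    unfolding surjection_def
  proof (intro conjI ballI allI)
    show "(f \<circ> \<theta>) ` L = carrier T"
      using surjectionD(1)[OF \<theta>] bij_betw_imp_surj_on[OF f(2)] by (simp only: image_comp[symmetric])
    fix x assume x: "x \<in> L"
    show "(f \<circ> \<theta>) (s a x) = a \<odot>\<^bsub>T\<^esub> (f \<circ> \<theta>) x" for a
      using module_hom_smult[OF f(1) _ mem[OF x], of a] surjectionD(3)[OF \<theta> x] by simp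
    fix y assume y: "y \<in> L"
    show "(f \<circ> \<theta>) (x + y) = (f \<circ> \<theta>) x \<oplus>\<^bsub>T\<^esub> (f \<circ> \<theta>) y"
      using module_hom_add[OF f(1) mem[OF x] mem[OF y]] surjectionD(2)[OF \<theta> x y] by simp
  qed
  moreover have "(f \<circ> \<theta>) x = (f \<circ> \<theta>) y \<longleftrightarrow> x - y \<in> \<Lambda>" if "x \<in> L" "y \<in> L" for x y
    using ker[OF that] inj_on_eq_iff[OF bij_betw_imp_inj_on[OF f(2)] mem[OF that(1)] mem[OF that(2)]] by simp
  ultimately show "has_quotient s T L \<Lambda>" unfolding has_quotient_def by blast
next
  assume "has_quotient s T L \<Lambda>"
  then obtain h where h: "surjection s L T h"
    and eq: "\<And>x y. x \<in> L \<Longrightarrow> y \<in> L \<Longrightarrow> h x = h y \<longleftrightarrow> x - y \<in> \<Lambda>"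
    unfolding has_quotient_def by blast
  have mem: "\<theta> x \<in> carrier M" if "x \<in> L" for x using that surjectionD(1)[OF \<theta>] by blast
  have pre: "\<exists>x\<in>L. X = \<theta> x" if "X \<in> carrier M" for X using that surjectionD(1)[OF \<theta>] by blast
  define r where "r X = (SOME x. x \<in> L \<and> \<theta> x = X)" for X
  have r: "r X \<in> L \<and> \<theta> (r X) = X" if "X \<in> carrier M" for X
  proof -
    have "\<exists>x. x \<in> L \<and> \<theta> x = X" using pre[OF that] by metis
    then show ?thesis unfolding r_def by (rule someI_ex)
  qed
  define f where "f X = h (r X)" for X
  have f\<theta>: "f (\<theta> x) = h x" if x: "x \<in> L" for x
    unfolding f_def using r[OF mem[OF x]] eq[of "r (\<theta> x)" x] ker[of "r (\<theta> x)" x] x by simp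
  have "f \<in> module_hom class_ring M T"
    unfolding module_hom_def
  proof (intro CollectI conjI allI impI Pi_I)
    fix X assume "X \<in> carrier M"
    then obtain x where "x \<in> L" "X = \<theta> x" using pre by blast
    then show "f X \<in> carrier T" using f\<theta> surjectionD(1)[OF h] by force
  next
    fix X Y assume "X \<in> carrier M \<and> Y \<in> carrier M"
    then obtain x y where xy: "x \<in> L" "X = \<theta> x" "y \<in> L" "Y = \<theta> y" using pre by blast
    then show "f (X \<oplus>\<^bsub>M\<^esub> Y) = f X \<oplus>\<^bsub>T\<^esub> f Y"
      using f\<theta> surjectionD(2)[OF \<theta>, of x y] surjectionD(2)[OF h, of x y] submodule_ofD(2)[OF L, of x y] by metis
  next
    fix a :: 'a and X assume "a \<in> carrier (class_ring :: 'a ring) \<and> X \<in> carrier M"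
    then obtain x where x: "x \<in> L" "X = \<theta> x" using pre by blast
    then show "f (a \<odot>\<^bsub>M\<^esub> X) = a \<odot>\<^bsub>T\<^esub> f X"
      using f\<theta> surjectionD(3)[OF \<theta> x(1), of a] surjectionD(3)[OF h x(1), of a] submodule_ofD(3)[OF L x(1), of a] by metis
  qed
  moreover have "bij_betw f (carrier M) (carrier T)"
    unfolding bij_betw_def
  proof
    show "inj_on f (carrier M)"
    proof (rule inj_onI)
      fix X Y assume XY: "X \<in> carrier M" "Y \<in> carrier M" "f X = f Y"
      obtain x y where "x \<in> L" "X = \<theta> x" "y \<in> L" "Y = \<theta> y"
        using pre[OF XY(1)] pre[OF XY(2)] by blast
      then show "X = Y" using XY(3) f\<theta> eq ker by metis
    qed
    have "f ` carrier M = f ` \<theta> ` L" using surjectionD(1)[OF \<theta>] by simp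
    also have "\<dots> = h ` L" using f\<theta> by (simp add: image_image)
    finally show "f ` carrier M = carrier T" using surjectionD(1)[OF h] by simp
  qed
  ultimately show "module_isomorphic class_ring M T" unfolding module_isomorphic_def by blast
qed

end

section \<open>Quotient modules\<close>

lemma submodule_abelian_subgroup:
  assumes "submodule R N M"
  shows "abelian_subgroup N M"
proof -
  interpret N: submodule R N M by (rule assms)
  interpret module R M by (rule N.module)
  have "subgroup N (add_monoid M)"
  proof
    show "N \<subseteq> carrier (add_monoid M)" using N.subset by simp
    show "x \<otimes>\<^bsub>add_monoid M\<^esub> y \<in> N" if "x \<in> N" "y \<in> N" for x y using that by simp
    show "\<one>\<^bsub>add_monoid M\<^esub> \<in> N" by simp
    show "inv\<^bsub>add_monoid M\<^esub> x \<in> N" if x: "x \<in> N" for x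
    proof -
      have "(\<ominus>\<^bsub>R\<^esub> \<one>\<^bsub>R\<^esub>) \<odot>\<^bsub>M\<^esub> x \<in> N" using x by simp
      moreover have "(\<ominus>\<^bsub>R\<^esub> \<one>\<^bsub>R\<^esub>) \<odot>\<^bsub>M\<^esub> x = \<ominus>\<^bsub>M\<^esub> x"
        using x N.subset smult_l_minus[of "\<one>\<^bsub>R\<^esub>" x] by auto
      ultimately show ?thesis unfolding a_inv_def by simp
    qed
  qed
  then have "additive_subgroup N M" by (rule additive_subgroup.intro)
  moreover have "abelian_group M" by unfold_locales
  ultimately show ?thesis by (rule abelian_subgroupI3)
qed

lemma quot_module_coset:
  assumes "submodule R N M"
  shows "carrier (quot_module M N) = (\<lambda>x. N +>\<^bsub>M\<^esub> x) ` carrier M"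
    and "x \<in> carrier M \<Longrightarrow> y \<in> carrier M \<Longrightarrow>
      (N +>\<^bsub>M\<^esub> x) \<oplus>\<^bsub>quot_module M N\<^esub> (N +>\<^bsub>M\<^esub> y) = N +>\<^bsub>M\<^esub> (x \<oplus>\<^bsub>M\<^esub> y)"
    and "a \<in> carrier R \<Longrightarrow> x \<in> carrier M \<Longrightarrow>
      a \<odot>\<^bsub>quot_module M N\<^esub> (N +>\<^bsub>M\<^esub> x) = N +>\<^bsub>M\<^esub> (a \<odot>\<^bsub>M\<^esub> x)"
    and "x \<in> carrier M \<Longrightarrow> y \<in> carrier M \<Longrightarrow> N +>\<^bsub>M\<^esub> x = N +>\<^bsub>M\<^esub> y \<longleftrightarrow> x \<ominus>\<^bsub>M\<^esub> y \<in> N"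
    and "\<zero>\<^bsub>quot_module M N\<^esub> = N +>\<^bsub>M\<^esub> \<zero>\<^bsub>M\<^esub>"
proof -
  interpret N: submodule R N M by (rule assms)
  interpret module R M by (rule N.module)
  interpret A: abelian_subgroup N M by (rule submodule_abelian_subgroup[OF assms])
  show "carrier (quot_module M N) = (\<lambda>x. N +>\<^bsub>M\<^esub> x) ` carrier M"
    unfolding quot_module_def A_RCOSETS_def' by auto
  show "(N +>\<^bsub>M\<^esub> x) \<oplus>\<^bsub>quot_module M N\<^esub> (N +>\<^bsub>M\<^esub> y) = N +>\<^bsub>M\<^esub> (x \<oplus>\<^bsub>M\<^esub> y)"
    if "x \<in> carrier M" "y \<in> carrier M"
    unfolding quot_module_def using A.a_rcos_sum[OF that] by simp
  show eq: "N +>\<^bsub>M\<^esub> x = N +>\<^bsub>M\<^esub> y \<longleftrightarrow> x \<ominus>\<^bsub>M\<^esub> y \<in> N" if "x \<in> carrier M" "y \<in> carrier M" for x y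
    using A.a_rcos_module[OF that(2,1)] a_repr_independence[OF _ that(2) A.a_subgroup, of x] A.a_rcos_self[OF that(1)]
    unfolding a_minus_def by metis
  show "\<zero>\<^bsub>quot_module M N\<^esub> = N +>\<^bsub>M\<^esub> \<zero>\<^bsub>M\<^esub>"
    unfolding quot_module_def using N.subset by (simp add: a_coset_add_zero)
  show "a \<odot>\<^bsub>quot_module M N\<^esub> (N +>\<^bsub>M\<^esub> x) = N +>\<^bsub>M\<^esub> (a \<odot>\<^bsub>M\<^esub> x)"
    if a: "a \<in> carrier R" and x: "x \<in> carrier M"
  proof -
    have "N +>\<^bsub>M\<^esub> (a \<odot>\<^bsub>M\<^esub> z) = N +>\<^bsub>M\<^esub> (a \<odot>\<^bsub>M\<^esub> x)" if z: "z \<in> N +>\<^bsub>M\<^esub> x" for z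
    proof -
      have zc: "z \<in> carrier M" using z a_r_coset_subset_G[OF N.subset x] by blast
      have "z \<ominus>\<^bsub>M\<^esub> x \<in> N" using A.a_rcos_module[OF x zc] z unfolding a_minus_def by blast
      then have "a \<odot>\<^bsub>M\<^esub> (z \<ominus>\<^bsub>M\<^esub> x) \<in> N" using a by blast
      moreover have "a \<odot>\<^bsub>M\<^esub> (z \<ominus>\<^bsub>M\<^esub> x) = a \<odot>\<^bsub>M\<^esub> z \<ominus>\<^bsub>M\<^esub> a \<odot>\<^bsub>M\<^esub> x"
        using a x zc by (simp add: a_minus_def smult_r_distr smult_r_minus)
      ultimately show ?thesis using eq a x zc by simp
    qed
    moreover have "x \<in> N +>\<^bsub>M\<^esub> x" using A.a_rcos_self[OF x] .
    ultimately have "(\<Union>z\<in>N +>\<^bsub>M\<^esub> x. N +>\<^bsub>M\<^esub> (a \<odot>\<^bsub>M\<^esub> z)) = N +>\<^bsub>M\<^esub> (a \<odot>\<^bsub>M\<^esub> x)"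
      by (intro SUP_eq_const) blast
    then show ?thesis unfolding quot_module_def by simp
  qed
qed

section \<open>The standard symplectic space\<close>

definition fscale :: "'k::field \<Rightarrow> (nat \<Rightarrow> 'k) \<Rightarrow> nat \<Rightarrow> 'k" where
  "fscale c x = (\<lambda>i. c * x i)"

definition std_form :: "nat \<Rightarrow> (nat \<Rightarrow> 'k::field) \<Rightarrow> (nat \<Rightarrow> 'k) \<Rightarrow> 'k" where
  "std_form n x y = (\<Sum>i<n. x i * y (n + i) - x (n + i) * y i)"

text \<open>As vectors, functions on the natural numbers let \<open>n\<close> vary, which a type of fixed dimension does
  not.\<close>

definition std_space :: "nat \<Rightarrow> (nat \<Rightarrow> 'k::field) set" where
  "std_space n = {x. \<forall>i\<ge>2 * n. x i = 0}"

definition unit_fun :: "nat \<Rightarrow> nat \<Rightarrow> 'k::field" where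
  "unit_fun j = (\<lambda>i. if i = j then 1 else 0)"

lemma std_form_unit_fun:
  assumes "j < n"
  shows "std_form n x (unit_fun (n + j)) = x j" "std_form n (unit_fun j) x = x (n + j)"
    "std_form n x (unit_fun j) = - x (n + j)"
proof -
  have "std_form n x (unit_fun (n + j)) = (\<Sum>i<n. if i = j then x i else 0)"
    unfolding std_form_def unit_fun_def using assms by (intro sum.cong) auto
  then show "std_form n x (unit_fun (n + j)) = x j" using assms by simp
  have "std_form n (unit_fun j) x = (\<Sum>i<n. if i = j then x (n + i) else 0)"
    unfolding std_form_def unit_fun_def using assms by (intro sum.cong) auto
  then show "std_form n (unit_fun j) x = x (n + j)" using assms by simp
  have "std_form n x (unit_fun j) = (\<Sum>i<n. if i = j then - x (n + i) else 0)"
    unfolding std_form_def unit_fun_def using assms by (intro sum.cong) auto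
  then show "std_form n x (unit_fun j) = - x (n + j)" using assms by simp
qed

lemma symplectic_space_standard:
  assumes "valuation_ring \<O> \<pi> q"
  shows "symplectic_space \<O> \<pi> q fscale (std_form n) (std_space n) n unit_fun (\<lambda>i. unit_fun (n + i))"
proof (intro symplectic_space.intro assms symplectic_space_axioms.intro)
  fix a b :: 'a and x y z :: "nat \<Rightarrow> 'a" and i j :: nat
  show "fscale a (x + y) = fscale a x + fscale a y" "fscale (a + b) x = fscale a x + fscale b x"
    "fscale a (fscale b x) = fscale (a * b) x" "fscale 1 x = x"
    unfolding fscale_def by (auto simp: fun_eq_iff algebra_simps)
  show "std_form n (x + y) z = std_form n x z + std_form n y z"
    unfolding std_form_def by (simp add: sum.distrib[symmetric] algebra_simps)
  show "std_form n (fscale a x) z = a * std_form n x z"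
    unfolding std_form_def fscale_def by (simp add: sum_distrib_left algebra_simps)
  show "std_form n x y = - std_form n y x"
    unfolding std_form_def by (simp add: sum_negf[symmetric] algebra_simps)
  show "std_form n x x = 0" unfolding std_form_def by (simp add: mult.commute)
  show "0 \<in> std_space n" unfolding std_space_def by simp
  show "x + y \<in> std_space n" if "x \<in> std_space n" "y \<in> std_space n"
    using that unfolding std_space_def by simp
  show "fscale a x \<in> std_space n" if "x \<in> std_space n"
    using that unfolding std_space_def fscale_def by simp
  show "unit_fun i \<in> std_space n" "unit_fun (n + i) \<in> std_space n" if "i < n"
    using that unfolding std_space_def unit_fun_def by auto
  show "std_form n (unit_fun i) (unit_fun (n + j)) = (if i = j then 1 else 0)"
    "std_form n (unit_fun i) (unit_fun j :: nat \<Rightarrow> 'a) = 0"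
    "std_form n (unit_fun (n + i)) (unit_fun (n + j) :: nat \<Rightarrow> 'a) = 0" if "i < n" "j < n"
    using that by (simp_all add: std_form_unit_fun) (auto simp: unit_fun_def)
  show "x = (\<Sum>i<n. fscale (std_form n x (unit_fun (n + i))) (unit_fun i) +
      fscale (std_form n (unit_fun i) x) (unit_fun (n + i)))" if x: "x \<in> std_space n"
  proof
    fix k
    have ap: "(\<Sum>i<n. f i) k = (\<Sum>i<n. f i k)" for f :: "nat \<Rightarrow> nat \<Rightarrow> 'a"
      by (induction n) simp_all
    have "(\<Sum>i<n. fscale (std_form n x (unit_fun (n + i))) (unit_fun i) +
        fscale (std_form n (unit_fun i) x) (unit_fun (n + i))) k =
        (\<Sum>i<n. x i * unit_fun i k) + (\<Sum>i<n. x (n + i) * unit_fun (n + i) k)"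
      unfolding ap sum.distrib[symmetric]
      by (intro sum.cong) (simp_all add: std_form_unit_fun fscale_def)
    also have "(\<Sum>i<n. x i * unit_fun i k) = (if k < n then x k else 0)"
      unfolding unit_fun_def by (simp add: if_distrib[of "(*) _"] cong: if_cong)
    also have "(\<Sum>i<n. x (n + i) * unit_fun (n + i) k) = (if n \<le> k \<and> k < 2 * n then x k else 0)"
    proof -
      have "(\<Sum>i<n. x (n + i) * unit_fun (n + i) k) = (\<Sum>i<n. if i = k - n then (if n \<le> k then x k else 0) else 0)"
        unfolding unit_fun_def by (intro sum.cong) auto
      also have "\<dots> = (if n \<le> k \<and> k < 2 * n then x k else 0)" by auto
      finally show ?thesis .
    qed
    finally have S: "(\<Sum>i<n. fscale (std_form n x (unit_fun (n + i))) (unit_fun i) +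
        fscale (std_form n (unit_fun i) x) (unit_fun (n + i))) k =
        (if k < n then x k else 0) + (if n \<le> k \<and> k < 2 * n then x k else 0)" .
    show "x k = (\<Sum>i<n. fscale (std_form n x (unit_fun (n + i))) (unit_fun i) +
        fscale (std_form n (unit_fun i) x) (unit_fun (n + i))) k"
      unfolding S using x unfolding std_space_def by auto
  qed
qed

section \<open>Lattices with a basis of given Gram matrix\<close>

context symplectic_space
begin

lemma lat_span: "lat w = {\<Sum>j\<in>indices. c j \<cdot> \<pi> ^ w j \<cdot> basis j |c. \<forall>j. c j \<in> \<O>}"
proof (intro equalityI subsetI)
  fix x assume x: "x \<in> lat w"
  define c where "c j = (if j \<in> indices then coord x j / \<pi> ^ w j else 0)" for j
  have "c j \<in> \<O>" for j using latD[OF x, of j] zero_in unfolding c_def P_iff by simp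
  moreover have "x = (\<Sum>j\<in>indices. c j \<cdot> \<pi> ^ w j \<cdot> basis j)"
  proof -
    have "x = (\<Sum>j\<in>indices. coord x j \<cdot> basis j)" using x unfolding lat_iff by (intro expand_basis) blast
    also have "\<dots> = (\<Sum>j\<in>indices. c j \<cdot> \<pi> ^ w j \<cdot> basis j)"
      unfolding c_def using pi_nonzero by (intro sum.cong) simp_all
    finally show ?thesis .
  qed
  ultimately show "x \<in> {\<Sum>j\<in>indices. c j \<cdot> \<pi> ^ w j \<cdot> basis j |c. \<forall>j. c j \<in> \<O>}" by blast
next
  fix x assume "x \<in> {\<Sum>j\<in>indices. c j \<cdot> \<pi> ^ w j \<cdot> basis j |c. \<forall>j. c j \<in> \<O>}"
  then obtain c where c: "\<And>j. c j \<in> \<O>" "x = (\<Sum>j\<in>indices. c j \<cdot> \<pi> ^ w j \<cdot> basis j)" by blast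
  then have x: "x = (\<Sum>j\<in>indices. (c j * \<pi> ^ w j) \<cdot> basis j)" by simp
  have "coord x j \<in> \<P> (w j)" if "j \<in> indices" for j
    unfolding x coord_comb[OF that] using c(1) pi_power_mem P_scale by blast
  then show "x \<in> lat w" unfolding lat_def using x comb_in by simp
qed

lemma image_lat:
  assumes "g \<in> G"
  shows "g ` lat w = {\<Sum>j\<in>indices. c j \<cdot> g (\<pi> ^ w j \<cdot> basis j) |c. \<forall>j. c j \<in> \<O>}"
proof -
  have eq: "g (\<Sum>j\<in>indices. c j \<cdot> \<pi> ^ w j \<cdot> basis j) = (\<Sum>j\<in>indices. c j \<cdot> g (\<pi> ^ w j \<cdot> basis j))" for c
    unfolding G_sum[OF assms] by (intro sum.cong refl) (rule G_scale[OF assms])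
  show ?thesis by (simp only: lat_span setcompr_eq_image image_image eq)
qed

text \<open>The Gram matrix of type \<open>\<mu>\<close>, with rows and columns labelled by basis vectors.\<close>

definition gram :: "(nat \<Rightarrow> nat) \<Rightarrow> nat \<times> bool \<Rightarrow> nat \<times> bool \<Rightarrow> 'k" where
  "gram \<mu> j k = (if k = opp j then (if snd j then - (\<pi> ^ \<mu> (fst j)) else \<pi> ^ \<mu> (fst j)) else 0)"

lemma B_basis:
  assumes "j \<in> indices" "k \<in> indices"
  shows "B (basis j) (basis k) = (if k = opp j then (if snd j then - 1 else 1) else 0)"
  using assms B_EF B_EE B_FF B_skew[of "F (fst j)" "E (fst k)"]
  unfolding basis_def opp_def by (cases j; cases k) auto

lemma B_scaled_basis:
  assumes "j \<in> indices" "k \<in> indices"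
  shows "B (\<pi> ^ wt \<mu> j \<cdot> basis j) (\<pi> ^ wt \<mu> k \<cdot> basis k) = gram \<mu> j k"
proof (cases "k = opp j")
  case True
  have "\<pi> ^ wt \<mu> j * \<pi> ^ wt \<mu> (opp j) = \<pi> ^ \<mu> (fst j)" by (simp only: power_add[symmetric] wt_opp)
  moreover from this have "\<pi> ^ wt \<mu> (opp j) * \<pi> ^ wt \<mu> j = \<pi> ^ \<mu> (fst j)" by (simp only: mult.commute)
  ultimately show ?thesis using True B_basis[OF assms] unfolding gram_def by (simp add: B_linear)
next
  case False
  then show ?thesis using B_basis[OF assms] unfolding gram_def by (simp add: B_linear)
qed

text \<open>Dividing the first half of the family by the powers \<open>\<pi>\<^bsup>\<mu> i\<^esup>\<close> gives a symplectic basis, and \<open>G\<close> is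
  transitive on these.\<close>

lemma gram_basis_moved:
  assumes bV: "\<And>j. j \<in> indices \<Longrightarrow> b j \<in> V"
    and gram: "\<And>j k. j \<in> indices \<Longrightarrow> k \<in> indices \<Longrightarrow> B (b j) (b k) = gram \<mu> j k"
  shows "\<exists>g\<in>G. \<forall>j\<in>indices. g (\<pi> ^ wt \<mu> j \<cdot> basis j) = b j"
proof -
  define e where "e i = inverse (\<pi> ^ \<mu> i) \<cdot> b (i, False)" for i
  define f where "f i = b (i, True)" for i
  have "frame n e f"
    unfolding frame_def
  proof (intro conjI allI impI)
    show "e i \<in> V" "f i \<in> V" if "i < n" for i
      unfolding e_def f_def using that by (auto intro: V_scale bV)
    fix i k assume ik: "i < n" "k < n"
    then have ind: "(i, b) \<in> indices" "(k, b) \<in> indices" for b by auto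
    show "B (e i) (f k) = (if i = k then 1 else 0)" "B (e i) (e k) = 0" "B (f i) (f k) = 0"
      unfolding e_def f_def using gram[OF ind(1) ind(2)] pi_nonzero
      by (simp_all add: B_linear gram_def opp_def)
  qed
  then obtain g where g: "g \<in> G" "\<And>i. i < n \<Longrightarrow> g (E i) = e i" "\<And>i. i < n \<Longrightarrow> g (F i) = f i"
    using G_transitive_frames[OF frame_standard] by blast
  have "g (\<pi> ^ wt \<mu> j \<cdot> basis j) = b j" if j: "j \<in> indices" for j
  proof (cases j)
    case (Pair i t)
    then have "i < n" using j by simp
    then show ?thesis
      using Pair g pi_nonzero unfolding G_scale[OF g(1)] wt_def basis_def e_def f_def by (cases t) simp_all
  qed
  then show ?thesis using g(1) by blast
qed

end

section \<open>Sublattices of the standard lattice\<close>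

text \<open>The numerator of an integral element; elsewhere the value is arbitrary.\<close>

definition numer :: "'a::idom fract \<Rightarrow> 'a" where
  "numer = inv_into UNIV to_fract"

lemma numer_to_fract [simp]: "numer (to_fract a) = a"
  unfolding numer_def by (intro inv_into_f_f) (auto simp: inj_on_def)

lemma to_fract_numer: "x \<in> range to_fract \<Longrightarrow> to_fract (numer x) = x"
  unfolding numer_def by (rule f_inv_into_f)

definition emb :: "nat \<Rightarrow> 'a::idom vec \<Rightarrow> nat \<Rightarrow> 'a fract" where
  "emb n v = (\<lambda>i. if i < 2 * n then to_fract (v $ i) else 0)"

definition vec_of :: "nat \<Rightarrow> (nat \<Rightarrow> 'a::idom fract) \<Rightarrow> 'a vec" where
  "vec_of n x = vec (2 * n) (\<lambda>i. numer (x i))"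

lemma vec_of_emb: "v \<in> carrier_vec (2 * n) \<Longrightarrow> vec_of n (emb n v) = v"
  unfolding vec_of_def emb_def by (intro eq_vecI) auto

lemma symp_mat_index:
  assumes "k < 2 * n" "l < 2 * n" "D \<in> carrier_mat n n"
  shows "symp_mat n D $$ (k, l) =
    (if k < n then if l < n then 0 else D $$ (k, l - n) else if l < n then - D $$ (k - n, l) else 0)"
  using assms unfolding symp_mat_def by (auto simp: four_block_mat_def Let_def)

lemma symp_form_std_form:
  fixes v w :: "'a::idom vec"
  assumes v: "v \<in> carrier_vec (2 * n)" and w: "w \<in> carrier_vec (2 * n)"
  shows "to_fract (symp_form n v w) = std_form n (emb n v) (emb n w)"
proof -
  let ?A = "symp_mat n (1\<^sub>m n) :: 'a mat"
  have A: "?A \<in> carrier_mat (2 * n) (2 * n)" unfolding symp_mat_def by (auto simp: mult_2)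
  have row: "(?A *\<^sub>v w) $ k = (if k < n then w $ (n + k) else - w $ (k - n))" if k: "k < 2 * n" for k
  proof -
    have "(?A *\<^sub>v w) $ k = (\<Sum>l\<in>{0..<2 * n}. ?A $$ (k, l) * w $ l)"
      using A k w by (auto simp: scalar_prod_def intro!: sum.cong)
    also have "\<dots> = (\<Sum>l\<in>{0..<2 * n}. if l = (if k < n then n + k else k - n)
        then (if k < n then w $ (n + k) else - w $ (k - n)) else 0)"
      using k by (intro sum.cong) (auto simp: symp_mat_index)
    also have "\<dots> = (if k < n then w $ (n + k) else - w $ (k - n))"
      using k by (cases "k < n") auto
    finally show ?thesis .
  qed
  have "symp_form n v w = (\<Sum>k\<in>{0..<2 * n}. v $ k * (if k < n then w $ (n + k) else - w $ (k - n)))"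
    unfolding symp_form_def scalar_prod_def using A v row by (auto intro!: sum.cong)
  also have "\<dots> = (\<Sum>k\<in>{0..<n}. v $ k * w $ (n + k)) + (\<Sum>k\<in>{n..<2 * n}. - (v $ k * w $ (k - n)))"
  proof -
    have "{0..<2 * n} = {0..<n} \<union> {n..<2 * n}" by auto
    then show ?thesis by (simp add: sum.union_disjoint)
  qed
  also have "(\<Sum>k\<in>{n..<2 * n}. - (v $ k * w $ (k - n))) = (\<Sum>k\<in>{0..<n}. - (v $ (n + k) * w $ k))"
    using sum.shift_bounds_nat_ivl[of "\<lambda>k. - (v $ k * w $ (k - n))" 0 n n] by (simp add: mult_2 add.commute)
  also have "(\<Sum>k\<in>{0..<n}. v $ k * w $ (n + k)) + (\<Sum>k\<in>{0..<n}. - (v $ (n + k) * w $ k)) =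
      (\<Sum>k<n. v $ k * w $ (n + k) - v $ (n + k) * w $ k)"
    by (simp add: sum.distrib[symmetric] lessThan_atLeast0)
  finally have eq: "symp_form n v w = (\<Sum>k<n. v $ k * w $ (n + k) - v $ (n + k) * w $ k)" .
  have hom: "to_fract (sum f A) = (\<Sum>i\<in>A. to_fract (f i))" for f :: "nat \<Rightarrow> 'a" and A
    by (induction A rule: infinite_finite_induct) (simp_all add: to_fract_add)
  show ?thesis
    unfolding eq hom std_form_def emb_def by (intro sum.cong) (simp_all add: to_fract_diff to_fract_mult)
qed

lemma (in ring_action) surjection_diff:
  assumes L: "submodule_of s L" and \<theta>: "surjection s L M \<theta>" and zero: "\<zero>\<^bsub>M\<^esub> = \<theta> 0"
    and xy: "x \<in> L" "y \<in> L"
  shows "\<theta> (x - y) = \<theta> x \<ominus>\<^bsub>M\<^esub> \<theta> y"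
proof -
  interpret module "class_ring :: 'a ring" M by (rule module_surjection[OF L \<theta> zero])
  have mem: "\<theta> z \<in> carrier M" if "z \<in> L" for z using that surjectionD(1)[OF \<theta>] by blast
  have d: "x - y \<in> L" by (rule submodule_of_diff[OF L xy])
  have "\<theta> x \<ominus>\<^bsub>M\<^esub> \<theta> y = (\<theta> (x - y) \<oplus>\<^bsub>M\<^esub> \<theta> y) \<ominus>\<^bsub>M\<^esub> \<theta> y"
    using surjectionD(2)[OF \<theta> d xy(2)] by simp
  also have "\<dots> = \<theta> (x - y)"
    using mem[OF d] mem[OF xy(2)] by (simp add: a_minus_def a_assoc r_neg)
  finally show ?thesis by simp
qed

lemma (in ring_action) surjection_quot:
  assumes L: "submodule_of s L" and \<theta>: "surjection s L M \<theta>" and zero: "\<zero>\<^bsub>M\<^esub> = \<theta> 0"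
    and N: "submodule class_ring N M"
  shows "surjection s L (quot_module M N) (\<lambda>x. N +>\<^bsub>M\<^esub> \<theta> x)"
    and "x \<in> L \<Longrightarrow> y \<in> L \<Longrightarrow> N +>\<^bsub>M\<^esub> \<theta> x = N +>\<^bsub>M\<^esub> \<theta> y \<longleftrightarrow> \<theta> (x - y) \<in> N"
proof -
  have mem: "\<theta> z \<in> carrier M" if "z \<in> L" for z using that surjectionD(1)[OF \<theta>] by blast
  note quot = quot_module_coset[OF N]
  show "surjection s L (quot_module M N) (\<lambda>x. N +>\<^bsub>M\<^esub> \<theta> x)"
    unfolding surjection_def
  proof (intro conjI ballI allI)
    show "(\<lambda>x. N +>\<^bsub>M\<^esub> \<theta> x) ` L = carrier (quot_module M N)"
      unfolding quot(1) surjectionD(1)[OF \<theta>, symmetric] image_image ..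
    fix x assume x: "x \<in> L"
    show "N +>\<^bsub>M\<^esub> \<theta> (s a x) = a \<odot>\<^bsub>quot_module M N\<^esub> (N +>\<^bsub>M\<^esub> \<theta> x)" for a
      using quot(3)[of a, OF _ mem[OF x]] surjectionD(3)[OF \<theta> x] by simp
    fix y assume y: "y \<in> L"
    show "N +>\<^bsub>M\<^esub> \<theta> (x + y) = (N +>\<^bsub>M\<^esub> \<theta> x) \<oplus>\<^bsub>quot_module M N\<^esub> (N +>\<^bsub>M\<^esub> \<theta> y)"
      using quot(2)[OF mem[OF x] mem[OF y]] surjectionD(2)[OF \<theta> x y] by simp
  qed
  show "N +>\<^bsub>M\<^esub> \<theta> x = N +>\<^bsub>M\<^esub> \<theta> y \<longleftrightarrow> \<theta> (x - y) \<in> N" if "x \<in> L" "y \<in> L"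
    using quot(4)[OF mem[OF that(1)] mem[OF that(2)]] surjection_diff[OF L \<theta> zero that] by simp
qed

lemma finsum_hom:
  fixes \<phi> :: "'m \<Rightarrow> 'c::comm_monoid_add"
  assumes "abelian_monoid M" and "finite A" and "\<And>i. i \<in> A \<Longrightarrow> f i \<in> carrier M"
    and add: "\<And>x y. x \<in> carrier M \<Longrightarrow> y \<in> carrier M \<Longrightarrow> \<phi> (x \<oplus>\<^bsub>M\<^esub> y) = \<phi> x + \<phi> y"
    and zero: "\<phi> \<zero>\<^bsub>M\<^esub> = 0"
  shows "\<phi> (\<Oplus>\<^bsub>M\<^esub> i\<in>A. f i) = (\<Sum>i\<in>A. \<phi> (f i))"
proof -
  interpret abelian_monoid M by (rule assms(1))
  show ?thesis
    using assms(2,3)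
  proof (induction A)
    case empty
    show ?case using zero by simp
  next
    case (insert i A)
    then have "f \<in> A \<rightarrow> carrier M" "f i \<in> carrier M" by auto
    then show ?case using insert add by (simp add: finsum_insert)
  qed
qed

interpretation fract_action: ring_action "\<lambda>(a::'a::idom) (x::nat \<Rightarrow> 'a fract). fscale (to_fract a) x"
  by unfold_locales (auto simp: fscale_def fun_eq_iff algebra_simps to_fract_add to_fract_mult)

locale dvr_symplectic =
  fixes p :: "'a::idom" and q n :: nat and mu :: "nat list"
  assumes dvr: "compact_dvr (class_ring :: 'a ring) p q" and mu: "mu \<in> partitions n"

sublocale dvr_symplectic \<subseteq> symplectic_space "range to_fract" "to_fract p" q fscale "std_form n"
    "std_space n" n unit_fun "\<lambda>i. unit_fun (n + i)"
  by (rule symplectic_space_standard[OF compact_dvr_valuation_ring[OF dvr]])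

context dvr_symplectic
begin

abbreviation smul :: "'a \<Rightarrow> (nat \<Rightarrow> 'a fract) \<Rightarrow> nat \<Rightarrow> 'a fract" where
  "smul a \<equiv> fscale (to_fract a)"

abbreviation "L \<equiv> module_vec TYPE('a) (2 * n)"

abbreviation \<Lambda>\<^sub>\<mu> :: "(nat \<Rightarrow> 'a fract) set" where "\<Lambda>\<^sub>\<mu> \<equiv> lat (wt ((!) mu))"

lemma length_mu: "length mu = n" using mu unfolding partitions_def by simp

lemma submodule_of_submod: "submod X \<Longrightarrow> submodule_of smul X"
  unfolding submod_def submodule_of_def by blast

lemma coord_std: "i < n \<Longrightarrow> coord x (i, t) = x (if t then n + i else i)"
  unfolding coord_def by (simp add: std_form_unit_fun)

lemma L0_std: "x \<in> L0 \<longleftrightarrow> x \<in> std_space n \<and> (\<forall>i<2 * n. x i \<in> range to_fract)"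
proof -
  have "(\<forall>j\<in>indices. coord x j \<in> range to_fract) \<longleftrightarrow> (\<forall>i<2 * n. x i \<in> range to_fract)"
  proof (intro iffI ballI allI impI)
    fix i assume *: "\<forall>j\<in>indices. coord x j \<in> range to_fract" "i < 2 * n"
    have "coord x (if i < n then (i, False) else (i - n, True)) \<in> range to_fract"
      by (rule bspec[OF *(1)]) (use *(2) in auto)
    then show "x i \<in> range to_fract" using *(2) by (auto simp: coord_std split: if_splits)
  next
    fix j assume *: "\<forall>i<2 * n. x i \<in> range to_fract" "j \<in> indices"
    then obtain i t where j: "j = (i, t)" "i < n" by blast
    then show "coord x j \<in> range to_fract" using *(1) by (simp add: coord_std)
  qed
  then show ?thesis unfolding L0_iff by blast
qed

lemma emb_std: "emb n v \<in> std_space n"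
  unfolding emb_def std_space_def by simp

lemma emb_L0: "emb n v \<in> L0"
  unfolding L0_std using emb_std[of v] by (simp add: emb_def)

lemma emb_vec_of: "x \<in> L0 \<Longrightarrow> emb n (vec_of n x) = x"
proof
  fix i assume "x \<in> L0"
  then have "x \<in> std_space n" "i < 2 * n \<Longrightarrow> x i \<in> range to_fract" unfolding L0_std by blast+
  then show "emb n (vec_of n x) i = x i"
    unfolding emb_def vec_of_def by (auto simp: to_fract_numer std_space_def)
qed

lemma vec_of_carrier: "vec_of n x \<in> carrier_vec (2 * n)"
  unfolding vec_of_def by simp

lemma emb_add: "v \<in> carrier_vec (2 * n) \<Longrightarrow> w \<in> carrier_vec (2 * n) \<Longrightarrow> emb n (v + w) = emb n v + emb n w"
  unfolding emb_def by (auto simp: fun_eq_iff to_fract_add)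

lemma emb_smult: "v \<in> carrier_vec (2 * n) \<Longrightarrow> emb n (a \<cdot>\<^sub>v v) = smul a (emb n v)"
  unfolding emb_def fscale_def by (auto simp: fun_eq_iff to_fract_mult)

lemma emb_zero: "emb n (0\<^sub>v (2 * n) :: 'a vec) = 0"
  unfolding emb_def by (auto simp: fun_eq_iff)

lemma surjection_vec: "surjection smul L0 L (vec_of n)"
  unfolding surjection_def module_vec_simps
proof (intro conjI ballI allI)
  show "vec_of n ` L0 = carrier_vec (2 * n)"
  proof (intro equalityI subsetI)
    fix v :: "'a vec" assume "v \<in> vec_of n ` L0"
    then show "v \<in> carrier_vec (2 * n)" using vec_of_carrier by blast
  next
    fix v :: "'a vec" assume "v \<in> carrier_vec (2 * n)"
    then show "v \<in> vec_of n ` L0" using vec_of_emb[of v n] emb_L0[of v] by (metis imageI)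
  qed
  fix x assume x: "x \<in> L0"
  show "vec_of n (smul a x) = a \<cdot>\<^sub>v vec_of n x" for a
    using vec_of_emb[of "a \<cdot>\<^sub>v vec_of n x" n] emb_smult[OF vec_of_carrier, of a x] emb_vec_of[OF x] vec_of_carrier[of x]
    by simp
  fix y assume y: "y \<in> L0"
  show "vec_of n (x + y) = vec_of n x + vec_of n y"
    using vec_of_emb[of "vec_of n x + vec_of n y" n] emb_add[OF vec_of_carrier vec_of_carrier, of x y]
      emb_vec_of[OF x] emb_vec_of[OF y] vec_of_carrier[of x] vec_of_carrier[of y] by simp
qed

lemma zero_vec: "\<zero>\<^bsub>L\<^esub> = vec_of n 0"
  using vec_of_emb[of "0\<^sub>v (2 * n) :: 'a vec" n] by (simp add: emb_zero module_vec_simps)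

lemma module_vec: "module (class_ring :: 'a ring) L"
  by (rule fract_action.module_surjection[OF submodule_of_submod[OF submod_lat] surjection_vec zero_vec])

lemma emb_mem_iff:
  assumes "\<Lambda> \<subseteq> carrier_vec (2 * n)" "v \<in> carrier_vec (2 * n)"
  shows "emb n v \<in> emb n ` \<Lambda> \<longleftrightarrow> v \<in> \<Lambda>"
proof
  assume "emb n v \<in> emb n ` \<Lambda>"
  then obtain w where w: "w \<in> \<Lambda>" "emb n v = emb n w" by blast
  then have "w \<in> carrier_vec (2 * n)" using assms(1) by blast
  then have "v = w" using arg_cong[OF w(2), of "vec_of n"] by (simp only: vec_of_emb assms(2))
  then show "v \<in> \<Lambda>" using w(1) by simp
qed blast

lemma submodule_iff_submod:
  assumes \<Lambda>: "\<Lambda> \<subseteq> carrier_vec (2 * n)"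
  shows "submodule (class_ring :: 'a ring) \<Lambda> L \<longleftrightarrow> submod (emb n ` \<Lambda>)"
proof
  assume "submodule (class_ring :: 'a ring) \<Lambda> L"
  then interpret N: submodule "class_ring :: 'a ring" \<Lambda> L .
  show "submod (emb n ` \<Lambda>)"
    unfolding submod_def
  proof (intro conjI ballI)
    show "emb n ` \<Lambda> \<subseteq> std_space n" using emb_std by blast
    show "0 \<in> emb n ` \<Lambda>" using N.zero_closed emb_zero unfolding module_vec_simps by (metis imageI)
    show "x + y \<in> emb n ` \<Lambda>" if xy: "x \<in> emb n ` \<Lambda>" "y \<in> emb n ` \<Lambda>" for x y
    proof -
      obtain v w where vw: "v \<in> \<Lambda>" "x = emb n v" "w \<in> \<Lambda>" "y = emb n w" using xy by blast
      then have "v + w \<in> \<Lambda>" using N.m_closed[of v w] unfolding module_vec_simps by blast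
      moreover have "x + y = emb n (v + w)" using vw \<Lambda> by (simp add: emb_add subset_iff)
      ultimately show ?thesis by blast
    qed
    show "fscale a x \<in> emb n ` \<Lambda>" if ax: "a \<in> range to_fract" "x \<in> emb n ` \<Lambda>" for a x
    proof -
      obtain c v where cv: "a = to_fract c" "v \<in> \<Lambda>" "x = emb n v" using ax by blast
      then have "c \<cdot>\<^sub>v v \<in> \<Lambda>" using N.smult_closed[of c v] unfolding module_vec_simps by simp
      moreover have "fscale a x = emb n (c \<cdot>\<^sub>v v)" using cv \<Lambda> by (simp add: emb_smult subset_iff)
      ultimately show ?thesis by blast
    qed
  qed
next
  assume sub: "submod (emb n ` \<Lambda>)"
  have mem: "v \<in> \<Lambda>" if "v \<in> carrier_vec (2 * n)" "emb n v \<in> emb n ` \<Lambda>" for v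
    using emb_mem_iff[OF \<Lambda> that(1)] that(2) by blast
  show "submodule (class_ring :: 'a ring) \<Lambda> L"
  proof (rule submodule.intro[OF module_vec]; unfold module_vec_simps)
    show "\<Lambda> \<subseteq> carrier_vec (2 * n)" by (rule \<Lambda>)
    show "0\<^sub>v (2 * n) \<in> \<Lambda>" using mem[of "0\<^sub>v (2 * n)"] submodD(2)[OF sub] by (simp add: emb_zero)
    show "v + w \<in> \<Lambda>" if "v \<in> \<Lambda>" "w \<in> \<Lambda>" for v w
    proof (rule mem)
      have vw: "v \<in> carrier_vec (2 * n)" "w \<in> carrier_vec (2 * n)" using that \<Lambda> by blast+
      then show "v + w \<in> carrier_vec (2 * n)" by simp
      show "emb n (v + w) \<in> emb n ` \<Lambda>" unfolding emb_add[OF vw] using that by (intro submodD(3)[OF sub]) blast+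
    qed
    show "c \<cdot>\<^sub>v v \<in> \<Lambda>" if "c \<in> carrier class_ring" "v \<in> \<Lambda>" for c :: 'a and v
    proof (rule mem)
      have v: "v \<in> carrier_vec (2 * n)" using that \<Lambda> by blast
      then show "c \<cdot>\<^sub>v v \<in> carrier_vec (2 * n)" by simp
      show "emb n (c \<cdot>\<^sub>v v) \<in> emb n ` \<Lambda>" unfolding emb_smult[OF v] using that by (intro submodD(4)[OF sub]) blast+
    qed
  qed
qed

lemma quot_isomorphic_iff:
  assumes \<Lambda>: "submodule (class_ring :: 'a ring) \<Lambda> L"
  shows "module_isomorphic class_ring (quot_module L \<Lambda>) T \<longleftrightarrow> has_quotient smul T L0 (emb n ` \<Lambda>)"
proof (rule fract_action.isomorphic_iff_has_quotient[OF submodule_of_submod[OF submod_lat],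
      where \<theta> = "\<lambda>x. \<Lambda> +>\<^bsub>L\<^esub> vec_of n x"])
  note quot = fract_action.surjection_quot[OF submodule_of_submod[OF submod_lat] surjection_vec zero_vec \<Lambda>]
  show "surjection smul L0 (quot_module L \<Lambda>) (\<lambda>x. \<Lambda> +>\<^bsub>L\<^esub> vec_of n x)" by (rule quot(1))
  fix x y assume xy: "x \<in> L0" "y \<in> L0"
  have d: "x - y \<in> L0" by (rule submod_diff[OF submod_lat xy])
  have "\<Lambda> \<subseteq> carrier_vec (2 * n)" using submodule.subset[OF \<Lambda>] unfolding module_vec_simps .
  then have "vec_of n (x - y) \<in> \<Lambda> \<longleftrightarrow> x - y \<in> emb n ` \<Lambda>"
    using emb_mem_iff[OF _ vec_of_carrier, of \<Lambda> "x - y"] emb_vec_of[OF d] by simp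
  then show "\<Lambda> +>\<^bsub>L\<^esub> vec_of n x = \<Lambda> +>\<^bsub>L\<^esub> vec_of n y \<longleftrightarrow> x - y \<in> emb n ` \<Lambda>"
    using quot(2)[OF xy] by (simp only:)
qed

definition pos :: "nat \<times> bool \<Rightarrow> nat" where
  "pos j = (if snd j then n + fst j else fst j)"

definition idx :: "nat \<Rightarrow> nat \<times> bool" where
  "idx k = (if k < n then (k, False) else (k - n, True))"

lemma pos_less: "j \<in> indices \<Longrightarrow> pos j < 2 * n"
  unfolding pos_def by auto

lemma idx_in: "k < 2 * n \<Longrightarrow> idx k \<in> indices"
  unfolding idx_def by auto

lemma pos_idx: "k < 2 * n \<Longrightarrow> pos (idx k) = k"
  unfolding idx_def pos_def by auto

lemma idx_pos: "j \<in> indices \<Longrightarrow> idx (pos j) = j"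
  unfolding idx_def pos_def by (cases j) auto

abbreviation "J\<^sub>\<mu> \<equiv> symp_mat n (mat_diag n (\<lambda>i. p ^ (mu ! i)))"

lemma gram_symp_mat:
  assumes "j \<in> indices" "k \<in> indices"
  shows "to_fract (J\<^sub>\<mu> $$ (pos j, pos k)) = gram ((!) mu) j k"
proof -
  obtain i s l t where jk: "j = (i, s)" "k = (l, t)" "i < n" "l < n" using assms by blast
  have neg: "to_fract (- x) = - to_fract x" for x :: 'a
    using to_fract_diff[of 0 x] by simp
  show ?thesis
    unfolding jk(1,2) pos_def gram_def opp_def using jk(3,4)
    by (subst symp_mat_index) (auto simp: mat_diag_def to_fract_power neg)
qed

text \<open>An element of \<open>G\<close> moves the basis of \<open>\<Lambda>\<^sub>\<mu>\<close> to the given one, and both lattices are spanned by their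
  bases.\<close>

lemma basis_imp_orbit:
  assumes \<Lambda>: "submodule (class_ring :: 'a ring) \<Lambda> L"
    and basis: "ordered_basis class_ring (L\<lparr>carrier := \<Lambda>\<rparr>) bs" and gram: "gram_mat n bs = J\<^sub>\<mu>"
  shows "\<exists>g\<in>G. emb n ` \<Lambda> = g ` \<Lambda>\<^sub>\<mu>"
proof -
  interpret Lm: module "class_ring :: 'a ring" L by (rule module_vec)
  have bs: "set bs \<subseteq> \<Lambda>" "module.span class_ring (L\<lparr>carrier := \<Lambda>\<rparr>) (set bs) = \<Lambda>"
    using basis unfolding ordered_basis_def by simp_all
  have car: "\<Lambda> \<subseteq> carrier_vec (2 * n)" using submodule.subset[OF \<Lambda>] unfolding module_vec_simps .
  have sub: "submod (emb n ` \<Lambda>)" using submodule_iff_submod[OF car] \<Lambda> by blast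
  have "dim_row (gram_mat n bs) = 2 * n" unfolding gram symp_mat_def by (simp add: mat_diag_def)
  then have len: "length bs = 2 * n" unfolding gram_mat_def by simp
  define b where "b j = emb n (bs ! pos j)" for j
  have b: "bs ! pos j \<in> \<Lambda>" if "j \<in> indices" for j
    using bs(1) nth_mem[of "pos j" bs] pos_less[OF that] len by auto
  have gb: "std_form n (b j) (b k) = local.gram ((!) mu) j k" if jk: "j \<in> indices" "k \<in> indices" for j k
  proof -
    have "std_form n (b j) (b k) = to_fract (symp_form n (bs ! pos j) (bs ! pos k))"
      unfolding b_def using b[OF jk(1)] b[OF jk(2)] car by (intro symp_form_std_form[symmetric]) blast+
    also have "symp_form n (bs ! pos j) (bs ! pos k) = gram_mat n bs $$ (pos j, pos k)"
      unfolding gram_mat_def using pos_less[OF jk(1)] pos_less[OF jk(2)] len by simp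
    also have "to_fract \<dots> = local.gram ((!) mu) j k" unfolding gram by (rule gram_symp_mat[OF jk])
    finally show ?thesis .
  qed
  have bV: "b j \<in> std_space n" if "j \<in> indices" for j
    unfolding b_def by (rule emb_std)
  obtain g where g: "g \<in> G"
    "\<And>j. j \<in> indices \<Longrightarrow> g (fscale (to_fract p ^ wt ((!) mu) j) (local.basis j)) = b j"
    using gram_basis_moved[OF bV gb] by blast
  have le: "g ` \<Lambda>\<^sub>\<mu> \<subseteq> emb n ` \<Lambda>"
  proof
    fix x assume "x \<in> g ` \<Lambda>\<^sub>\<mu>"
    then obtain c where c: "\<And>j. c j \<in> range to_fract"
      "x = (\<Sum>j\<in>indices. fscale (c j) (g (fscale (to_fract p ^ wt ((!) mu) j) (local.basis j))))"
      unfolding image_lat[OF g(1)] by blast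
    show "x \<in> emb n ` \<Lambda>"
      unfolding c(2)
    proof (intro submod_sum[OF sub] submodD(4)[OF sub] c(1))
      fix j assume j: "j \<in> indices"
      show "g (fscale (to_fract p ^ wt ((!) mu) j) (local.basis j)) \<in> emb n ` \<Lambda>"
        unfolding g(2)[OF j] b_def using b[OF j] by blast
    qed
  qed
  have "emb n ` \<Lambda> \<subseteq> g ` \<Lambda>\<^sub>\<mu>"
  proof -
    let ?N = "{v \<in> \<Lambda>. emb n v \<in> g ` \<Lambda>\<^sub>\<mu>}"
    have gsub: "submod (g ` \<Lambda>\<^sub>\<mu>)" by (rule submod_image[OF g(1) submod_lat])
    have embN: "emb n ` ?N = g ` \<Lambda>\<^sub>\<mu>"
    proof (intro equalityI subsetI)
      fix x assume "x \<in> emb n ` ?N"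
      then show "x \<in> g ` \<Lambda>\<^sub>\<mu>" by auto
    next
      fix x assume x: "x \<in> g ` \<Lambda>\<^sub>\<mu>"
      then obtain v where "v \<in> \<Lambda>" "x = emb n v" using le by blast
      then show "x \<in> emb n ` ?N" using x by simp
    qed
    have "submodule (class_ring :: 'a ring) ?N L"
      using submodule_iff_submod[of ?N] gsub subset_trans[OF _ car, of ?N] unfolding embN by simp
    moreover have "set bs \<subseteq> ?N"
    proof
      fix v assume "v \<in> set bs"
      then obtain k where k: "k < 2 * n" "v = bs ! k" using len by (metis in_set_conv_nth)
      have "fscale (to_fract p ^ wt ((!) mu) (idx k)) (local.basis (idx k)) \<in> \<Lambda>\<^sub>\<mu>"
        by (rule scaled_basis_lat[OF idx_in[OF k(1)]])
      then have "b (idx k) \<in> g ` \<Lambda>\<^sub>\<mu>" using g(2)[OF idx_in[OF k(1)]] by (metis imageI)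
      then show "v \<in> ?N" using k bs(1) len unfolding b_def pos_idx[OF k(1)] by auto
    qed
    ultimately have "Lm.span (set bs) \<subseteq> ?N" by (intro Lm.span_is_subset)
    moreover have "Lm.span (set bs) = \<Lambda>" using Lm.span_li_not_depend(1)[OF bs(1) \<Lambda>] bs(2) by simp
    ultimately show ?thesis by blast
  qed
  then show ?thesis using le g(1) by blast
qed

end

section \<open>Dual lattices and finiteness\<close>

context symplectic_space
begin

definition dual :: "'v set \<Rightarrow> 'v set" where
  "dual \<Lambda> = {x \<in> V. \<forall>y\<in>\<Lambda>. B x y \<in> \<O>}"

lemma dual_lat_iff:
  "x \<in> dual (lat (wt \<mu>)) \<longleftrightarrow> x \<in> V \<and> (\<forall>j\<in>indices. \<pi> ^ wt \<mu> (opp j) * coord x j \<in> \<O>)"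
proof (intro iffI conjI ballI)
  assume x: "x \<in> dual (lat (wt \<mu>))"
  then show "x \<in> V" unfolding dual_def by blast
  fix j assume j: "j \<in> indices"
  have "B x (\<pi> ^ wt \<mu> (opp j) \<cdot> basis (opp j)) \<in> \<O>"
    using x scaled_basis_lat[OF opp_in[OF j]] unfolding dual_def by blast
  then show "\<pi> ^ wt \<mu> (opp j) * coord x j \<in> \<O>"
    using B_basis_opp[of x _ j] P_uminus_iff[of _ 0] unfolding P_0 by metis
next
  assume x: "x \<in> V \<and> (\<forall>j\<in>indices. \<pi> ^ wt \<mu> (opp j) * coord x j \<in> \<O>)"
  have "B x y \<in> \<O>" if y: "y \<in> lat (wt \<mu>)" for y
  proof -
    have "B x y \<in> \<P> 0"
    proof (rule B_coord_mem)
      show "x \<in> V" using x by blast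
      fix j assume j: "j \<in> indices"
      obtain c where c: "c \<in> \<O>" "coord y (opp j) = \<pi> ^ wt \<mu> (opp j) * c"
        using latD[OF y opp_in[OF j]] unfolding \<P>_def by blast
      have "\<pi> ^ wt \<mu> (opp j) * coord x j \<in> \<O>" using x j by blast
      from mult_in[OF this c(1)] show "coord x j * coord y (opp j) \<in> \<P> 0"
        unfolding c(2) P_0 by (simp add: mult_ac)
    qed
    then show ?thesis unfolding P_0 .
  qed
  then show "x \<in> dual (lat (wt \<mu>))" using x unfolding dual_def by blast
qed

lemma submod_dual: "submod (dual \<Lambda>)"
  unfolding submod_def dual_def
  by (auto simp: V_zero V_add V_scale zero_in B_linear add_in mult_in)

lemma lat_subset_dual: "lat (wt \<mu>) \<subseteq> dual (lat (wt \<mu>))"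
proof
  fix x assume x: "x \<in> lat (wt \<mu>)"
  then have "x \<in> L0" using lat_subset_L0 by blast
  then show "x \<in> dual (lat (wt \<mu>))"
    unfolding dual_def using B_L0 lat_subset_L0 L0_iff by blast
qed

text \<open>The exponents of \<open>\<pi>\<close> in the coordinates of the dual and of the lattice differ by \<open>\<mu> i\<close>, which the
  sum of all parts bounds.\<close>

lemma dual_absorbs:
  assumes x: "x \<in> dual (lat (wt \<mu>))"
  shows "\<pi> ^ (\<Sum>i<n. \<mu> i) \<cdot> x \<in> lat (wt \<mu>)"
  unfolding lat_iff
proof (intro conjI ballI)
  show "\<pi> ^ (\<Sum>i<n. \<mu> i) \<cdot> x \<in> V" using x V_scale unfolding dual_lat_iff by blast
  fix j assume j: "j \<in> indices"
  let ?N = "\<Sum>i<n. \<mu> i"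
  have "wt \<mu> j + wt \<mu> (opp j) \<le> ?N"
    unfolding wt_opp using j by (intro member_le_sum) auto
  then have N: "\<pi> ^ ?N = \<pi> ^ (?N - wt \<mu> (opp j)) * \<pi> ^ wt \<mu> (opp j)" by (simp flip: power_add)
  have "\<pi> ^ wt \<mu> (opp j) * coord x j \<in> \<O>" using x j unfolding dual_lat_iff by blast
  then have "\<pi> ^ (?N - wt \<mu> (opp j)) * (\<pi> ^ wt \<mu> (opp j) * coord x j) \<in> \<P> (?N - wt \<mu> (opp j) + 0)"
    unfolding P_pi_power P_0 .
  then have "coord (\<pi> ^ ?N \<cdot> x) j \<in> \<P> (?N - wt \<mu> (opp j))"
    unfolding coord_scale N by (simp add: mult.assoc)
  moreover have "wt \<mu> j \<le> ?N - wt \<mu> (opp j)" using \<open>wt \<mu> j + wt \<mu> (opp j) \<le> ?N\<close> by linarith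
  ultimately show "coord (\<pi> ^ ?N \<cdot> x) j \<in> \<P> (wt \<mu> j)" using P_antimono by blast
qed

lemma orbit_self_dual:
  assumes g: "g \<in> G" and x: "x \<in> V"
  shows "x \<in> g ` L0 \<longleftrightarrow> (\<forall>y\<in>g ` L0. B x y \<in> \<O>)"
proof
  assume "x \<in> g ` L0"
  then show "\<forall>y\<in>g ` L0. B x y \<in> \<O>" using B_L0 by (auto simp: G_B[OF g])
next
  assume *: "\<forall>y\<in>g ` L0. B x y \<in> \<O>"
  obtain h where h: "h \<in> G" "g \<circ> h = id" using inv_G[OF g] by blast
  have gh: "g (h x) = x" using h(2) by (metis comp_apply id_apply)
  have "h x \<in> L0"
  proof (rule L0_self_dual[OF G_V[OF h(1) x]])
    fix y assume "y \<in> L0"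
    then have "B (g (h x)) (g y) \<in> \<O>" using * gh by simp
    then show "B (h x) y \<in> \<O>" unfolding G_B[OF g] .
  qed
  then show "x \<in> g ` L0" using gh by (metis imageI)
qed

text \<open>If \<open>\<Lambda> = g (lat (wt \<mu>)) \<subseteq> L0\<close>, then \<open>L0\<close> is contained in the dual of \<open>\<Lambda>\<close>, which a power of \<open>\<pi>\<close>
  depending on \<open>\<mu>\<close> only maps into \<open>\<Lambda>\<close>.\<close>

lemma finite_orbit_below: "finite {g ` lat (wt \<mu>) |g. g \<in> G \<and> g ` lat (wt \<mu>) \<subseteq> L0}"
proof (rule finite_subset[OF _ finite_between[of "\<Sum>i<n. \<mu> i"]], intro subsetI)
  fix X assume "X \<in> {g ` lat (wt \<mu>) |g. g \<in> G \<and> g ` lat (wt \<mu>) \<subseteq> L0}"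
  then obtain g where g: "g \<in> G" "g ` lat (wt \<mu>) \<subseteq> L0" and X: "X = g ` lat (wt \<mu>)" by blast
  let ?N = "\<Sum>i<n. \<mu> i"
  obtain h where h: "h \<in> G" "g \<circ> h = id" using inv_G[OF g(1)] by blast
  have low: "\<pi> ^ ?N \<cdot> v \<in> X" if v: "v \<in> L0" for v
  proof -
    have gh: "g (h v) = v" using h(2) by (metis comp_apply id_apply)
    have "h v \<in> dual (lat (wt \<mu>))"
      unfolding dual_def
    proof (intro CollectI conjI ballI)
      show "h v \<in> V" using G_V[OF h(1)] v L0_iff by blast
      fix y assume "y \<in> lat (wt \<mu>)"
      then have "g y \<in> L0" using g(2) by blast
      then show "B (h v) y \<in> \<O>" using B_L0[OF v] G_B[OF g(1), of "h v" y] gh by metis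
    qed
    from dual_absorbs[OF this] have "g (\<pi> ^ ?N \<cdot> h v) \<in> X" unfolding X by (rule imageI)
    then show ?thesis unfolding G_scale[OF g(1)] gh .
  qed
  have up: "\<pi> ^ ?N \<cdot> v \<in> L0" if "v \<in> X" for v
    using that g(2) X submodD(4)[OF submod_lat pi_power_in] by blast
  have "submod X" unfolding X by (rule submod_image[OF g(1) submod_lat])
  with low up show "X \<in> {z. submod z \<and> (\<forall>v\<in>L0. \<pi> ^ ?N \<cdot> v \<in> z) \<and> (\<forall>v\<in>z. \<pi> ^ ?N \<cdot> v \<in> L0)}" by simp
qed

lemma orbit_above_dual:
  assumes "g \<in> G" "lat (wt \<mu>) \<subseteq> g ` L0"
  shows "g ` L0 \<subseteq> dual (lat (wt \<mu>))"
proof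
  fix x assume x: "x \<in> g ` L0"
  then have xV: "x \<in> V" using G_V[OF assms(1)] L0_iff by blast
  then show "x \<in> dual (lat (wt \<mu>))"
    using orbit_self_dual[OF assms(1) xV] x assms(2) unfolding dual_def by blast
qed

lemma finite_orbit_above: "finite {g ` L0 |g. g \<in> G \<and> lat (wt \<mu>) \<subseteq> g ` L0}"
proof (rule finite_subset[OF _ finite_between[of "\<Sum>i<n. \<mu> i"]], intro subsetI)
  fix X assume "X \<in> {g ` L0 |g. g \<in> G \<and> lat (wt \<mu>) \<subseteq> g ` L0}"
  then obtain g where g: "g \<in> G" "lat (wt \<mu>) \<subseteq> g ` L0" and X: "X = g ` L0" by blast
  let ?N = "\<Sum>i<n. \<mu> i"
  have low: "\<pi> ^ ?N \<cdot> v \<in> X" if v: "v \<in> L0" for v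
  proof -
    have "v \<in> dual (lat (wt \<mu>))"
      unfolding dual_def using v B_L0[OF v] lat_subset_L0 L0_iff by blast
    then show ?thesis using dual_absorbs g(2) X by blast
  qed
  have up: "\<pi> ^ ?N \<cdot> v \<in> L0" if "v \<in> X" for v
    using that orbit_above_dual[OF g] dual_absorbs lat_subset_L0 unfolding X by blast
  have "submod X" unfolding X by (rule submod_image[OF g(1) submod_lat])
  with low up show "X \<in> {z. submod z \<and> (\<forall>v\<in>L0. \<pi> ^ ?N \<cdot> v \<in> z) \<and> (\<forall>v\<in>z. \<pi> ^ ?N \<cdot> v \<in> L0)}" by simp
qed

end

section \<open>Bases of the lattices in an orbit\<close>

context dvr_symplectic
begin

lemma has_quotient_image:
  assumes g: "g \<in> G" and X: "has_quotient smul T X \<Lambda>"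
  shows "has_quotient smul T (g ` X) (g ` \<Lambda>)"
proof -
  obtain h where h: "surjection smul X T h" "\<And>x y. x \<in> X \<Longrightarrow> y \<in> X \<Longrightarrow> h x = h y \<longleftrightarrow> x - y \<in> \<Lambda>"
    using X unfolding has_quotient_def by blast
  obtain g' where g': "g' \<in> G" "g' \<circ> g = id" "g \<circ> g' = id" using inv_G[OF g] by blast
  have g'g: "g' (g x) = x" for x using g'(2) by (metis comp_apply id_apply)
  have inj: "g x \<in> g ` \<Lambda> \<longleftrightarrow> x \<in> \<Lambda>" for x
    using g'g by (metis imageE imageI)
  have "surjection smul (g ` X) T (h \<circ> g')"
    unfolding surjection_def
  proof (intro conjI ballI allI)
    show "(h \<circ> g') ` g ` X = carrier T"
      using surjectionD(1)[OF h(1)] by (simp add: image_image g'g)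
    fix x assume "x \<in> g ` X"
    then obtain x' where x': "x' \<in> X" "x = g x'" by blast
    show "(h \<circ> g') (smul a x) = a \<odot>\<^bsub>T\<^esub> (h \<circ> g') x" for a
      using surjectionD(3)[OF h(1) x'(1), of a] unfolding x'(2) by (simp add: g'g flip: G_scale[OF g])
    fix y assume "y \<in> g ` X"
    then obtain y' where y': "y' \<in> X" "y = g y'" by blast
    show "(h \<circ> g') (x + y) = (h \<circ> g') x \<oplus>\<^bsub>T\<^esub> (h \<circ> g') y"
      using surjectionD(2)[OF h(1) x'(1) y'(1)] unfolding x'(2) y'(2) comp_apply G_add[OF g, symmetric] g'g .
  qed
  moreover have "(h \<circ> g') x = (h \<circ> g') y \<longleftrightarrow> x - y \<in> g ` \<Lambda>" if mem: "x \<in> g ` X" "y \<in> g ` X" for x y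
  proof -
    obtain x' y' where xy: "x' \<in> X" "x = g x'" "y' \<in> X" "y = g y'" using mem by blast
    show ?thesis
      unfolding xy(2,4) comp_apply g'g G_diff[OF g, symmetric] inj by (rule h(2)[OF xy(1,3)])
  qed
  ultimately show ?thesis unfolding has_quotient_def by blast
qed

lemma emb_vec_of_image:
  assumes "X \<subseteq> L0"
  shows "emb n ` vec_of n ` X = X"
proof -
  have "(\<lambda>x. emb n (vec_of n x)) ` X = (\<lambda>x. x) ` X"
    using assms emb_vec_of by (intro image_cong) auto
  then show ?thesis by (simp add: image_image)
qed

lemma gram_opp_nonzero: "gram \<mu> j (opp j) \<noteq> 0"
  unfolding gram_def using pi_nonzero by simp

lemma opp_inj: "opp j = opp k \<Longrightarrow> j = k"
  unfolding opp_def by (auto simp: prod_eq_iff)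

text \<open>The basis is the image of the basis of \<open>\<Lambda>\<^sub>\<mu>\<close>.  A family with nondegenerate Gram matrix is linearly
  independent: pairing a relation with the partner of a vector isolates the coefficient of that
  vector.\<close>

lemma orbit_imp_basis:
  assumes g: "g \<in> G" "g ` \<Lambda>\<^sub>\<mu> \<subseteq> L0"
  defines "\<Lambda> \<equiv> vec_of n ` g ` \<Lambda>\<^sub>\<mu>"
  shows "submodule (class_ring :: 'a ring) \<Lambda> L"
    and "\<exists>bs. ordered_basis class_ring (L\<lparr>carrier := \<Lambda>\<rparr>) bs \<and> gram_mat n bs = J\<^sub>\<mu>"
proof -
  interpret Lm: module "class_ring :: 'a ring" L by (rule module_vec)
  have car: "\<Lambda> \<subseteq> carrier_vec (2 * n)" unfolding \<Lambda>_def using vec_of_carrier by blast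
  have emb\<Lambda>: "emb n ` \<Lambda> = g ` \<Lambda>\<^sub>\<mu>" unfolding \<Lambda>_def by (rule emb_vec_of_image[OF g(2)])
  show sub: "submodule (class_ring :: 'a ring) \<Lambda> L"
    unfolding submodule_iff_submod[OF car] emb\<Lambda> by (rule submod_image[OF g(1) submod_lat])
  define b where "b j = g (fscale (to_fract p ^ wt ((!) mu) j) (local.basis j))" for j
  have b_in: "b j \<in> g ` \<Lambda>\<^sub>\<mu>" if "j \<in> indices" for j
    unfolding b_def using scaled_basis_lat[OF that] by (rule imageI)
  have b_L0: "b j \<in> L0" if "j \<in> indices" for j using b_in[OF that] g(2) by blast
  have gb: "std_form n (b j) (b k) = local.gram ((!) mu) j k" if "j \<in> indices" "k \<in> indices" for j k
    unfolding b_def G_B[OF g(1)] by (rule B_scaled_basis[OF that])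
  define bs where "bs = map (\<lambda>k. vec_of n (b (idx k))) [0..<2 * n]"
  have len: "length bs = 2 * n" unfolding bs_def by simp
  have nth: "bs ! k = vec_of n (b (idx k))" if "k < 2 * n" for k
    unfolding bs_def using that by simp
  have emb_nth: "emb n (bs ! k) = b (idx k)" if "k < 2 * n" for k
    unfolding nth[OF that] by (rule emb_vec_of[OF b_L0[OF idx_in[OF that]]])
  have nth_in: "bs ! k \<in> \<Lambda>" if "k < 2 * n" for k
    unfolding nth[OF that] \<Lambda>_def by (rule imageI[OF b_in[OF idx_in[OF that]]])
  have set_bs: "set bs \<subseteq> \<Lambda>"
  proof
    fix v assume "v \<in> set bs"
    then obtain k where "k < 2 * n" "v = bs ! k" using len by (metis in_set_conv_nth)
    then show "v \<in> \<Lambda>" using nth_in by simp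
  qed
  have partner: "std_form n (emb n (bs ! l)) (b (opp (idx k))) = (if l = k then gram ((!) mu) (idx k) (opp (idx k)) else 0)"
    if kl: "k < 2 * n" "l < 2 * n" for k l
  proof -
    have "std_form n (emb n (bs ! l)) (b (opp (idx k))) = gram ((!) mu) (idx l) (opp (idx k))"
      unfolding emb_nth[OF kl(2)] by (rule gb[OF idx_in[OF kl(2)] opp_in[OF idx_in[OF kl(1)]]])
    moreover have "opp (idx k) = opp (idx l) \<Longrightarrow> l = k"
      using opp_inj pos_idx[OF kl(1)] pos_idx[OF kl(2)] by metis
    ultimately show ?thesis unfolding gram_def by auto
  qed
  have gram: "gram_mat n bs = J\<^sub>\<mu>"
  proof (rule eq_matI)
    show dims: "dim_row (gram_mat n bs) = dim_row J\<^sub>\<mu>" "dim_col (gram_mat n bs) = dim_col J\<^sub>\<mu>"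
      unfolding gram_mat_def symp_mat_def using len by (simp_all add: mat_diag_def)
    fix k l assume "k < dim_row J\<^sub>\<mu>" "l < dim_col J\<^sub>\<mu>"
    then have kl: "k < 2 * n" "l < 2 * n" unfolding symp_mat_def by (simp_all add: mat_diag_def)
    have "to_fract (gram_mat n bs $$ (k, l)) = to_fract (symp_form n (bs ! k) (bs ! l))"
      unfolding gram_mat_def using kl len by simp
    also have "\<dots> = std_form n (emb n (bs ! k)) (emb n (bs ! l))"
      using nth_in[OF kl(1)] nth_in[OF kl(2)] car by (intro symp_form_std_form) blast+
    also have "\<dots> = gram ((!) mu) (idx k) (idx l)"
      unfolding emb_nth[OF kl(1)] emb_nth[OF kl(2)] by (rule gb[OF idx_in[OF kl(1)] idx_in[OF kl(2)]])
    also have "\<dots> = to_fract (J\<^sub>\<mu> $$ (k, l))"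
      using gram_symp_mat[OF idx_in[OF kl(1)] idx_in[OF kl(2)]] unfolding pos_idx[OF kl(1)] pos_idx[OF kl(2)] by simp
    finally show "gram_mat n bs $$ (k, l) = J\<^sub>\<mu> $$ (k, l)" by (simp only: to_fract_eq_iff)
  qed
  have "distinct bs"
    unfolding distinct_conv_nth
  proof (intro allI impI notI)
    fix k l assume kl: "k < length bs" "l < length bs" "k \<noteq> l" "bs ! k = bs ! l"
    then show False
      using partner[of k k] partner[of k l] gram_opp_nonzero[of "(!) mu" "idx k"] len by auto
  qed
  moreover have "\<not> Lm.lin_dep (set bs)"
  proof
    assume "Lm.lin_dep (set bs)"
    then obtain A a v where A: "finite A" "A \<subseteq> set bs" "Lm.lincomb a A = \<zero>\<^bsub>L\<^esub>" "v \<in> A" "a v \<noteq> 0"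
      unfolding Lm.lin_dep_def by auto
    have "v \<in> set bs" using A by blast
    then obtain k where k: "k < 2 * n" "v = bs ! k" using len by (metis in_set_conv_nth)
    let ?\<phi> = "\<lambda>x. std_form n (emb n x) (b (opp (idx k)))"
    have Acar: "x \<in> carrier_vec (2 * n)" if "x \<in> A" for x using that A(2) set_bs car by blast
    have "?\<phi> (\<Oplus>\<^bsub>L\<^esub> x\<in>A. a x \<odot>\<^bsub>L\<^esub> x) = (\<Sum>x\<in>A. ?\<phi> (a x \<odot>\<^bsub>L\<^esub> x))"
    proof (rule finsum_hom)
      show "abelian_monoid L" by unfold_locales
      show "a x \<odot>\<^bsub>L\<^esub> x \<in> carrier L" if "x \<in> A" for x using Acar[OF that] unfolding module_vec_simps by simp
      show "?\<phi> (x \<oplus>\<^bsub>L\<^esub> y) = ?\<phi> x + ?\<phi> y" if "x \<in> carrier L" "y \<in> carrier L" for x y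
        using that unfolding module_vec_simps by (simp add: emb_add B_linear)
      show "?\<phi> \<zero>\<^bsub>L\<^esub> = 0" unfolding module_vec_simps by (simp add: emb_zero)
    qed (rule A(1))
    also have "\<dots> = (\<Sum>x\<in>A. if x = v then to_fract (a v) * ?\<phi> v else 0)"
    proof (intro sum.cong refl)
      fix x assume x: "x \<in> A"
      then obtain l where l: "l < 2 * n" "x = bs ! l" using A(2) len by (metis in_set_conv_nth subsetD)
      have "?\<phi> (a x \<odot>\<^bsub>L\<^esub> x) = to_fract (a x) * ?\<phi> x"
        unfolding module_vec_simps emb_smult[OF Acar[OF x]] by (simp add: B_linear)
      moreover have "?\<phi> x = 0" if "x \<noteq> v"
      proof -
        have "l \<noteq> k" using that l k by auto
        then show ?thesis using partner[OF k(1) l(1)] l(2) by simp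
      qed
      ultimately show "?\<phi> (a x \<odot>\<^bsub>L\<^esub> x) = (if x = v then to_fract (a v) * ?\<phi> v else 0)" by auto
    qed
    also have "\<dots> = to_fract (a v) * ?\<phi> v" using A(1,4) by simp
    finally have "?\<phi> (Lm.lincomb a A) = to_fract (a v) * ?\<phi> v" unfolding Lm.lincomb_def .
    moreover have "?\<phi> (Lm.lincomb a A) = 0" unfolding A(3) module_vec_simps by (simp add: emb_zero)
    moreover have "?\<phi> v \<noteq> 0" using partner[OF k(1) k(1)] gram_opp_nonzero unfolding k(2) by simp
    ultimately show False using A(5) by simp
  qed
  moreover have "Lm.span (set bs) = \<Lambda>"
  proof
    show "Lm.span (set bs) \<subseteq> \<Lambda>" by (rule Lm.span_is_subset[OF set_bs sub])
    have bs_car: "set bs \<subseteq> carrier L" using set_bs car unfolding module_vec_simps by blast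
    let ?S = "Lm.span (set bs)"
    have Ssub: "submodule (class_ring :: 'a ring) ?S L" by (rule Lm.span_is_submodule[OF bs_car])
    have Scar: "?S \<subseteq> carrier_vec (2 * n)" using submodule.subset[OF Ssub] unfolding module_vec_simps .
    have embS: "submod (emb n ` ?S)" using Ssub unfolding submodule_iff_submod[OF Scar] .
    have "g ` \<Lambda>\<^sub>\<mu> \<subseteq> emb n ` ?S"
    proof
      fix x assume "x \<in> g ` \<Lambda>\<^sub>\<mu>"
      then obtain c where c: "\<And>j. c j \<in> range to_fract" "x = (\<Sum>j\<in>indices. fscale (c j) (b j))"
        unfolding image_lat[OF g(1)] b_def by blast
      show "x \<in> emb n ` ?S"
        unfolding c(2)
      proof (intro submod_sum[OF embS] submodD(4)[OF embS] c(1))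
        fix j assume j: "j \<in> indices"
        have "bs ! pos j \<in> set bs" using pos_less[OF j] len by simp
        then have "bs ! pos j \<in> ?S" using Lm.in_own_span[OF bs_car] by blast
        moreover have "b j = emb n (bs ! pos j)" using emb_nth[OF pos_less[OF j]] idx_pos[OF j] by simp
        ultimately show "b j \<in> emb n ` ?S" by blast
      qed
    qed
    then have "vec_of n ` g ` \<Lambda>\<^sub>\<mu> \<subseteq> vec_of n ` emb n ` ?S" by (rule image_mono)
    moreover have "vec_of n ` emb n ` ?S = ?S"
    proof -
      have "(\<lambda>v. vec_of n (emb n v)) ` ?S = (\<lambda>v. v) ` ?S"
        using Scar vec_of_emb by (intro image_cong) auto
      then show ?thesis by (simp add: image_image)
    qed
    ultimately show "\<Lambda> \<subseteq> ?S" unfolding \<Lambda>_def by simp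
  qed
  ultimately have "ordered_basis class_ring (L\<lparr>carrier := \<Lambda>\<rparr>) bs"
    unfolding ordered_basis_def using set_bs Lm.span_li_not_depend[OF set_bs sub] by simp
  then show "\<exists>bs. ordered_basis class_ring (L\<lparr>carrier := \<Lambda>\<rparr>) bs \<and> gram_mat n bs = J\<^sub>\<mu>" using gram by blast
qed

end

section \<open>The discriminant module\<close>

lemma (in ring_action) surjection_finsum:
  assumes L: "submodule_of s L" and \<theta>: "surjection s L M \<theta>" and zero: "\<zero>\<^bsub>M\<^esub> = \<theta> 0"
    and "finite A" "\<And>i. i \<in> A \<Longrightarrow> z i \<in> L"
  shows "(\<Oplus>\<^bsub>M\<^esub> i\<in>A. \<theta> (z i)) = \<theta> (\<Sum>i\<in>A. z i)"
proof -
  interpret module "class_ring :: 'a ring" M by (rule module_surjection[OF L \<theta> zero])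
  have mem: "\<theta> x \<in> carrier M" if "x \<in> L" for x using that surjectionD(1)[OF \<theta>] by blast
  have "(\<Oplus>\<^bsub>M\<^esub> i\<in>A. \<theta> (z i)) = \<theta> (\<Sum>i\<in>A. z i) \<and> (\<Sum>i\<in>A. z i) \<in> L"
    using assms(4,5)
  proof (induction A)
    case empty
    show ?case using zero submodule_ofD(1)[OF L] by simp
  next
    case (insert i A)
    then have IH: "(\<Oplus>\<^bsub>M\<^esub> i\<in>A. \<theta> (z i)) = \<theta> (\<Sum>i\<in>A. z i)" "(\<Sum>i\<in>A. z i) \<in> L" by simp_all
    have "(\<lambda>i. \<theta> (z i)) \<in> A \<rightarrow> carrier M" using insert.prems mem by blast
    then have "(\<Oplus>\<^bsub>M\<^esub> i\<in>insert i A. \<theta> (z i)) = \<theta> (z i) \<oplus>\<^bsub>M\<^esub> \<theta> (\<Sum>i\<in>A. z i)"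
      using insert.hyps insert.prems mem IH(1) by (simp add: finsum_insert)
    also have "\<dots> = \<theta> (\<Sum>i\<in>insert i A. z i)"
      using insert.hyps insert.prems IH(2) surjectionD(2)[OF \<theta>, of "z i" "\<Sum>i\<in>A. z i"] by simp
    finally show ?case using insert.hyps insert.prems IH(2) submodule_ofD(2)[OF L] by simp
  qed
  then show ?thesis by blast
qed

interpretation mult_action: ring_action "(*) :: 'a::comm_ring_1 \<Rightarrow> 'a \<Rightarrow> 'a"
  by unfold_locales (simp_all add: algebra_simps)

interpretation fmult_action: ring_action "\<lambda>(a::'a::idom) z. to_fract a * z"
  by unfold_locales (simp_all add: algebra_simps to_fract_add to_fract_mult)

lemma submodule_of_UNIV: "submodule_of s UNIV"
  unfolding submodule_of_def by simp

lemma surjection_regular: "surjection (*) UNIV (regular_module (class_ring :: 'a::comm_ring_1 ring)) id"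
  unfolding surjection_def regular_module_def by simp

lemma surjection_fract: "surjection (\<lambda>(a::'a::idom) z. to_fract a * z) UNIV fract_module id"
  unfolding surjection_def fract_module_def by simp

lemma submodule_PIdl:
  "submodule (class_ring :: 'a::idom ring) (PIdl\<^bsub>class_ring\<^esub> (p ^ k)) (regular_module class_ring)"
proof (rule submodule.intro)
  show "module class_ring (regular_module (class_ring :: 'a ring))"
    by (rule mult_action.module_surjection[OF submodule_of_UNIV surjection_regular])
      (simp add: regular_module_def)
qed (auto simp: PIdl_class_ring regular_module_def)

lemma submodule_range_to_fract: "submodule (class_ring :: 'a::idom ring) (range to_fract) fract_module"
proof (rule submodule.intro)
  show "module (class_ring :: 'a ring) fract_module"
    by (rule fmult_action.module_surjection[OF submodule_of_UNIV surjection_fract])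
      (simp add: fract_module_def)
  show "\<zero>\<^bsub>fract_module\<^esub> \<in> range to_fract" unfolding fract_module_def using to_fract_0 by (metis module.simps(2) rangeI ring_record_simps(11))
qed (auto simp: fract_module_def simp flip: to_fract_add to_fract_mult)

definition cyc :: "'a::idom \<Rightarrow> nat \<Rightarrow> 'a \<Rightarrow> 'a set" where
  "cyc p k a = PIdl\<^bsub>class_ring\<^esub> (p ^ k) +>\<^bsub>regular_module class_ring\<^esub> a"

lemma surjection_cyc: "surjection (*) UNIV (cyclic_module p k) (cyc p k)"
proof -
  have "surjection (*) UNIV (cyclic_module p k)
      (\<lambda>x. PIdl\<^bsub>class_ring\<^esub> (p ^ k) +>\<^bsub>regular_module class_ring\<^esub> id x)"
    unfolding cyclic_module_def
    by (rule mult_action.surjection_quot(1)[OF submodule_of_UNIV surjection_regular _ submodule_PIdl])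
      (simp add: regular_module_def)
  then show ?thesis unfolding cyc_def id_def .
qed

lemma cyc_eq_iff: "cyc p k a = cyc p k b \<longleftrightarrow> p ^ k dvd a - b" for p :: "'a::idom"
proof -
  have "\<zero>\<^bsub>regular_module (class_ring :: 'a ring)\<^esub> = id 0" by (simp add: regular_module_def)
  from mult_action.surjection_quot(2)[OF submodule_of_UNIV surjection_regular this submodule_PIdl, of a b p k]
  show ?thesis unfolding cyc_def PIdl_class_ring by simp
qed

lemma cyclic_module_simps:
  "carrier (cyclic_module p k) = range (cyc p k)"
  "cyc p k a \<oplus>\<^bsub>cyclic_module p k\<^esub> cyc p k b = cyc p k (a + b)"
  "c \<odot>\<^bsub>cyclic_module p k\<^esub> cyc p k a = cyc p k (c * a)"
  "\<zero>\<^bsub>cyclic_module p k\<^esub> = cyc p k 0"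
proof -
  show "carrier (cyclic_module p k) = range (cyc p k)"
    "cyc p k a \<oplus>\<^bsub>cyclic_module p k\<^esub> cyc p k b = cyc p k (a + b)"
    "c \<odot>\<^bsub>cyclic_module p k\<^esub> cyc p k a = cyc p k (c * a)"
    using surjectionD[OF surjection_cyc[of p k]] by simp_all
  show "\<zero>\<^bsub>cyclic_module p k\<^esub> = cyc p k 0"
    using quot_module_coset(5)[OF submodule_PIdl, of p k]
    unfolding cyclic_module_def cyc_def by (simp add: regular_module_def)
qed

definition fcoset :: "'a::idom fract \<Rightarrow> 'a fract set" where
  "fcoset z = range to_fract +>\<^bsub>fract_module\<^esub> z"

lemma surjection_fcoset: "surjection (\<lambda>(a::'a::idom) z. to_fract a * z) UNIV fract_mod_ring fcoset"
proof -
  have "surjection (\<lambda>(a::'a) z. to_fract a * z) UNIV fract_mod_ring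
      (\<lambda>x. range to_fract +>\<^bsub>fract_module\<^esub> id x)"
    unfolding fract_mod_ring_def
    by (rule fmult_action.surjection_quot(1)[OF submodule_of_UNIV surjection_fract _ submodule_range_to_fract])
      (simp add: fract_module_def)
  then show ?thesis unfolding fcoset_def id_def .
qed

lemma fract_mod_ring_zero: "\<zero>\<^bsub>fract_mod_ring\<^esub> = fcoset (0 :: 'a::idom fract)"
  using quot_module_coset(5)[OF submodule_range_to_fract]
  unfolding fract_mod_ring_def fcoset_def by (simp add: fract_module_def)

lemma fcoset_eq_zero_iff: "fcoset z = \<zero>\<^bsub>fract_mod_ring\<^esub> \<longleftrightarrow> z \<in> range to_fract" for z :: "'a::idom fract"
proof -
  have "\<zero>\<^bsub>fract_module\<^esub> = id (0 :: 'a fract)" by (simp add: fract_module_def)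
  from fmult_action.surjection_quot(2)[OF submodule_of_UNIV surjection_fract this submodule_range_to_fract, of z 0]
  show ?thesis unfolding fract_mod_ring_zero fcoset_def by simp
qed

lemma fcoset_sum:
  "finite A \<Longrightarrow> (\<Oplus>\<^bsub>fract_mod_ring\<^esub> i\<in>A. fcoset (z i)) = fcoset (\<Sum>i\<in>A. z i)"
  by (rule fmult_action.surjection_finsum[OF submodule_of_UNIV surjection_fcoset fract_mod_ring_zero]) auto

context dvr_symplectic
begin

lemma p_nonzero: "p \<noteq> 0" by (rule compact_dvr_uniformizer(1)[OF dvr])

lemma P_iff_dvd:
  assumes "z \<in> range to_fract"
  shows "z \<in> \<P> k \<longleftrightarrow> p ^ k dvd numer z"
proof -
  have "z \<in> \<P> k \<longleftrightarrow> (\<exists>y. to_fract (numer z) = to_fract (p ^ k * y))"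
    unfolding \<P>_def image_iff to_fract_numer[OF assms] by (auto simp: to_fract_mult to_fract_power)
  then show ?thesis unfolding dvd_def by (simp only: to_fract_eq_iff)
qed

lemma numer_add: "x \<in> range to_fract \<Longrightarrow> y \<in> range to_fract \<Longrightarrow> numer (x + y) = numer x + numer y"
  by (auto simp flip: to_fract_add)

lemma numer_diff: "x \<in> range to_fract \<Longrightarrow> y \<in> range to_fract \<Longrightarrow> numer (x - y) = numer x - numer y"
  by (auto simp flip: to_fract_diff)

lemma numer_smult: "x \<in> range to_fract \<Longrightarrow> numer (to_fract a * x) = a * numer x"
  by (auto simp flip: to_fract_mult)

abbreviation D :: "(nat \<Rightarrow> 'a fract) set" where "D \<equiv> dual \<Lambda>\<^sub>\<mu>"

abbreviation M :: "('a, nat \<Rightarrow> 'a set \<times> 'a set) module" where "M \<equiv> symp_module p mu"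

definition eco :: "(nat \<Rightarrow> 'a fract) \<Rightarrow> nat \<Rightarrow> 'a" where
  "eco x i = numer (x i)"

definition fco :: "(nat \<Rightarrow> 'a fract) \<Rightarrow> nat \<Rightarrow> 'a" where
  "fco x i = numer (to_fract (p ^ (mu ! i)) * x (n + i))"

text \<open>The isomorphism of \<open>D / \<Lambda>\<^sub>\<mu>\<close> with \<open>M\<close>: the classes of \<open>E i\<close> and \<open>\<pi>\<^bsup>-\<mu> i\<^esup> F i\<close> go to the generators \<open>e\<close>
  and \<open>f\<close> of the summand \<open>i\<close>, whose coefficients are given by \<open>eco\<close> and \<open>fco\<close>.\<close>

definition \<Phi> :: "(nat \<Rightarrow> 'a fract) \<Rightarrow> nat \<Rightarrow> 'a set \<times> 'a set" where
  "\<Phi> x = (\<lambda>i\<in>{..<n}. (cyc p (mu ! i) (eco x i), cyc p (mu ! i) (fco x i)))"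

lemma D_iff:
  "x \<in> D \<longleftrightarrow> x \<in> std_space n \<and>
     (\<forall>i<n. x i \<in> range to_fract \<and> to_fract (p ^ (mu ! i)) * x (n + i) \<in> range to_fract)"
proof -
  have "(\<forall>j\<in>indices. to_fract p ^ wt ((!) mu) (opp j) * coord x j \<in> range to_fract) \<longleftrightarrow>
      (\<forall>i<n. x i \<in> range to_fract \<and> to_fract (p ^ (mu ! i)) * x (n + i) \<in> range to_fract)"
  proof (intro iffI ballI allI impI conjI)
    fix i assume *: "\<forall>j\<in>indices. to_fract p ^ wt ((!) mu) (opp j) * coord x j \<in> range to_fract" "i < n"
    have ind: "(i, t) \<in> indices" for t using *(2) by simp
    show "x i \<in> range to_fract"
      using bspec[OF *(1) ind, of False] *(2) by (simp add: coord_std wt_def opp_def)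
    show "to_fract (p ^ (mu ! i)) * x (n + i) \<in> range to_fract"
      using bspec[OF *(1) ind, of True] *(2) by (simp add: coord_std wt_def opp_def to_fract_power)
  next
    fix j assume *: "\<forall>i<n. x i \<in> range to_fract \<and> to_fract (p ^ (mu ! i)) * x (n + i) \<in> range to_fract"
      "j \<in> indices"
    then obtain i t where j: "j = (i, t)" "i < n" by blast
    show "to_fract p ^ wt ((!) mu) (opp j) * coord x j \<in> range to_fract"
      using *(1) j(2) unfolding j(1) by (cases t) (auto simp: coord_std wt_def opp_def to_fract_power)
  qed
  then show ?thesis unfolding dual_lat_iff by blast
qed

lemma D_coords:
  assumes "x \<in> D" "i < n"
  shows "to_fract (eco x i) = x i" "to_fract (fco x i) = to_fract (p ^ (mu ! i)) * x (n + i)"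
  using assms unfolding D_iff eco_def fco_def by (simp_all add: to_fract_numer)

lemma eco_fco_add:
  assumes "x \<in> D" "y \<in> D" "i < n"
  shows "eco (x + y) i = eco x i + eco y i" "fco (x + y) i = fco x i + fco y i"
proof -
  have r: "x i \<in> range to_fract" "y i \<in> range to_fract"
    "to_fract (p ^ (mu ! i)) * x (n + i) \<in> range to_fract" "to_fract (p ^ (mu ! i)) * y (n + i) \<in> range to_fract"
    using assms unfolding D_iff by blast+
  show "eco (x + y) i = eco x i + eco y i" unfolding eco_def plus_fun_apply by (rule numer_add[OF r(1,2)])
  show "fco (x + y) i = fco x i + fco y i"
    unfolding fco_def plus_fun_apply distrib_left by (rule numer_add[OF r(3,4)])
qed

lemma eco_fco_smul:
  assumes "x \<in> D" "i < n"
  shows "eco (smul a x) i = a * eco x i" "fco (smul a x) i = a * fco x i"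
proof -
  have r: "x i \<in> range to_fract" "to_fract (p ^ (mu ! i)) * x (n + i) \<in> range to_fract"
    using assms unfolding D_iff by blast+
  show "eco (smul a x) i = a * eco x i" unfolding eco_def fscale_def by (rule numer_smult[OF r(1)])
  show "fco (smul a x) i = a * fco x i"
    unfolding fco_def fscale_def mult.left_commute[of _ "to_fract a"] by (rule numer_smult[OF r(2)])
qed

lemma M_simps:
  "carrier M = (\<Pi>\<^sub>E i\<in>{..<n}. range (cyc p (mu ! i)) \<times> range (cyc p (mu ! i)))"
  "X \<oplus>\<^bsub>M\<^esub> Z = (\<lambda>i\<in>{..<n}. (fst (X i) \<oplus>\<^bsub>cyclic_module p (mu ! i)\<^esub> fst (Z i), snd (X i) \<oplus>\<^bsub>cyclic_module p (mu ! i)\<^esub> snd (Z i)))"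
  "a \<odot>\<^bsub>M\<^esub> X = (\<lambda>i\<in>{..<n}. (a \<odot>\<^bsub>cyclic_module p (mu ! i)\<^esub> fst (X i), a \<odot>\<^bsub>cyclic_module p (mu ! i)\<^esub> snd (X i)))"
  "\<zero>\<^bsub>M\<^esub> = (\<lambda>i\<in>{..<n}. (cyc p (mu ! i) 0, cyc p (mu ! i) 0))"
  unfolding symp_module_def dsum_module_def hyp_module_def direct_sum_def length_mu
  by (simp_all add: cyclic_module_simps)

lemma \<Phi>_onto:
  assumes "X \<in> carrier M"
  shows "\<exists>x\<in>D. X = \<Phi> x"
proof -
  have "\<forall>i. \<exists>a b. i < n \<longrightarrow> X i = (cyc p (mu ! i) a, cyc p (mu ! i) b)"
  proof
    fix i
    show "\<exists>a b. i < n \<longrightarrow> X i = (cyc p (mu ! i) a, cyc p (mu ! i) b)"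
    proof (cases "i < n")
      case True
      then have "X i \<in> range (cyc p (mu ! i)) \<times> range (cyc p (mu ! i))"
        using PiE_mem[of X "{..<n}"] assms unfolding M_simps(1) by blast
      then show ?thesis by blast
    qed simp
  qed
  then obtain a b where ab: "\<And>i. i < n \<Longrightarrow> X i = (cyc p (mu ! i) (a i), cyc p (mu ! i) (b i))" by metis
  define x where "x k = (if k < n then to_fract (a k)
    else if k < 2 * n then to_fract (b (k - n)) / to_fract (p ^ (mu ! (k - n))) else 0)" for k
  have xe: "x i = to_fract (a i)" and xf: "to_fract (p ^ (mu ! i)) * x (n + i) = to_fract (b i)" if "i < n" for i
    using that p_nonzero unfolding x_def by simp_all
  have "x \<in> D"
    unfolding D_iff using xe xf by (simp add: std_space_def) (simp add: x_def)
  moreover have "X = \<Phi> x"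
  proof
    fix i
    show "X i = \<Phi> x i"
    proof (cases "i < n")
      case True
      then show ?thesis unfolding \<Phi>_def eco_def fco_def by (simp add: ab xe xf)
    next
      case False
      then show ?thesis unfolding \<Phi>_def using assms PiE_arb[of X "{..<n}"] unfolding M_simps(1) by simp
    qed
  qed
  ultimately show ?thesis by blast
qed

lemma surjection_\<Phi>: "surjection smul D M \<Phi>"
  unfolding surjection_def
proof (intro conjI ballI allI)
  show "\<Phi> ` D = carrier M"
  proof (intro equalityI subsetI)
    fix X assume "X \<in> \<Phi> ` D"
    then show "X \<in> carrier M" unfolding M_simps(1) \<Phi>_def by (auto split: if_splits)
  next
    fix X assume "X \<in> carrier M"
    then show "X \<in> \<Phi> ` D" using \<Phi>_onto by blast
  qed
  fix x assume x: "x \<in> D"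
  show "\<Phi> (smul a x) = a \<odot>\<^bsub>M\<^esub> \<Phi> x" for a
    unfolding M_simps(3) \<Phi>_def
    by (rule restrict_ext) (simp add: cyclic_module_simps eco_fco_smul[OF x])
  fix y assume y: "y \<in> D"
  show "\<Phi> (x + y) = \<Phi> x \<oplus>\<^bsub>M\<^esub> \<Phi> y"
    unfolding M_simps(2) \<Phi>_def
    by (rule restrict_ext) (simp add: cyclic_module_simps eco_fco_add[OF x y])
qed

lemma \<Phi>_zero: "\<zero>\<^bsub>M\<^esub> = \<Phi> 0"
proof -
  have "numer (0 :: 'a fract) = 0" using numer_to_fract[of 0] by simp
  then show ?thesis unfolding M_simps(4) \<Phi>_def eco_def fco_def by (simp add: restrict_def)
qed

lemma \<Phi>_eq_iff:
  assumes x: "x \<in> D" and y: "y \<in> D"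
  shows "\<Phi> x = \<Phi> y \<longleftrightarrow> x - y \<in> \<Lambda>\<^sub>\<mu>"
proof -
  have "\<Phi> x = \<Phi> y \<longleftrightarrow> (\<forall>i<n. \<Phi> x i = \<Phi> y i)"
    unfolding \<Phi>_def by (auto simp: restrict_def fun_eq_iff)
  also have "\<dots> \<longleftrightarrow> (\<forall>i<n. p ^ (mu ! i) dvd eco x i - eco y i \<and> p ^ (mu ! i) dvd fco x i - fco y i)"
    unfolding \<Phi>_def by (simp add: cyc_eq_iff)
  also have "\<dots> \<longleftrightarrow> (\<forall>i<n. x i - y i \<in> \<P> (mu ! i) \<and> x (n + i) - y (n + i) \<in> \<P> 0)"
  proof (intro all_cong)
    fix i assume i: "i < n"
    have r: "x i \<in> range to_fract" "y i \<in> range to_fract"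
      "to_fract (p ^ (mu ! i)) * x (n + i) \<in> range to_fract" "to_fract (p ^ (mu ! i)) * y (n + i) \<in> range to_fract"
      using x y i unfolding D_iff by blast+
    have "x i - y i \<in> \<P> (mu ! i) \<longleftrightarrow> p ^ (mu ! i) dvd eco x i - eco y i"
      unfolding eco_def numer_diff[OF r(1,2), symmetric] by (rule P_iff_dvd[OF diff_in[OF r(1,2)]])
    moreover have "x (n + i) - y (n + i) \<in> \<P> 0 \<longleftrightarrow>
        to_fract (p ^ (mu ! i)) * x (n + i) - to_fract (p ^ (mu ! i)) * y (n + i) \<in> \<P> (mu ! i)"
      using P_pi_power[of "mu ! i" "x (n + i) - y (n + i)" 0]
      by (simp add: to_fract_power right_diff_distrib)
    moreover have "\<dots> \<longleftrightarrow> p ^ (mu ! i) dvd fco x i - fco y i"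
      unfolding fco_def numer_diff[OF r(3,4), symmetric] by (rule P_iff_dvd[OF diff_in[OF r(3,4)]])
    ultimately show "(p ^ (mu ! i) dvd eco x i - eco y i \<and> p ^ (mu ! i) dvd fco x i - fco y i) \<longleftrightarrow>
        (x i - y i \<in> \<P> (mu ! i) \<and> x (n + i) - y (n + i) \<in> \<P> 0)" by blast
  qed
  also have "\<dots> \<longleftrightarrow> x - y \<in> \<Lambda>\<^sub>\<mu>"
  proof -
    have V: "x - y \<in> std_space n" using submod_diff[OF submod_dual x y] unfolding D_iff by blast
    have "(\<forall>j\<in>indices. coord (x - y) j \<in> \<P> (wt ((!) mu) j)) \<longleftrightarrow>
        (\<forall>i<n. x i - y i \<in> \<P> (mu ! i) \<and> x (n + i) - y (n + i) \<in> \<P> 0)"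
    proof (intro iffI ballI allI impI conjI)
      fix i assume *: "\<forall>j\<in>indices. coord (x - y) j \<in> \<P> (wt ((!) mu) j)" "i < n"
      have ind: "(i, t) \<in> indices" for t using *(2) by simp
      show "x i - y i \<in> \<P> (mu ! i)" using bspec[OF *(1) ind, of False] *(2) by (simp add: coord_std wt_def)
      show "x (n + i) - y (n + i) \<in> \<P> 0" using bspec[OF *(1) ind, of True] *(2) by (simp add: coord_std wt_def)
    next
      fix j assume *: "\<forall>i<n. x i - y i \<in> \<P> (mu ! i) \<and> x (n + i) - y (n + i) \<in> \<P> 0" "j \<in> indices"
      then obtain i t where j: "j = (i, t)" "i < n" by blast
      show "coord (x - y) j \<in> \<P> (wt ((!) mu) j)"
        using *(1) j(2) unfolding j(1) by (cases t) (auto simp: coord_std wt_def)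
    qed
    then show ?thesis unfolding lat_iff using V by blast
  qed
  finally show ?thesis .
qed

lemma symp_pairing_\<Phi>:
  assumes x: "x \<in> D" and y: "y \<in> D"
  shows "symp_pairing p mu (\<Phi> x) (\<Phi> y) = fcoset (std_form n x y)"
proof -
  have hyp: "hyp_pairing p (mu ! i) (\<Phi> x i) (\<Phi> y i) = fcoset (x i * y (n + i) - x (n + i) * y i)"
    if i: "i < n" for i
  proof -
    let ?k = "to_fract (p ^ (mu ! i))"
    have nz: "?k \<noteq> 0" using p_nonzero by simp
    have "hyp_pairing p (mu ! i) (\<Phi> x i) (\<Phi> y i) =
        fcoset (to_fract (eco x i * fco y i - fco x i * eco y i) / ?k)"
      unfolding \<Phi>_def fcoset_def cyc_def using i hyp_pairing_coset[OF p_nonzero] by simp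
    also have "to_fract (eco x i * fco y i - fco x i * eco y i) / ?k = x i * y (n + i) - x (n + i) * y i"
      unfolding to_fract_diff to_fract_mult D_coords[OF x i] D_coords[OF y i]
      unfolding nonzero_divide_eq_eq[OF nz] by (simp only: algebra_simps)
    finally show ?thesis .
  qed
  have "symp_pairing p mu (\<Phi> x) (\<Phi> y) =
      (\<Oplus>\<^bsub>fract_mod_ring\<^esub> i\<in>{..<n}. hyp_pairing p (mu ! i) (\<Phi> x i) (\<Phi> y i))"
    unfolding symp_pairing_def length_mu ..
  also have "\<dots> = (\<Oplus>\<^bsub>fract_mod_ring\<^esub> i\<in>{..<n}. fcoset (x i * y (n + i) - x (n + i) * y i))"
  proof -
    interpret F: module "class_ring :: 'a ring" "fract_mod_ring :: ('a, 'a fract set) module"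
      by (rule fmult_action.module_surjection[OF submodule_of_UNIV surjection_fcoset fract_mod_ring_zero])
    have "fcoset z \<in> carrier fract_mod_ring" for z :: "'a fract"
      using surjectionD(1)[OF surjection_fcoset] by blast
    then show ?thesis using hyp by (intro F.finsum_cong') auto
  qed
  also have "\<dots> = fcoset (std_form n x y)" unfolding std_form_def by (rule fcoset_sum) simp
  finally show ?thesis .
qed

lemma perp_\<Phi>:
  assumes "X \<subseteq> D"
  shows "perp p mu (\<Phi> ` X) = \<Phi> ` {x \<in> D. \<forall>y\<in>X. std_form n x y \<in> range to_fract}"
proof -
  have iff: "(\<forall>Y\<in>\<Phi> ` X. symp_pairing p mu (\<Phi> x) Y = \<zero>\<^bsub>fract_mod_ring\<^esub>) \<longleftrightarrow>
      (\<forall>y\<in>X. std_form n x y \<in> range to_fract)" if x: "x \<in> D" for x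
    using assms by (auto simp: symp_pairing_\<Phi>[OF x] fcoset_eq_zero_iff subset_iff)
  show ?thesis
    unfolding perp_def surjectionD(1)[OF surjection_\<Phi>, symmetric] using iff by blast
qed

end

section \<open>Lagrangians and self-dual lattices\<close>

lemma module_isomorphic_finite:
  assumes "module_isomorphic R M N" "finite (carrier N)"
  shows "finite (carrier M)"
  using assms bij_betw_finite unfolding module_isomorphic_def by blast

context dvr_symplectic
begin

lemma finite_cyclic_module: "finite (carrier (cyclic_module p k))"
proof -
  obtain T where T: "finite T" "T \<subseteq> range to_fract" "\<And>x. x \<in> range to_fract \<Longrightarrow> \<exists>t\<in>T. x - t \<in> \<P> k"
    using finite_residues_power[of k] by blast
  have "range (cyc p k) \<subseteq> (\<lambda>t. cyc p k (numer t)) ` T"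
  proof
    fix X assume "X \<in> range (cyc p k)"
    then obtain a where a: "X = cyc p k a" by blast
    obtain t where t: "t \<in> T" "to_fract a - t \<in> \<P> k" using T(3)[OF rangeI] by blast
    obtain b where b: "t = to_fract b" using t(1) T(2) by blast
    have "numer (to_fract a - to_fract b) = a - b" using numer_to_fract[of "a - b"] by simp
    moreover have "to_fract a - to_fract b \<in> range to_fract" by (rule diff_in[OF rangeI rangeI])
    ultimately have "p ^ k dvd a - b" using P_iff_dvd t(2) unfolding b by metis
    then have "X = cyc p k (numer t)" unfolding a b by (simp add: cyc_eq_iff)
    then show "X \<in> (\<lambda>t. cyc p k (numer t)) ` T" using t(1) by blast
  qed
  then show ?thesis unfolding cyclic_module_simps(1) using T(1) by (blast intro: finite_subset)
qed

text \<open>This gives the finite index required of the sublattices that are counted.\<close>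

lemma finite_torsion_module: "finite (carrier (torsion_module p lam))"
  unfolding torsion_module_def dsum_module_def using finite_cyclic_module by (simp add: finite_PiE)

lemma module_M: "module (class_ring :: 'a ring) M"
  by (rule fract_action.module_surjection[OF submodule_of_submod[OF submod_dual] surjection_\<Phi> \<Phi>_zero])

lemma submodule_\<Phi>:
  assumes X: "submod X" "X \<subseteq> D"
  shows "submodule (class_ring :: 'a ring) (\<Phi> ` X) M"
proof (rule submodule.intro[OF module_M])
  note \<Phi> = surjectionD[OF surjection_\<Phi>]
  show "\<Phi> ` X \<subseteq> carrier M" using \<Phi>(1) X(2) by blast
  show "\<zero>\<^bsub>M\<^esub> \<in> \<Phi> ` X" unfolding \<Phi>_zero using submodD(2)[OF X(1)] by (rule imageI)
  show "U \<oplus>\<^bsub>M\<^esub> W \<in> \<Phi> ` X" if "U \<in> \<Phi> ` X" "W \<in> \<Phi> ` X" for U W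
  proof -
    obtain x y where xy: "x \<in> X" "U = \<Phi> x" "y \<in> X" "W = \<Phi> y" using \<open>U \<in> _\<close> \<open>W \<in> _\<close> by blast
    then have "U \<oplus>\<^bsub>M\<^esub> W = \<Phi> (x + y)" using \<Phi>(2)[of x y] X(2) by (simp add: subset_iff)
    then show ?thesis using submodD(3)[OF X(1) xy(1,3)] by blast
  qed
  show "a \<odot>\<^bsub>M\<^esub> U \<in> \<Phi> ` X" if "U \<in> \<Phi> ` X" for a U
  proof -
    obtain x where x: "x \<in> X" "U = \<Phi> x" using \<open>U \<in> _\<close> by blast
    then have "a \<odot>\<^bsub>M\<^esub> U = \<Phi> (smul a x)" using \<Phi>(3)[of x a] X(2) by (simp add: subset_iff)
    then show ?thesis using submodD(4)[OF X(1) rangeI x(1)] by blast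
  qed
qed

definition preimage :: "(nat \<Rightarrow> 'a set \<times> 'a set) set \<Rightarrow> (nat \<Rightarrow> 'a fract) set" where
  "preimage N = {x \<in> D. \<Phi> x \<in> N}"

lemma preimage_image:
  assumes X: "submod X" "\<Lambda>\<^sub>\<mu> \<subseteq> X" "X \<subseteq> D"
  shows "preimage (\<Phi> ` X) = X"
proof (intro equalityI subsetI)
  fix x assume "x \<in> X"
  then show "x \<in> preimage (\<Phi> ` X)" using X(3) unfolding preimage_def by blast
next
  fix x assume "x \<in> preimage (\<Phi> ` X)"
  then obtain y where y: "x \<in> D" "y \<in> X" "\<Phi> x = \<Phi> y" unfolding preimage_def by blast
  then have "x - y \<in> X" using \<Phi>_eq_iff[of x y] X(2,3) by blast
  then show "x \<in> X" using submodD(3)[OF X(1) _ y(2), of "x - y"] by simp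
qed

lemma image_preimage: "N \<subseteq> carrier M \<Longrightarrow> \<Phi> ` preimage N = N"
  unfolding preimage_def surjectionD(1)[OF surjection_\<Phi>, symmetric] by blast

lemma submod_preimage:
  assumes "submodule (class_ring :: 'a ring) N M"
  shows "submod (preimage N)" "\<Lambda>\<^sub>\<mu> \<subseteq> preimage N"
proof -
  interpret N: submodule "class_ring :: 'a ring" N M by (rule assms)
  note \<Phi> = surjectionD[OF surjection_\<Phi>] and D = submodD[OF submod_dual]
  show "submod (preimage N)"
    unfolding submod_def
  proof (intro conjI ballI)
    show "preimage N \<subseteq> std_space n" unfolding preimage_def dual_def by blast
    show "0 \<in> preimage N" unfolding preimage_def using D(2) N.zero_closed \<Phi>_zero by simp
    show "x + y \<in> preimage N" if "x \<in> preimage N" "y \<in> preimage N" for x y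
      using \<open>x \<in> _\<close> \<open>y \<in> _\<close> D(3) \<Phi>(2) N.m_closed unfolding preimage_def by auto
    show "fscale a x \<in> preimage N" if "a \<in> range to_fract" "x \<in> preimage N" for a x
    proof -
      obtain b where b: "a = to_fract b" using \<open>a \<in> _\<close> by blast
      have x: "x \<in> D" "\<Phi> x \<in> N" using \<open>x \<in> _\<close> unfolding preimage_def by blast+
      have "\<Phi> (smul b x) \<in> N" unfolding \<Phi>(3)[OF x(1)] using N.smult_closed x(2) by simp
      then show ?thesis using D(4)[OF rangeI x(1)] unfolding preimage_def b by blast
    qed
  qed
  show "\<Lambda>\<^sub>\<mu> \<subseteq> preimage N"
  proof
    fix x assume x: "x \<in> \<Lambda>\<^sub>\<mu>"
    then have "x \<in> D" using lat_subset_dual by blast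
    moreover have "\<Phi> x = \<Phi> 0" using \<Phi>_eq_iff[OF \<open>x \<in> D\<close> D(2)] x by simp
    ultimately show "x \<in> preimage N" using N.zero_closed \<Phi>_zero unfolding preimage_def by simp
  qed
qed

text \<open>Since \<open>\<Phi>\<close> turns the form modulo integral elements into the pairing, \<open>N = N\<^sup>\<bottom>\<close> means that the preimage
  of \<open>N\<close> is a self-dual lattice.\<close>

lemma lagrangian_imp_orbit:
  assumes "lagrangian p mu N"
  shows "\<exists>g\<in>G. g ` L0 = preimage N"
proof (rule self_dual_orbit)
  have sub: "submodule class_ring N M" and perp: "perp p mu N = N"
    using assms unfolding lagrangian_def by auto
  let ?X = "preimage N"
  note X = submod_preimage[OF sub]
  have XD: "?X \<subseteq> D" unfolding preimage_def by blast
  show "submod ?X" by (rule X(1))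
  show "absorbs ?X L0"
    unfolding absorbs_def
  proof (intro exI ballI)
    let ?N = "\<Sum>i<n. mu ! i"
    show "fscale (to_fract p ^ ?N) v \<in> L0" if "v \<in> ?X" for v
      using \<open>v \<in> ?X\<close> XD dual_absorbs lat_subset_L0 by blast
  qed
  fix x :: "nat \<Rightarrow> 'a fract" assume x: "x \<in> std_space n"
  have iff: "x \<in> ?X \<longleftrightarrow> (\<forall>y\<in>?X. std_form n x y \<in> range to_fract)" if xD: "x \<in> D"
  proof -
    have "x \<in> ?X \<longleftrightarrow> \<Phi> x \<in> N" using xD unfolding preimage_def by blast
    also have "\<dots> \<longleftrightarrow> \<Phi> x \<in> perp p mu (\<Phi> ` ?X)"
      using image_preimage[OF submodule.subset[OF sub]] perp by simp
    also have "\<dots> \<longleftrightarrow> (\<forall>y\<in>?X. symp_pairing p mu (\<Phi> x) (\<Phi> y) = \<zero>\<^bsub>fract_mod_ring\<^esub>)"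
      unfolding perp_def using surjectionD(1)[OF surjection_\<Phi>] xD by blast
    also have "\<dots> \<longleftrightarrow> (\<forall>y\<in>?X. std_form n x y \<in> range to_fract)"
      using XD by (auto simp: symp_pairing_\<Phi>[OF xD] fcoset_eq_zero_iff subset_iff)
    finally show ?thesis .
  qed
  show "x \<in> ?X \<longleftrightarrow> (\<forall>y\<in>?X. std_form n x y \<in> range to_fract)"
  proof (cases "x \<in> D")
    case False
    then have "\<exists>y\<in>\<Lambda>\<^sub>\<mu>. std_form n x y \<notin> range to_fract" using x unfolding dual_def by blast
    then show ?thesis using False XD X(2) by blast
  qed (rule iff)
qed

lemma orbit_imp_lagrangian:
  assumes g: "g \<in> G" "\<Lambda>\<^sub>\<mu> \<subseteq> g ` L0"
  shows "lagrangian p mu (\<Phi> ` g ` L0)"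
proof -
  let ?X = "g ` L0"
  have X: "submod ?X" "?X \<subseteq> D" by (rule submod_image[OF g(1) submod_lat], rule orbit_above_dual[OF g])
  have "{x \<in> D. \<forall>y\<in>?X. std_form n x y \<in> range to_fract} = ?X"
  proof (intro equalityI subsetI)
    fix x assume x: "x \<in> {x \<in> D. \<forall>y\<in>?X. std_form n x y \<in> range to_fract}"
    then have "x \<in> std_space n" unfolding dual_def by blast
    then show "x \<in> ?X" using orbit_self_dual[OF g(1), of x] x by blast
  next
    fix x assume x: "x \<in> ?X"
    then have "x \<in> std_space n" using X(2) unfolding dual_def by blast
    then show "x \<in> {x \<in> D. \<forall>y\<in>?X. std_form n x y \<in> range to_fract}"
      using orbit_self_dual[OF g(1), of x] x X(2) by blast
  qed
  then show ?thesis unfolding lagrangian_def using submodule_\<Phi>[OF X] perp_\<Phi>[OF X(2)] by simp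
qed

lemma sub_isomorphic_iff:
  assumes X: "submod X" "X \<subseteq> D"
  shows "module_isomorphic class_ring (M\<lparr>carrier := \<Phi> ` X\<rparr>) T \<longleftrightarrow> has_quotient smul T X \<Lambda>\<^sub>\<mu>"
proof (rule fract_action.isomorphic_iff_has_quotient[OF submodule_of_submod[OF X(1)], where \<theta> = \<Phi>])
  show "surjection smul X (M\<lparr>carrier := \<Phi> ` X\<rparr>) \<Phi>"
    using surjectionD[OF surjection_\<Phi>] X(2) unfolding surjection_def by (simp add: subset_iff)
  show "\<Phi> x = \<Phi> y \<longleftrightarrow> x - y \<in> \<Lambda>\<^sub>\<mu>" if "x \<in> X" "y \<in> X" for x y
    using \<Phi>_eq_iff X(2) \<open>x \<in> X\<close> \<open>y \<in> X\<close> by blast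
qed

section \<open>The two counts as orbit counts\<close>

definition has_quotient_of_type :: "nat list \<Rightarrow> (nat \<Rightarrow> 'a fract) set \<Rightarrow> (nat \<Rightarrow> 'a fract) set \<Rightarrow> bool" where
  "has_quotient_of_type lam X \<Lambda> \<longleftrightarrow> \<Lambda> \<subseteq> X \<and> has_quotient smul (torsion_module p lam) X \<Lambda>"

lemma lagrangian_count_orbit:
  "lagrangian_count p lam mu = card {g ` L0 |g. g \<in> G \<and> has_quotient_of_type lam (g ` L0) \<Lambda>\<^sub>\<mu>}"
proof -
  let ?S = "{N. lagrangian p mu N \<and> module_isomorphic class_ring (M\<lparr>carrier := N\<rparr>) (torsion_module p lam)}"
  let ?X = "{g ` L0 |g. g \<in> G \<and> has_quotient_of_type lam (g ` L0) \<Lambda>\<^sub>\<mu>}"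
  have "bij_betw preimage ?S ?X"
  proof (rule bij_betw_byWitness[where f' = "\<lambda>X. \<Phi> ` X"])
    show "\<forall>N\<in>?S. \<Phi> ` preimage N = N"
    proof
      fix N assume "N \<in> ?S"
      then have "submodule class_ring N M" unfolding lagrangian_def by blast
      then show "\<Phi> ` preimage N = N" by (rule image_preimage[OF submodule.subset])
    qed
    have X: "submod X" "\<Lambda>\<^sub>\<mu> \<subseteq> X" "X \<subseteq> D" "has_quotient smul (torsion_module p lam) X \<Lambda>\<^sub>\<mu>"
      "lagrangian p mu (\<Phi> ` X)" if "X \<in> ?X" for X
    proof -
      obtain g where g: "g \<in> G" "X = g ` L0" and R: "has_quotient_of_type lam X \<Lambda>\<^sub>\<mu>" using \<open>X \<in> ?X\<close> by blast
      show "\<Lambda>\<^sub>\<mu> \<subseteq> X" "has_quotient smul (torsion_module p lam) X \<Lambda>\<^sub>\<mu>"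
        using R unfolding has_quotient_of_type_def by blast+
      then have le: "\<Lambda>\<^sub>\<mu> \<subseteq> g ` L0" unfolding g(2) by blast
      show "submod X" "X \<subseteq> D" "lagrangian p mu (\<Phi> ` X)"
        unfolding g(2)
        by (rule submod_image[OF g(1) submod_lat], rule orbit_above_dual[OF g(1) le],
            rule orbit_imp_lagrangian[OF g(1) le])
    qed
    show "\<forall>X\<in>?X. preimage (\<Phi> ` X) = X"
    proof
      fix X assume "X \<in> ?X"
      then show "preimage (\<Phi> ` X) = X" by (intro preimage_image X(1-3))
    qed
    show "(`) \<Phi> ` ?X \<subseteq> ?S"
    proof (rule image_subsetI, intro CollectI conjI)
      fix X assume "X \<in> ?X"
      note X = X[OF this]
      show "lagrangian p mu (\<Phi> ` X)" by (rule X(5))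
      show "module_isomorphic class_ring (M\<lparr>carrier := \<Phi> ` X\<rparr>) (torsion_module p lam)"
        unfolding sub_isomorphic_iff[OF X(1,3)] by (rule X(4))
    qed
    show "preimage ` ?S \<subseteq> ?X"
    proof (rule image_subsetI)
      fix N assume "N \<in> ?S"
      then have N: "lagrangian p mu N" "module_isomorphic class_ring (M\<lparr>carrier := N\<rparr>) (torsion_module p lam)"
        by blast+
      then have sub: "submodule class_ring N M" unfolding lagrangian_def by blast
      obtain g where g: "g \<in> G" "g ` L0 = preimage N" using lagrangian_imp_orbit[OF N(1)] by blast
      have D: "preimage N \<subseteq> D" unfolding preimage_def by blast
      have "has_quotient smul (torsion_module p lam) (preimage N) \<Lambda>\<^sub>\<mu>"
        using N(2) sub_isomorphic_iff[OF submod_preimage(1)[OF sub] D]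
        unfolding image_preimage[OF submodule.subset[OF sub]] by blast
      then have "has_quotient_of_type lam (g ` L0) \<Lambda>\<^sub>\<mu>"
        unfolding has_quotient_of_type_def g(2) using submod_preimage(2)[OF sub] by blast
      then show "preimage N \<in> ?X" using g by blast
    qed
  qed
  then show ?thesis unfolding lagrangian_count_def by (rule bij_betw_same_card)
qed

lemma lattice_count_orbit:
  "lattice_count p n lam mu = card {g ` \<Lambda>\<^sub>\<mu> |g. g \<in> G \<and> has_quotient_of_type lam L0 (g ` \<Lambda>\<^sub>\<mu>)}"
proof -
  let ?X = "{g ` \<Lambda>\<^sub>\<mu> |g. g \<in> G \<and> has_quotient_of_type lam L0 (g ` \<Lambda>\<^sub>\<mu>)}"
  have "bij_betw ((`) (emb n)) (lattices p n lam mu) ?X"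
  proof (rule bij_betw_byWitness[where f' = "\<lambda>X. vec_of n ` X"])
    have lattD: "submodule (class_ring :: 'a ring) \<Lambda> L" "\<Lambda> \<subseteq> carrier_vec (2 * n)"
        "has_quotient smul (torsion_module p lam) L0 (emb n ` \<Lambda>)" "\<exists>g\<in>G. emb n ` \<Lambda> = g ` \<Lambda>\<^sub>\<mu>"
      if "\<Lambda> \<in> lattices p n lam mu" for \<Lambda>
    proof -
      show sub: "submodule (class_ring :: 'a ring) \<Lambda> L"
        using \<open>\<Lambda> \<in> _\<close> unfolding lattices_def Let_def by blast
      show "\<Lambda> \<subseteq> carrier_vec (2 * n)" using submodule.subset[OF sub] unfolding module_vec_simps .
      show "has_quotient smul (torsion_module p lam) L0 (emb n ` \<Lambda>)"
        using \<open>\<Lambda> \<in> _\<close> quot_isomorphic_iff[OF sub] unfolding lattices_def Let_def by blast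
      show "\<exists>g\<in>G. emb n ` \<Lambda> = g ` \<Lambda>\<^sub>\<mu>"
        using \<open>\<Lambda> \<in> _\<close> basis_imp_orbit[OF sub] unfolding lattices_def Let_def by blast
    qed
    show "\<forall>\<Lambda>\<in>lattices p n lam mu. vec_of n ` emb n ` \<Lambda> = \<Lambda>"
    proof
      fix \<Lambda> assume "\<Lambda> \<in> lattices p n lam mu"
      then have "(\<lambda>v. vec_of n (emb n v)) ` \<Lambda> = (\<lambda>v. v) ` \<Lambda>"
        using lattD(2) vec_of_emb by (intro image_cong) blast+
      then show "vec_of n ` emb n ` \<Lambda> = \<Lambda>" by (simp add: image_image)
    qed
    show "\<forall>X\<in>?X. emb n ` vec_of n ` X = X"
    proof
      fix X assume "X \<in> ?X"
      then have "X \<subseteq> L0" unfolding has_quotient_of_type_def by blast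
      then show "emb n ` vec_of n ` X = X" by (rule emb_vec_of_image)
    qed
    show "(`) (emb n) ` lattices p n lam mu \<subseteq> ?X"
    proof (rule image_subsetI)
      fix \<Lambda> assume "\<Lambda> \<in> lattices p n lam mu"
      note \<Lambda> = lattD[OF this]
      obtain g where g: "g \<in> G" "emb n ` \<Lambda> = g ` \<Lambda>\<^sub>\<mu>" using \<Lambda>(4) by blast
      have "emb n ` \<Lambda> \<subseteq> L0" using emb_L0 by blast
      then have "has_quotient_of_type lam L0 (g ` \<Lambda>\<^sub>\<mu>)" using \<Lambda>(3) unfolding has_quotient_of_type_def g(2) by blast
      then show "emb n ` \<Lambda> \<in> ?X" using g by blast
    qed
    show "(`) (vec_of n) ` ?X \<subseteq> lattices p n lam mu"
    proof (rule image_subsetI)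
      fix X assume "X \<in> ?X"
      then obtain g where g: "g \<in> G" "X = g ` \<Lambda>\<^sub>\<mu>" "g ` \<Lambda>\<^sub>\<mu> \<subseteq> L0"
        "has_quotient smul (torsion_module p lam) L0 (g ` \<Lambda>\<^sub>\<mu>)" unfolding has_quotient_of_type_def by blast
      let ?\<Lambda> = "vec_of n ` g ` \<Lambda>\<^sub>\<mu>"
      note \<Lambda> = orbit_imp_basis[OF g(1,3)]
      have iso: "module_isomorphic class_ring (quot_module L ?\<Lambda>) (torsion_module p lam)"
        unfolding quot_isomorphic_iff[OF \<Lambda>(1)] emb_vec_of_image[OF g(3)] by (rule g(4))
      have "?\<Lambda> \<in> lattices p n lam mu"
        unfolding lattices_def Let_def
        using \<Lambda> iso module_isomorphic_finite[OF iso finite_torsion_module] by blast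
      then show "vec_of n ` X \<in> lattices p n lam mu" unfolding g(2) .
    qed
  qed
  then show ?thesis unfolding lattice_count_def by (rule bij_betw_same_card)
qed

theorem lattice_count_eq:
  "real (lattice_count p n lam mu) =
    birkhoff n mu ((real q)\<^sup>2) * real (lagrangian_count p lam mu)"
  unfolding lattice_count_orbit lagrangian_count_orbit
proof (rule card_related)
  have L0_Y: "L0 \<in> Y" and \<Lambda>_Y: "\<Lambda>\<^sub>\<mu> \<in> Y" by (rule lat_Y)+
  show "L0 \<in> Y" "\<Lambda>\<^sub>\<mu> \<in> Y" by (fact L0_Y, fact \<Lambda>_Y)
  show "has_quotient_of_type lam (g ` X) (g ` \<Lambda>)" if "g \<in> G" "has_quotient_of_type lam X \<Lambda>" for g X \<Lambda>
    using has_quotient_image \<open>g \<in> G\<close> \<open>has_quotient_of_type lam X \<Lambda>\<close> image_mono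
    unfolding has_quotient_of_type_def by blast
  show "index L0 (g ` \<Lambda>\<^sub>\<mu>) = birkhoff n mu ((real q)\<^sup>2)" if g: "g \<in> G" for g
  proof -
    have "index L0 (g ` \<Lambda>\<^sub>\<mu>) = index L0 (g ` L0) * index (g ` L0) (g ` \<Lambda>\<^sub>\<mu>)"
      by (rule index_trans[OF L0_Y image_in[OF g L0_Y] image_in[OF g \<Lambda>_Y]])
    then show ?thesis
      unfolding index_L0_orbit[OF g] index_image[OF g] index_birkhoff[OF mu] by simp
  qed
  show "finite {g ` \<Lambda>\<^sub>\<mu> |g. g \<in> G \<and> has_quotient_of_type lam L0 (g ` \<Lambda>\<^sub>\<mu>)}"
    by (rule finite_subset[OF _ finite_orbit_below[of "(!) mu"]]) (auto simp: has_quotient_of_type_def)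
  show "finite {g ` L0 |g. g \<in> G \<and> has_quotient_of_type lam (g ` L0) \<Lambda>\<^sub>\<mu>}"
    by (rule finite_subset[OF _ finite_orbit_above[of "(!) mu"]]) (auto simp: has_quotient_of_type_def)
qed

end

theorem proposition1p5:
  fixes p :: "'a::idom" and q n :: nat and lam mu :: "nat list"
  assumes "compact_dvr (class_ring :: 'a ring) p q"
    and "n \<ge> 1"
    and "lam \<in> partitions (2 * n)"
    and "mu \<in> partitions n"
  shows "real (lattice_count p n lam mu) =
         real (lagrangian_count p lam mu) * birkhoff n mu ((real q)\<^sup>2)"
proof -
  interpret dvr_symplectic p q n mu by (rule dvr_symplectic.intro[OF assms(1,4)])
  show ?thesis unfolding lattice_count_eq by (rule mult.commute)
qed

end
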